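(* Let $\zeta(s)$ denote the Riemann zeta-function and write $s=\sigma+it$. There is an absolute constant $T_0>0$ such that for every $T>T_0$ and every $A>0.17$ there exists a radius $r$ with $$\exp(-T^{A})\le r\le \exp(-T^{A-0.17})$$ such that in the region $\{s : |s-(1/2+iT)|\le r \text{ and } \sigma<1/2\}$ the functions $\zeta(s)$ and $\zeta'(s)$ have the same number of zeros (counted with multiplicity). *)

theory Defs
  imports "HOL-Complex_Analysis.Complex_Analysis"
begin

(* The Riemann zeta-function as the analytic continuation of its Dirichlet series.
   The identity theorem determines it on the connected set - {1}; the value 0 at the
   pole is a convention that makes the description unique on the whole plane. *)
definition zeta :: "complex \<Rightarrow> complex" where
  "zeta = (THE f. f holomorphic_on - {1} \<and>
                  (\<forall>s. Re s > 1 \<longrightarrow> (\<lambda>n. of_nat (Suc n) powr (- s)) sums f s) \<and>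
                  f 1 = 0)"

definition zeros_in :: "(complex \<Rightarrow> complex) \<Rightarrow> complex set \<Rightarrow> complex set" where
  "zeros_in f S = {z \<in> S. f z = 0}"

(* Number of zeros with multiplicity. As with card, this is only meaningful
   if there are finitely many zeros in S. *)
definition num_zeros :: "(complex \<Rightarrow> complex) \<Rightarrow> complex set \<Rightarrow> nat" where
  "num_zeros f S = (\<Sum>z\<in>zeros_in f S. nat (zorder f z))"

definition left_half_disc :: "real \<Rightarrow> real \<Rightarrow> complex set" where
  "left_half_disc T r = {s. norm (s - Complex (1/2) T) \<le> r \<and> Re s < 1/2}"

end

theory Submission
  imports Defs "HOL-Real_Asymp.Real_Asymp"
begin

text \<open>
  On the critical line the functional equation gives
  $\mathrm{Re}\,\zeta'/\zeta(1/2+it) = \frac12\log\pi - \frac12\mathrm{Re}\,\psi(1/4+it/2)$, which tends to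
  minus infinity. Near $s_0 = 1/2+iT$ write $\zeta'/\zeta(s) = \sum_\rho m_\rho/(s-\rho) + h(s)$ with
  $O(\log T)$ zeros and $h' = O(\log T)$. The zeros are symmetric under $\rho\mapsto 1-\bar\rho$; the pair
  of poles at $\rho$ and $1-\bar\rho$ contributes a negative real part at points left of the line if
  $\rho$ is much closer to $s_0$ than $s$ is, and almost nothing if $\rho$ is much farther away.
  If no zero is closer to $s_0$ than $\exp(-T^A/3)$, then $r = \exp(-T^A)$ works. Otherwise,
  since $O(\log T)$ zeros cannot meet all of the more than $O(\log T)$ disjoint thick annuli with radii
  between $\exp(-T^A)$ and $\exp(-T^{A-0.17})$, some radius $r$ in one of them gives $\mathrm{Re}\,\zeta'/\zeta < 0$ on the
  whole left half circle, and by Rouche's theorem $\zeta$ and $\zeta'$ have equally many zeros inside.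
\<close>

text \<open>The case distinction is forced. At a point of the left arc with distance x to the
  critical line every reflected pair contributes a multiple of x. Around an annulus that is only
  logarithmically thick, from r/4 to L * r, the outer pairs may add up to N * x / (L * r)^2, far
  more than the fixed gain -1 inherited from the line; only an inner pair, worth about - x / r^2,
  beats them, once L^2 exceeds a multiple of N. Without an inner pair the zero-free region must be
  exponentially thick. The threshold does not depend on A: every size condition is monotone in T^A
  and already holds at T^0.17. The radii tried shrink by a total factor (log T)^(O(log T)), so
  T^0.17 must dominate log T * log log T. Zeros may lie on the critical line, so it cannot be part
  of a contour. The half disc is cut along a chord slightly to its left, beyond all zeros to be
  counted, where the real part is at most -1 plus a multiple of the shift. Everything about zeta is
  derived from the Dirichlet series in its definition.\<close>

subsection \<open>Analytic continuation by the trapezoidal rule\<close>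

text \<open>
  The error of the trapezoidal rule for $x^{-s}$ on $[n, n+1]$, multiplied by $s-1$ so that it is
  entire in $s$. Accordingly \<open>zeta_num s\<close> below is $(s-1)\zeta(s)$.
\<close>
definition trap_num :: "nat \<Rightarrow> complex \<Rightarrow> complex" where
  "trap_num n s = (s - 1) / 2 * (of_nat n powr (-s) + of_nat (Suc n) powr (-s))
     + of_nat (Suc n) powr (1 - s) - of_nat n powr (1 - s)"

definition zeta_num :: "complex \<Rightarrow> complex" where
  "zeta_num s = 1 + (s - 1) / 2 + (\<Sum>n. trap_num (Suc n) s)"

lemma has_vector_derivative_of_real_powr:
  assumes "x > 0"
  shows "((\<lambda>x. complex_of_real x powr a) has_vector_derivative a * of_real x powr (a - 1)) (at x within S)"
proof -
  have "((\<lambda>z. z powr a) has_field_derivative a * of_real x powr (a - 1)) (at (complex_of_real x))"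
    by (rule has_field_derivative_powr) (use assms in auto)
  from has_vector_derivative_real_field[OF this] show ?thesis .
qed

text \<open>Two integrations by parts against the quadratic \<open>(x - n) * (n + 1 - x)\<close>,
  which vanishes at both ends, replace \<open>x powr (- s)\<close> by its second derivative. This
  gains two powers of decay.\<close>

lemma trap_num_has_integral:
  assumes "n \<ge> 1"
  shows "((\<lambda>x. (s - 1) * s * (s + 1) / 2 * (of_real ((x - real n) * (real n + 1 - x)) * complex_of_real x powr (- s - 2)))
    has_integral trap_num n s) {real n..real n + 1}"
proof -
  \<comment> \<open>Explicit antiderivative: its first summand vanishes at both end points, the
    other two give the trapezoidal error.\<close>
  define H where "H = (\<lambda>x. - (s - 1) / 2 * s * (of_real ((x - real n) * (real n + 1 - x)) * complex_of_real x powr (- s - 1))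
     - (s - 1) / 2 * (of_real (2 * real n + 1 - 2 * x) * of_real x powr (- s)) + of_real x powr (1 - s))"
  have "((\<lambda>x. (s - 1) * s * (s + 1) / 2 * (of_real ((x - real n) * (real n + 1 - x)) * complex_of_real x powr (- s - 2)))
    has_integral (H (real n + 1) - H (real n))) {real n..real n + 1}"
  proof (rule fundamental_theorem_of_calculus)
    fix x assume x: "x \<in> {real n..real n + 1}"
    with assms have x0: "x > 0" by auto
    show "(H has_vector_derivative (s - 1) * s * (s + 1) / 2 * (of_real ((x - real n) * (real n + 1 - x)) * complex_of_real x powr (- s - 2))) (at x within {real n..real n + 1})"
      unfolding H_def
      apply (rule derivative_eq_intros has_vector_derivative_of_real_powr x0 has_vector_derivative_of_real 
         | simp (no_asm) only: has_real_derivative_iff_has_vector_derivative[symmetric])+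
      apply (auto simp: algebra_simps add_divide_distrib diff_divide_distrib)
      done
  qed auto
  also have "H (real n + 1) - H (real n) = trap_num n s"
    by (simp add: H_def trap_num_def algebra_simps add_divide_distrib diff_divide_distrib)
  finally show ?thesis .
qed

text \<open>The quadratic is at most 1/4 and the power decreases in x. The resulting decay is
  summable for Re s > -1, far enough left to contain the strip -1 < Re s < 2, which is symmetric
  under s -> 1 - s.\<close>

lemma norm_trap_num_le:
  assumes "n \<ge> 1" "Re s > -2"
  shows "norm (trap_num n s) \<le> norm ((s - 1) * s * (s + 1)) / 8 * real n powr (- Re s - 2)"
proof -
  have "norm (trap_num n s) \<le> norm ((s - 1) * s * (s + 1)) / 8 * real n powr (- Re s - 2)
       * measure lborel {real n..real n + 1}"
  proof (rule has_integral_bound_real[OF _ _ trap_num_has_integral[OF assms(1)], of _ "{}"])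
    show "norm ((s - 1) * s * (s + 1) / 2 * (of_real ((x - real n) * (real n + 1 - x)) * complex_of_real x powr (- s - 2)))
       \<le> norm ((s - 1) * s * (s + 1)) / 8 * real n powr (- Re s - 2)" if "x \<in> {real n..real n + 1} - {}" for x
    proof -
      have x: "x > 0" "x \<ge> real n" using that assms by auto
      have q: "\<bar>(x - real n) * (real n + 1 - x)\<bar> \<le> 1/4"
      proof -
        have "(x - real n) * (real n + 1 - x) \<ge> 0" using that by auto
        moreover have "1/4 - (x - real n) * (real n + 1 - x) = (x - real n - 1/2)^2"
          by (simp add: power2_eq_square algebra_simps)
        hence "(x - real n) * (real n + 1 - x) \<le> 1/4"
          using zero_le_power2[of "x - real n - 1/2"] by linarith
        ultimately show ?thesis by linarith
      qed
      have p: "x powr (- Re s - 2) \<le> real n powr (- Re s - 2)"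
        using x assms by (intro powr_mono2') auto
      have "norm ((s - 1) * s * (s + 1) / 2 * (of_real ((x - real n) * (real n + 1 - x)) * complex_of_real x powr (- s - 2)))
        = norm ((s - 1) * s * (s + 1)) / 2 * (\<bar>(x - real n) * (real n + 1 - x)\<bar> * x powr (- Re s - 2))"
        using x by (simp add: norm_mult norm_divide norm_powr_real_powr abs_mult del: of_real_mult of_real_diff of_real_add)
      also have "\<dots> \<le> norm ((s - 1) * s * (s + 1)) / 2 * (1 / 4 * real n powr (- Re s - 2))"
        by (intro mult_left_mono mult_mono q p) auto
      finally show ?thesis by simp
    qed
  qed auto
  thus ?thesis by simp
qed

lemma summable_powr_Suc: "(a::real) < -1 \<Longrightarrow> summable (\<lambda>n. real (Suc n) powr a)"
  using summable_Suc_iff[of "\<lambda>n. real n powr a"] summable_real_powr_iff[of a] by simp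

lemma summable_trap_num:
  assumes "Re s > -1"
  shows "summable (\<lambda>n. trap_num (Suc n) s)"
proof (rule summable_comparison_test')
  show "summable (\<lambda>n. norm ((s - 1) * s * (s + 1)) / 8 * real (Suc n) powr (- Re s - 2))"
    using assms by (intro summable_mult summable_powr_Suc) auto
  show "norm (trap_num (Suc n) s) \<le> norm ((s - 1) * s * (s + 1)) / 8 * real (Suc n) powr (- Re s - 2)" if "n \<ge> 0" for n
    using assms by (intro norm_trap_num_le) auto
qed

lemma norm_cubic_le:
  fixes s :: complex
  assumes "norm s \<le> B"
  shows "norm ((s - 1) * s * (s + 1)) \<le> (B + 1) ^ 3"
proof -
  have "norm (s - 1) \<le> B + 1" "norm (s + 1) \<le> B + 1"
    using assms norm_triangle_ineq4[of s 1] norm_triangle_ineq[of s 1] by (simp_all)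
  moreover have "norm s \<le> B + 1" using assms by simp
  ultimately have "norm (s - 1) * norm s * norm (s + 1) \<le> (B+1) * (B+1) * (B+1)"
    by (intro mult_mono) (auto intro: order.trans[OF norm_ge_zero])
  thus ?thesis by (simp add: norm_mult power3_eq_cube)
qed

lemma holomorphic_trap_num: "n \<ge> 1 \<Longrightarrow> trap_num n holomorphic_on A"
  unfolding trap_num_def[abs_def] by (intro holomorphic_intros) auto

lemma holomorphic_zeta_num: "zeta_num holomorphic_on {s. Re s > -1}"
proof -
  have "(\<lambda>s. \<Sum>n. trap_num (Suc n) s) holomorphic_on {s. Re s > -1}"
  proof (rule holomorphic_uniform_sequence)
    show "open {s. Re s > -1}" by (rule open_halfspace_Re_gt)
    show "(\<lambda>s. \<Sum>i<n. trap_num (Suc i) s) holomorphic_on {s. Re s > -1}" for n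
      by (intro holomorphic_on_sum holomorphic_trap_num) auto
    fix z assume z: "z \<in> {s. Re s > -1}"
    define d where "d = (Re z + 1) / 2"
    have d: "d > 0" using z by (simp add: d_def)
    have re: "Re s \<ge> -1 + d" if "s \<in> cball z d" for s
    proof -
      have "\<bar>Re (z - s)\<bar> \<le> d" using that abs_Re_le_cmod[of "z - s"] by (simp add: dist_norm)
      moreover have "2 * d = Re z + 1" by (simp add: d_def)
      ultimately show ?thesis by (simp add: abs_le_iff)
    qed
    have "uniform_limit (cball z d) (\<lambda>n s. \<Sum>i<n. trap_num (Suc i) s) (\<lambda>s. \<Sum>i. trap_num (Suc i) s) sequentially"
    proof (rule Weierstrass_m_test)
      show "summable (\<lambda>n. (norm z + d + 1) ^ 3 / 8 * real (Suc n) powr (- 1 - d))"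
        using d by (intro summable_mult summable_powr_Suc) auto
      fix n s assume s: "s \<in> cball z d"
      have ns: "norm s \<le> norm z + d"
        using s norm_triangle_ineq4[of z "z - s"] by (simp add: dist_norm)
      have "norm (trap_num (Suc n) s) \<le> norm ((s - 1) * s * (s + 1)) / 8 * real (Suc n) powr (- Re s - 2)"
        using re[OF s] d by (intro norm_trap_num_le) auto
      also have "\<dots> \<le> (norm z + d + 1) ^ 3 / 8 * real (Suc n) powr (- 1 - d)"
        using re[OF s] by (intro mult_mono divide_right_mono norm_cubic_le ns powr_mono) 
          (use d in auto)
      finally show "norm (trap_num (Suc n) s) \<le> (norm z + d + 1) ^ 3 / 8 * real (Suc n) powr (- 1 - d)" .
    qed
    moreover have "cball z d \<subseteq> {s. Re s > -1}"
      using re d by fastforce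
    ultimately show "\<exists>d. 0 < d \<and> cball z d \<subseteq> {s. Re s > -1} \<and> uniform_limit (cball z d) 
       (\<lambda>n s. \<Sum>i<n. trap_num (Suc i) s) (\<lambda>s. \<Sum>i. trap_num (Suc i) s) sequentially"
      using d by blast
  qed
  thus ?thesis unfolding zeta_num_def[abs_def] by (intro holomorphic_intros) auto
qed

text \<open>The abscissa -0.95 is the leftmost one of the disc of radius 285/100 about 19/10 + iT on
  which zeta is bounded later; the majorant exponent is 1.05 = 2 - 0.95.\<close>

lemma zeta_num_bound:
  "\<exists>K>0. \<forall>s. Re s \<ge> -0.95 \<longrightarrow> norm (zeta_num s) \<le> K * (norm s + 1) ^ 3"
proof -
  define S where "S = (\<Sum>n. real (Suc n) powr (-1.05))"
  have sm: "summable (\<lambda>n. real (Suc n) powr (-1.05))" by (rule summable_powr_Suc) simp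
  have S: "S \<ge> 0" unfolding S_def by (rule suminf_nonneg[OF sm]) simp
  have "norm (zeta_num s) \<le> (2 + S) * (norm s + 1) ^ 3" if s: "Re s \<ge> -0.95" for s
  proof -
    have le: "norm (trap_num (Suc n) s) \<le> (norm s + 1) ^ 3 * real (Suc n) powr (- 1.05)" for n
    proof -
      have "norm (trap_num (Suc n) s) \<le> norm ((s - 1) * s * (s + 1)) / 8 * real (Suc n) powr (- Re s - 2)"
        using s by (intro norm_trap_num_le) auto
      also have "\<dots> \<le> (norm s + 1) ^ 3 / 8 * real (Suc n) powr (- 1.05)"
        using s by (intro mult_mono divide_right_mono norm_cubic_le powr_mono) auto
      also have "\<dots> \<le> (norm s + 1) ^ 3 * real (Suc n) powr (- 1.05)"
        by (intro mult_right_mono) auto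
      finally show ?thesis .
    qed
    have "norm (\<Sum>n. trap_num (Suc n) s) \<le> (\<Sum>n. (norm s + 1) ^ 3 * real (Suc n) powr (- 1.05))"
      by (rule norm_suminf_le[OF le summable_mult[OF sm]])
    also have "\<dots> = (norm s + 1) ^ 3 * S" unfolding S_def by (rule suminf_mult[OF sm])
    finally have 1: "norm (\<Sum>n. trap_num (Suc n) s) \<le> (norm s + 1) ^ 3 * S" .
    have "norm (1 + (s - 1) / 2) = norm (s + 1) / 2"
    proof -
      have "1 + (s - 1) / 2 = (s + 1) / 2" by (simp add: field_simps)
      thus ?thesis by (simp only: norm_divide norm_numeral)
    qed
    also have "\<dots> \<le> norm s + 1" using norm_triangle_ineq[of s 1] norm_ge_zero[of s] unfolding norm_one by linarith
    also have "\<dots> \<le> (norm s + 1) ^ 3" 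
      using power_increasing[of 1 3 "norm s + 1"] by simp
    finally have 2: "norm (1 + (s - 1) / 2) \<le> (norm s + 1) ^ 3" .
    have "norm (zeta_num s) \<le> norm (1 + (s - 1) / 2) + norm (\<Sum>n. trap_num (Suc n) s)"
      unfolding zeta_num_def by (rule norm_triangle_ineq)
    also have "\<dots> \<le> (1 + S) * (norm s + 1) ^ 3" using 1 2 by (simp add: algebra_simps)
    also have "\<dots> \<le> (2 + S) * (norm s + 1) ^ 3" by (intro mult_right_mono) auto
    finally show ?thesis .
  qed
  thus ?thesis using S by (intro exI[of _ "2 + S"]) auto
qed

lemma sum_trap_num:
  "(\<Sum>n<N. trap_num (Suc n) s) = (s - 1) * (\<Sum>n<N. of_nat (Suc n) powr (-s))
     + (s - 1) / 2 * (of_nat (Suc N) powr (-s) - 1) + of_nat (Suc N) powr (1 - s) - 1"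
proof (induction N)
  case (Suc N)
  show ?case unfolding sum.lessThan_Suc Suc.IH unfolding trap_num_def
    by (simp add: algebra_simps add_divide_distrib diff_divide_distrib)
qed simp

lemma tendsto_of_nat_powr_0:
  assumes "Re a < 0"
  shows "(\<lambda>n. of_nat (Suc n) powr a :: complex) \<longlonglongrightarrow> 0"
proof (rule tendsto_norm_zero_cancel)
  have "(\<lambda>n. real (Suc n) powr Re a) \<longlonglongrightarrow> 0"
    by (rule tendsto_neg_powr[OF assms filterlim_compose[OF filterlim_real_sequentially filterlim_Suc]])
  thus "(\<lambda>n. norm (of_nat (Suc n) powr a :: complex)) \<longlonglongrightarrow> 0"
    by (simp add: norm_powr_real_powr)
qed

text \<open>Limit of the telescoped identity \<open>sum_trap_num\<close>: for Re s > 1 the powers of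
  N + 1 tend to 0, and what remains is s - 1 times the Dirichlet series.\<close>

lemma zeta_num_sums:
  assumes "Re s > 1"
  shows "(\<lambda>n. of_nat (Suc n) powr (-s)) sums (zeta_num s / (s - 1))"
proof -
  have s1: "s \<noteq> 1" using assms by auto
  have "(\<lambda>N. \<Sum>n<N. trap_num (Suc n) s) \<longlonglongrightarrow> (\<Sum>n. trap_num (Suc n) s)"
    using summable_trap_num[of s] assms by (intro summable_LIMSEQ) auto
  hence "(\<lambda>N. ((\<Sum>n<N. trap_num (Suc n) s) - ((s - 1) / 2 * (of_nat (Suc N) powr (-s) - 1) + of_nat (Suc N) powr (1 - s) - 1)) / (s - 1))
    \<longlonglongrightarrow> ((\<Sum>n. trap_num (Suc n) s) - ((s - 1) / 2 * (0 - 1) + 0 - 1)) / (s - 1)"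
    using assms s1 by (intro tendsto_intros tendsto_of_nat_powr_0) auto
  also have "((\<Sum>n. trap_num (Suc n) s) - ((s - 1) / 2 * (0 - 1) + 0 - 1)) / (s - 1) = zeta_num s / (s - 1)"
    by (simp add: zeta_num_def field_simps)
  also have "(\<lambda>N. ((\<Sum>n<N. trap_num (Suc n) s) - ((s - 1) / 2 * (of_nat (Suc N) powr (-s) - 1) + of_nat (Suc N) powr (1 - s) - 1)) / (s - 1))
     = (\<lambda>N. \<Sum>n<N. of_nat (Suc n) powr (-s))"
  proof
    fix N
    have "(\<Sum>n<N. trap_num (Suc n) s) - ((s - 1) / 2 * (of_nat (Suc N) powr (-s) - 1) + of_nat (Suc N) powr (1 - s) - 1)
       = (s - 1) * (\<Sum>n<N. of_nat (Suc n) powr (-s))" unfolding sum_trap_num by simp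
    thus "((\<Sum>n<N. trap_num (Suc n) s) - ((s - 1) / 2 * (of_nat (Suc N) powr (-s) - 1) + of_nat (Suc N) powr (1 - s) - 1)) / (s - 1)
      = (\<Sum>n<N. of_nat (Suc n) powr (-s))" using s1 by simp
  qed
  finally show ?thesis unfolding sums_def .
qed

lemma cnj_trap_num: "cnj (trap_num n s) = trap_num n (cnj s)"
  by (cases "n = 0") (simp_all add: trap_num_def cnj_powr)

lemma cnj_zeta_num:
  assumes "Re s > -1"
  shows "cnj (zeta_num s) = zeta_num (cnj s)"
proof -
  have "(\<lambda>n. trap_num (Suc n) s) sums (\<Sum>n. trap_num (Suc n) s)"
    using summable_trap_num[OF assms] by (rule summable_sums)
  hence "(\<lambda>n. cnj (trap_num (Suc n) s)) sums cnj (\<Sum>n. trap_num (Suc n) s)" by (simp only: sums_cnj)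
  thus ?thesis by (simp add: zeta_num_def cnj_trap_num sums_iff)
qed

subsection \<open>The functional equation on the real interval $(-1, 0)$\<close>

lemma power2_powr: "x > 0 \<Longrightarrow> (x\<^sup>2) powr c = x powr (2 * c)" for x c :: real
  by (simp add: powr_powr flip: powr_numeral)

text \<open>Stated in \<open>ennreal\<close>, like the integrals that follow, so that sums and
  integrals can later be interchanged without integrability checks.\<close>

lemma nn_integral_Gamma_scaled:
  assumes "a > 0" "x > (0::real)"
  shows "(\<integral>\<^sup>+u. ennreal (indicator {0<..} u * (u powr (a - 1) * exp (- (x * u)))) \<partial>lborel) = ennreal (Gamma a * x powr (- a))"
proof -
  have "ennreal (Gamma a) = (\<integral>\<^sup>+t. ennreal (indicator {0..} t * t powr (a - 1) / exp t) \<partial>lborel)"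
    by (rule Gamma_conv_nn_integral_real[OF assms(1)])
  also have "\<dots> = ennreal \<bar>x\<bar> * (\<integral>\<^sup>+u. ennreal (indicator {0..} (0 + x * u) * (0 + x * u) powr (a - 1) / exp (0 + x * u)) \<partial>lborel)"
    by (rule nn_integral_real_affine) (use assms in auto)
  also have "\<dots> = ennreal x * (\<integral>\<^sup>+u. ennreal (x powr (a - 1)) * ennreal (indicator {0<..} u * (u powr (a - 1) * exp (- (x * u)))) \<partial>lborel)"
    using assms by (intro arg_cong2[of _ _ _ _ "(*)"] nn_integral_cong)
      (auto simp: indicator_def powr_mult exp_minus field_simps zero_less_mult_iff zero_le_mult_iff simp flip: ennreal_mult')
  also have "\<dots> = ennreal (x powr a) * (\<integral>\<^sup>+u. ennreal (indicator {0<..} u * (u powr (a - 1) * exp (- (x * u)))) \<partial>lborel)"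
    using assms by (subst nn_integral_cmult) (auto simp: mult.assoc [symmetric] powr_mult_base simp flip: ennreal_mult')
  finally have *: "ennreal (Gamma a) = ennreal (x powr a) * (\<integral>\<^sup>+u. ennreal (indicator {0<..} u * (u powr (a - 1) * exp (- (x * u)))) \<partial>lborel)" (is "_ = _ * ?I") .
  have "ennreal (x powr (-a)) * ennreal (Gamma a) = ennreal (x powr (-a)) * ennreal (x powr a) * ?I"
    unfolding * by (simp add: mult.assoc)
  also have "ennreal (x powr (-a)) * ennreal (x powr a) = 1"
    using assms by (simp add: powr_minus flip: ennreal_mult')
  finally show ?thesis using assms by (simp add: ennreal_mult' mult.commute)
qed

text \<open>Substitution t = u^2 in the Gamma integral.\<close>

lemma nn_integral_gaussian_moment_1:
  assumes "b > (-1::real)"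
  shows "(\<integral>\<^sup>+u. ennreal (indicator {0<..} u * (u powr b * exp (- u\<^sup>2))) \<partial>lborel) = ennreal (Gamma ((b + 1) / 2) / 2)"
proof -
  define c where "c = (b + 1) / 2"
  have c: "c > 0" using assms by (simp add: c_def)
  define f where "f = (\<lambda>t::real. t powr (c - 1) / exp t)"
  have "(f has_integral Gamma c) {0..}"
    unfolding f_def by (rule Gamma_integral_real[OF c])
  hence "(f has_integral Gamma c) {0<..}"
    by (subst (asm) has_integral_spike_set_eq[of _ "{0<..}"]) (auto intro: negligible_subset[of "{0}"])
  moreover have "f absolutely_integrable_on {0<..}"
    using calculation by (intro nonnegative_absolutely_integrable_1) (auto simp: f_def has_integral_iff)
  moreover have im: "(\<lambda>u::real. u\<^sup>2) ` {0<..} = {0<..}"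
  proof
    show "{0<..} \<subseteq> (\<lambda>u::real. u\<^sup>2) ` {0<..}"
    proof
      fix x :: real assume "x \<in> {0<..}"
      thus "x \<in> (\<lambda>u::real. u\<^sup>2) ` {0<..}" by (intro image_eqI[of _ _ "sqrt x"]) auto
    qed
  qed auto
  ultimately have "f absolutely_integrable_on (\<lambda>u. u\<^sup>2) ` {0<..} \<and> integral ((\<lambda>u. u\<^sup>2) ` {0<..}) f = Gamma c"
    by (simp add: has_integral_iff)
  hence "(\<lambda>u. \<bar>2 * u\<bar> * f (u\<^sup>2)) absolutely_integrable_on {0<..} \<and> integral {0<..} (\<lambda>u. \<bar>2 * u\<bar> * f (u\<^sup>2)) = Gamma c"
    by (subst has_absolute_integral_change_of_variables_1')
       (auto intro!: derivative_eq_intros inj_onI)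
  hence "((\<lambda>u. \<bar>2 * u\<bar> * f (u\<^sup>2)) has_integral Gamma c) {0<..}"
    using absolutely_integrable_on_def has_integral_iff by blast
  hence "((\<lambda>u. 1/2 * (\<bar>2 * u\<bar> * f (u\<^sup>2))) has_integral (1/2 * Gamma c)) {0<..}"
    by (rule has_integral_mult_right)
  also have "?this \<longleftrightarrow> ((\<lambda>u. u powr b * exp (- u\<^sup>2)) has_integral (1/2 * Gamma c)) {0<..}"
  proof (rule has_integral_cong)
    fix u :: real assume "u \<in> {0<..}"
    hence u: "u > 0" by simp
    have "(u\<^sup>2) powr (c - 1) = u powr (b - 1)"
    proof -
      have "2 * (c - 1) = b - 1" by (simp add: c_def field_simps)
      thus ?thesis using power2_powr[OF u, of "c - 1"] by (simp only:)
    qed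
    moreover have "u * u powr (b - 1) = u powr b" using u by (simp add: powr_mult_base)
    ultimately show "1/2 * (\<bar>2 * u\<bar> * f (u\<^sup>2)) = u powr b * exp (- u\<^sup>2)"
      using u by (simp add: f_def exp_minus field_simps)
  qed
  finally have "((\<lambda>u. u powr b * exp (- u\<^sup>2)) has_integral (1/2 * Gamma c)) {0<..}" .
  from nn_integral_has_integral_lebesgue[OF _ this] show ?thesis by (simp add: c_def)
qed

lemma nn_integral_gaussian_moment:
  assumes "b > (-1::real)" "v > 0"
  shows "(\<integral>\<^sup>+u. ennreal (indicator {0<..} u * (u powr b * exp (- (v * u\<^sup>2)))) \<partial>lborel) = ennreal (Gamma ((b + 1) / 2) / 2 * v powr (- ((b + 1) / 2)))"
proof -
  define x where "x = sqrt v"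
  have x: "x > 0" "x\<^sup>2 = v" using assms by (auto simp: x_def)
  have "ennreal (Gamma ((b + 1) / 2) / 2) = (\<integral>\<^sup>+u. ennreal (indicator {0<..} u * (u powr b * exp (- u\<^sup>2))) \<partial>lborel)"
    by (rule nn_integral_gaussian_moment_1[OF assms(1), symmetric])
  also have "\<dots> = ennreal \<bar>x\<bar> * (\<integral>\<^sup>+u. ennreal (indicator {0<..} (0 + x * u) * ((0 + x * u) powr b * exp (- (0 + x * u)\<^sup>2))) \<partial>lborel)"
    by (rule nn_integral_real_affine) (use x in auto)
  also have "\<dots> = ennreal x * (\<integral>\<^sup>+u. ennreal (x powr b) * ennreal (indicator {0<..} u * (u powr b * exp (- (v * u\<^sup>2)))) \<partial>lborel)"
    using x by (intro arg_cong2[of _ _ _ _ "(*)"] nn_integral_cong)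
      (auto simp: indicator_def powr_mult exp_minus field_simps zero_less_mult_iff power_mult_distrib simp flip: ennreal_mult')
  also have "\<dots> = ennreal (x powr (b + 1)) * (\<integral>\<^sup>+u. ennreal (indicator {0<..} u * (u powr b * exp (- (v * u\<^sup>2)))) \<partial>lborel)"
    using x by (subst nn_integral_cmult) (auto simp: mult.assoc [symmetric] powr_mult_base add.commute simp flip: ennreal_mult')
  finally have *: "ennreal (Gamma ((b + 1) / 2) / 2) = ennreal (x powr (b + 1)) * (\<integral>\<^sup>+u. ennreal (indicator {0<..} u * (u powr b * exp (- (v * u\<^sup>2)))) \<partial>lborel)" (is "_ = _ * ?I") .
  have xv: "v powr (- ((b + 1) / 2)) = x powr (- (b + 1))"
  proof -
    have "2 * - ((b + 1) / 2) = - (b + 1)" by (simp add: field_simps)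
    thus ?thesis using power2_powr[OF x(1), of "- ((b + 1) / 2)"] unfolding x(2) by (simp only:)
  qed
  have "ennreal (x powr (-(b+1))) * ennreal (Gamma ((b + 1) / 2) / 2) = ennreal (x powr (-(b+1))) * ennreal (x powr (b+1)) * ?I"
    unfolding * by (simp add: mult.assoc)
  also have "ennreal (x powr (-(b+1))) * ennreal (x powr (b+1)) = 1"
    using x by (simp add: powr_minus flip: ennreal_mult' powr_add)
  finally have "?I = ennreal (x powr (-(b+1))) * ennreal (Gamma ((b + 1) / 2) / 2)" by (simp only: mult_1_left)
  also have "\<dots> = ennreal (Gamma ((b + 1) / 2) / 2 * x powr (-(b+1)))"
    by (subst (2) mult.commute, rule ennreal_mult' [symmetric]) simp
  finally show ?thesis unfolding xv .
qed

text \<open>Write 1 / (u^2 + a^2) as the integral of exp (- v (u^2 + a^2)) over v > 0 and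
  interchange: the u-integral is a Gaussian moment, the v-integral a Gamma integral. The Gamma
  product is kept instead of pi / cos (pi b / 2), since it fits the duplication formula used
  later.\<close>

lemma nn_integral_Lorentzian_moment:
  assumes b: "b > (-1::real)" "b < 1" and a: "a > 0"
  shows "(\<integral>\<^sup>+u. ennreal (indicator {0<..} u * (u powr b / (u\<^sup>2 + a\<^sup>2))) \<partial>lborel) 
    = ennreal (Gamma ((1 + b) / 2) * Gamma ((1 - b) / 2) / 2 * a powr (b - 1))"
proof -
  define F where "F = (\<lambda>u v::real. ennreal (indicator {0<..} u * indicator {0<..} v * (u powr b * exp (- (v * (u\<^sup>2 + a\<^sup>2))))))"
  have "(\<integral>\<^sup>+u. ennreal (indicator {0<..} u * (u powr b / (u\<^sup>2 + a\<^sup>2))) \<partial>lborel)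
     = (\<integral>\<^sup>+u. \<integral>\<^sup>+v. F u v \<partial>lborel \<partial>lborel)"
  proof (rule nn_integral_cong)
    fix u :: real
    show "ennreal (indicator {0<..} u * (u powr b / (u\<^sup>2 + a\<^sup>2))) = (\<integral>\<^sup>+v. F u v \<partial>lborel)"
    proof (cases "u > 0")
      case u: True
      have p: "u\<^sup>2 + a\<^sup>2 > 0" using u by (intro add_pos_nonneg) auto
      have "(\<integral>\<^sup>+v. F u v \<partial>lborel) = (\<integral>\<^sup>+v. ennreal (u powr b) * ennreal (indicator {0<..} v * (v powr (1 - 1) * exp (- ((u\<^sup>2 + a\<^sup>2) * v)))) \<partial>lborel)"
        using u by (intro nn_integral_cong) (auto simp: F_def indicator_def mult.commute simp flip: ennreal_mult')
      also have "\<dots> = ennreal (u powr b) * ennreal (Gamma 1 * (u\<^sup>2 + a\<^sup>2) powr (- 1))"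
        by (subst nn_integral_cmult) (use nn_integral_Gamma_scaled[of 1, OF _ p] in auto)
      also have "\<dots> = ennreal (indicator {0<..} u * (u powr b / (u\<^sup>2 + a\<^sup>2)))"
        using u p by (simp add: powr_minus field_simps flip: ennreal_mult')
      finally show ?thesis ..
    qed (simp add: F_def)
  qed
  also have "\<dots> = (\<integral>\<^sup>+v. \<integral>\<^sup>+u. F u v \<partial>lborel \<partial>lborel)"
    by (rule lborel_pair.Fubini') (simp add: F_def case_prod_unfold)
  also have "\<dots> = (\<integral>\<^sup>+v. ennreal (Gamma ((b + 1) / 2) / 2) * ennreal (indicator {0<..} v * (v powr ((1 - b) / 2 - 1) * exp (- (a\<^sup>2 * v)))) \<partial>lborel)"
  proof (rule nn_integral_cong)
    fix v :: real
    show "(\<integral>\<^sup>+u. F u v \<partial>lborel) = ennreal (Gamma ((b + 1) / 2) / 2) * ennreal (indicator {0<..} v * (v powr ((1 - b) / 2 - 1) * exp (- (a\<^sup>2 * v))))"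
    proof (cases "v > 0")
      case v: True
      have G: "Gamma ((b + 1) / 2) \<ge> 0" using b by (intro less_imp_le Gamma_real_pos) auto
      have "(\<integral>\<^sup>+u. F u v \<partial>lborel) = (\<integral>\<^sup>+u. ennreal (exp (- (a\<^sup>2 * v))) * ennreal (indicator {0<..} u * (u powr b * exp (- (v * u\<^sup>2)))) \<partial>lborel)"
        using v by (intro nn_integral_cong) (auto simp: F_def indicator_def exp_add[symmetric] algebra_simps simp flip: ennreal_mult')
      also have "\<dots> = ennreal (exp (- (a\<^sup>2 * v))) * ennreal (Gamma ((b + 1) / 2) / 2 * v powr (- ((b + 1) / 2)))"
        by (subst nn_integral_cmult) (use nn_integral_gaussian_moment[OF b(1) v] in auto)
      also have "(- ((b + 1) / 2)) = (1 - b) / 2 - 1" by (simp add: field_simps)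
      finally show ?thesis using v G by (simp add: mult_ac flip: ennreal_mult')
    qed (simp add: F_def)
  qed
  also have "\<dots> = ennreal (Gamma ((b + 1) / 2) / 2) * ennreal (Gamma ((1 - b) / 2) * (a\<^sup>2) powr (- ((1 - b) / 2)))"
    by (subst nn_integral_cmult) (use nn_integral_Gamma_scaled[of "(1-b)/2" "a\<^sup>2"] b a in auto)
  also have "(a\<^sup>2) powr (- ((1 - b) / 2)) = a powr (b - 1)"
  proof -
    have "2 * - ((1 - b) / 2) = b - 1" by (simp add: field_simps)
    thus ?thesis using power2_powr[OF a, of "- ((1 - b) / 2)"] by (simp only:)
  qed
  finally show ?thesis using b 
    by (subst (asm) ennreal_mult' [symmetric]) (auto simp: Gamma_real_pos less_imp_le add.commute)
qed

text \<open>The left member of the limit is coth (u/2). Differentiating the reflection formula for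
  \<open>rGamma\<close> gives pi cot (pi z) = Digamma (1 - z) - Digamma z; at z = iu / (2 pi) the
  two Digamma series yield the partial fractions.\<close>

lemma coth_partial_fractions:
  assumes u: "u > (0::real)"
  shows "(\<lambda>k. 4 * u / (u\<^sup>2 + (2 * pi * real (Suc k))\<^sup>2)) sums ((1 + exp (-u)) / (1 - exp (-u)) - 2 / u)"
proof -
  define y where "y = u / (2 * pi)"
  have y: "y > 0" using u by (simp add: y_def)
  define z where "z = \<i> * complex_of_real y"
  have z0: "z \<noteq> 0" "1 - z \<noteq> 0" "1 + z \<noteq> 0" using y by (auto simp: z_def complex_eq_iff)
  have zn: "z \<notin> \<int>\<^sub>\<le>\<^sub>0" "1 - z \<notin> \<int>\<^sub>\<le>\<^sub>0" 
    using y by (auto simp: z_def complex_eq_iff elim!: nonpos_Ints_cases)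
  have "((\<lambda>z. rGamma z * rGamma (1 - z)) has_field_derivative 
      (- rGamma z * Digamma z * rGamma (1 - z) + rGamma z * (rGamma (1 - z) * Digamma (1 - z)))) (at z)"
    using zn by (auto intro!: derivative_eq_intros simp: field_simps)
  moreover have "((\<lambda>z. rGamma z * rGamma (1 - z)) has_field_derivative cos (of_real pi * z)) (at z)"
    unfolding rGamma_reflection_complex by (auto intro!: derivative_eq_intros)
  ultimately have "(- rGamma z * Digamma z * rGamma (1 - z) + rGamma z * (rGamma (1 - z) * Digamma (1 - z))) = cos (of_real pi * z)"
    by (rule DERIV_unique)
  hence "(rGamma z * rGamma (1 - z)) * (Digamma (1 - z) - Digamma z) = cos (of_real pi * z)"
    by (simp add: algebra_simps)
  hence 1: "sin (of_real pi * z) * (Digamma (1 - z) - Digamma z) = of_real pi * cos (of_real pi * z)"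
    unfolding rGamma_reflection_complex by (simp add: field_simps)
  \<comment> \<open>Shifting to \<open>1 + z\<close> pairs 1 / (k + z) with 1 / (k - z) for k >= 1;
    the split-off term 1/z is the origin of 2/u.\<close>
  have 2: "Digamma z = Digamma (1 + z) - 1 / z"
    using Digamma_plus1[OF z0(1)] by (simp add: add.commute)
  have "(\<lambda>n. (inverse (of_nat (Suc n)) - inverse ((1 - z) + of_nat n)) - (inverse (of_nat (Suc n)) - inverse ((1 + z) + of_nat n)))
     sums ((Digamma (1 - z) + euler_mascheroni) - (Digamma (1 + z) + euler_mascheroni))"
    unfolding Digamma_def using summable_Digamma[OF z0(2)] summable_Digamma[OF z0(3)]
    by (intro sums_diff) (simp_all add: summable_sums)
  also have "(\<lambda>n. (inverse (of_nat (Suc n)) - inverse ((1 - z) + of_nat n)) - (inverse (of_nat (Suc n)) - inverse ((1 + z) + of_nat n)))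
     = (\<lambda>n. - (\<i> * of_real (2 * y / ((real (Suc n))\<^sup>2 + y\<^sup>2))))"
  proof
    fix n
    have nz: "of_nat (Suc n) - z \<noteq> 0" "of_nat (Suc n) + z \<noteq> 0" using y by (auto simp: z_def complex_eq_iff)
    have p: "(complex_of_real ((real (Suc n))\<^sup>2 + y\<^sup>2)) = (of_nat (Suc n) - z) * (of_nat (Suc n) + z)"
      by (simp add: z_def algebra_simps power2_eq_square)
    have "(inverse (of_nat (Suc n)) - inverse ((1 - z) + of_nat n)) - (inverse (of_nat (Suc n)) - inverse ((1 + z) + of_nat n))
       = inverse (of_nat (Suc n) + z) - inverse (of_nat (Suc n) - z)" by (simp add: algebra_simps)
    also have "\<dots> = - 2 * z / ((of_nat (Suc n) - z) * (of_nat (Suc n) + z))"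
      using nz by (simp add: divide_simps)
    also have "\<dots> = - (\<i> * of_real (2 * y / ((real (Suc n))\<^sup>2 + y\<^sup>2)))"
      by (subst p[symmetric]) (simp add: z_def)
    finally show "(inverse (of_nat (Suc n)) - inverse ((1 - z) + of_nat n)) - (inverse (of_nat (Suc n)) - inverse ((1 + z) + of_nat n))
     = - (\<i> * of_real (2 * y / ((real (Suc n))\<^sup>2 + y\<^sup>2)))" .
  qed
  finally have "(\<lambda>n. \<i> * (- (\<i> * of_real (2 * y / ((real (Suc n))\<^sup>2 + y\<^sup>2))))) sums (\<i> * (Digamma (1 - z) - Digamma (1 + z)))"
    by (intro sums_mult) simp
  hence "(\<lambda>n. complex_of_real (2 * y / ((real (Suc n))\<^sup>2 + y\<^sup>2))) sums (\<i> * (Digamma (1 - z) - Digamma (1 + z)))"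
    by (simp add: mult.assoc[symmetric])
  moreover have "\<i> * (Digamma (1 - z) - Digamma (1 + z)) = of_real (pi * (1 + exp (-u)) / (1 - exp (-u)) - 1 / y)"
  proof -
    have e: "1 - exp (-u) > 0" using u by simp
    have s: "sin (of_real pi * z) = \<i> * of_real (exp (u/2) * (1 - exp (-u)) / 2)"
    proof -
      have e: "\<i> * (of_real pi * z) = of_real (-(u/2))" using pi_gt_zero by (simp add: z_def y_def)
      have "sin (of_real pi * z) = \<i> * of_real ((exp (u/2) - exp (-(u/2))) / 2)"
        unfolding sin_exp_eq e of_real_minus[symmetric] minus_minus exp_of_real by (simp add: field_simps)
      also have "exp (u/2) - exp (-(u/2)) = exp (u/2) * (1 - exp (-u))"
        by (simp add: algebra_simps flip: exp_add)
      finally show ?thesis .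
    qed
    have c: "cos (of_real pi * z) = of_real (exp (u/2) * (1 + exp (-u)) / 2)"
    proof -
      have e: "\<i> * (of_real pi * z) = of_real (-(u/2))" using pi_gt_zero by (simp add: z_def y_def)
      have "cos (of_real pi * z) = of_real ((exp (u/2) + exp (-(u/2))) / 2)"
        unfolding cos_exp_eq e of_real_minus[symmetric] minus_minus exp_of_real by (simp add: field_simps)
      also have "exp (u/2) + exp (-(u/2)) = exp (u/2) * (1 + exp (-u))"
        by (simp add: algebra_simps flip: exp_add)
      finally show ?thesis .
    qed
    have "\<i> * of_real (exp (u/2) * (1 - exp (-u)) / 2) * (Digamma (1 - z) - Digamma z) = of_real pi * of_real (exp (u/2) * (1 + exp (-u)) / 2)"
      using 1 unfolding s c .
    hence "of_real (exp (u/2) / 2) * (of_real (1 - exp (-u)) * (\<i> * (Digamma (1 - z) - Digamma z))) = of_real (exp (u/2) / 2) * of_real (pi * (1 + exp (-u)))"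
      by (simp add: mult_ac)
    hence "of_real (1 - exp (-u)) * (\<i> * (Digamma (1 - z) - Digamma z)) = of_real (pi * (1 + exp (-u)))"
      by (subst (asm) mult_cancel_left) simp
    hence "\<i> * (Digamma (1 - z) - Digamma z) = of_real (pi * (1 + exp (-u))) / of_real (1 - exp (-u))"
      using e by (metis less_irrefl nonzero_mult_div_cancel_left of_real_eq_0_iff)
    moreover have "\<i> * (1 / z) = of_real (1 / y)" using y by (simp add: z_def)
    ultimately show ?thesis unfolding 2 by (simp add: algebra_simps)
  qed
  ultimately have "(\<lambda>n. 2 * y / ((real (Suc n))\<^sup>2 + y\<^sup>2)) sums (pi * (1 + exp (-u)) / (1 - exp (-u)) - 1 / y)"
    by (simp only: sums_of_real_iff)
  hence "(\<lambda>n. 1 / pi * (2 * y / ((real (Suc n))\<^sup>2 + y\<^sup>2))) sums (1 / pi * (pi * (1 + exp (-u)) / (1 - exp (-u)) - 1 / y))"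
    by (rule sums_mult)
  also have "1 / pi * (pi * (1 + exp (-u)) / (1 - exp (-u)) - 1 / y) = (1 + exp (-u)) / (1 - exp (-u)) - 2 / u"
    using u by (simp add: y_def right_diff_distrib)
  also have "(\<lambda>n. 1 / pi * (2 * y / ((real (Suc n))\<^sup>2 + y\<^sup>2))) = (\<lambda>k. 4 * u / (u\<^sup>2 + (2 * pi * real (Suc k))\<^sup>2))"
  proof
    fix n
    have "(real (Suc n))\<^sup>2 + y\<^sup>2 = (u\<^sup>2 + (2 * pi * real (Suc n))\<^sup>2) / (4 * pi\<^sup>2)"
      by (simp add: y_def power_divide power_mult_distrib add_divide_distrib)
    thus "1 / pi * (2 * y / ((real (Suc n))\<^sup>2 + y\<^sup>2)) = 4 * u / (u\<^sup>2 + (2 * pi * real (Suc n))\<^sup>2)"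
      by (simp add: y_def power2_eq_square)
  qed
  finally show ?thesis .
qed

text \<open>The same integration by parts with exp (- x u) in place of a power of x. The dependence
  on n is a pure factor \<open>exp (-u) ^ n\<close>, so the sum over n will be geometric.\<close>

lemma trapezoid_exp_has_integral:
  fixes u :: real and n :: nat
  assumes "u > 0"
  shows "((\<lambda>x. (x - real n) * (real n + 1 - x) * (u\<^sup>2 * exp (- (x * u)))) has_integral
    exp (-u) ^ n * ((1 + exp (-u)) - 2 * (1 - exp (-u)) / u)) {real n..real n + 1}"
proof -
  define H where "H = (\<lambda>x. - ((x - real n) * (real n + 1 - x) * (u * exp (- (x * u)))) - (2 * real n + 1 - 2 * x) * exp (- (x * u)) + 2 * exp (- (x * u)) / u)"
  have "((\<lambda>x. (x - real n) * (real n + 1 - x) * (u\<^sup>2 * exp (- (x * u)))) has_integral (H (real n + 1) - H (real n))) {real n..real n + 1}"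
  proof (rule fundamental_theorem_of_calculus)
    show "(H has_vector_derivative (x - real n) * (real n + 1 - x) * (u\<^sup>2 * exp (- (x * u)))) (at x within {real n..real n + 1})" for x
      unfolding H_def has_real_derivative_iff_has_vector_derivative[symmetric] using assms
      by (auto intro!: derivative_eq_intros simp: algebra_simps power2_eq_square)
  qed auto
  also have "H (real n + 1) - H (real n) = exp (-u) ^ n * ((1 + exp (-u)) - 2 * (1 - exp (-u)) / u)"
  proof -
    have e: "exp (- (real n * u)) = exp (-u) ^ n" by (simp add: exp_of_nat_mult[symmetric])
    have e': "exp (- ((real n + 1) * u)) = exp (-u) ^ n * exp (-u)"
      by (simp add: e[symmetric] algebra_simps flip: exp_add)
    show ?thesis unfolding H_def e e' by (simp add: algebra_simps diff_divide_distrib)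
  qed
  finally show ?thesis .
qed

text \<open>
  The value of $\int_n^{n+1}(x-n)(n+1-x)x^{-\sigma-2}\,dx$ for $-1 < \sigma < 0$; the interval $n = 0$
  is separate because \<open>trap_num 0\<close> is meaningless at the singularity $x = 0$.
\<close>
definition trap_int :: "real \<Rightarrow> nat \<Rightarrow> real" where
  "trap_int \<sigma> n = (if n = 0 then 1 / (- \<sigma> * (1 - \<sigma>)) else Re (trap_num n (of_real \<sigma>)) / ((\<sigma> - 1) * \<sigma> * (\<sigma> + 1) / 2))"

lemma trap_int_has_integral:
  assumes s: "-1 < \<sigma>" "\<sigma> < 0"
  shows "((\<lambda>x. (x - real n) * (real n + 1 - x) * x powr (- \<sigma> - 2)) has_integral trap_int \<sigma> n) {real n..real n + 1}"
proof (cases "n = 0")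
  case True
  have "((\<lambda>x. x powr (- \<sigma> - 1) - x powr (- \<sigma>)) has_integral
     (1 powr (- \<sigma> - 1 + 1) / (- \<sigma> - 1 + 1) - 1 powr (- \<sigma> + 1) / (- \<sigma> + 1))) {0..1}"
    using s by (intro has_integral_diff has_integral_powr_from_0) auto
  also have "(1 powr (- \<sigma> - 1 + 1) / (- \<sigma> - 1 + 1) - 1 powr (- \<sigma> + 1) / (- \<sigma> + 1)) = trap_int \<sigma> n"
    using s True by (simp add: trap_int_def divide_simps)
  finally have "((\<lambda>x. x powr (- \<sigma> - 1) - x powr (- \<sigma>)) has_integral trap_int \<sigma> n) {0..1}" .
  also have "?this \<longleftrightarrow> ((\<lambda>x. (x - real n) * (real n + 1 - x) * x powr (- \<sigma> - 2)) has_integral trap_int \<sigma> n) {0..1}"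
  proof (rule has_integral_cong)
    fix x :: real assume x: "x \<in> {0..1}"
    show "x powr (- \<sigma> - 1) - x powr (- \<sigma>) = (x - real n) * (real n + 1 - x) * x powr (- \<sigma> - 2)"
    \<comment> \<open>At x = 0 both sides are 0, because \<open>0 powr a = 0\<close> whatever the
      exponent.\<close>
    proof (cases "x = 0")
      case False
      hence "x * x powr (- \<sigma> - 2) = x powr (- \<sigma> - 1)" "x * x powr (- \<sigma> - 1) = x powr (- \<sigma>)"
      proof -
        have e: "1 + (- \<sigma> - 2) = - \<sigma> - 1" "1 + (- \<sigma> - 1) = - \<sigma>" by auto
        show "x * x powr (- \<sigma> - 2) = x powr (- \<sigma> - 1)" "x * x powr (- \<sigma> - 1) = x powr (- \<sigma>)"
          using x powr_mult_base[of x "- \<sigma> - 2"] powr_mult_base[of x "- \<sigma> - 1"] unfolding e by auto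
      qed
      moreover have "(x - real n) * (real n + 1 - x) * x powr (- \<sigma> - 2) = x * x powr (- \<sigma> - 2) - x * (x * x powr (- \<sigma> - 2))"
        using True by (simp add: algebra_simps)
      ultimately show ?thesis by simp
    qed (use True in auto)
  qed
  finally show ?thesis using True by simp
next
  case False
  define c where "c = (\<sigma> - 1) * \<sigma> * (\<sigma> + 1) / 2"
  have c: "c \<noteq> 0" using s by (simp add: c_def)
  have "((\<lambda>x. Re ((of_real \<sigma> - 1) * of_real \<sigma> * (of_real \<sigma> + 1) / 2 * (of_real ((x - real n) * (real n + 1 - x)) * complex_of_real x powr (- of_real \<sigma> - 2)))) has_integral
       Re (trap_num n (of_real \<sigma>))) {real n..real n + 1}"
    using has_integral_linear[OF trap_num_has_integral[of n "of_real \<sigma>"] bounded_linear_Re] False by (simp add: o_def)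
  also have "?this \<longleftrightarrow> ((\<lambda>x. c * ((x - real n) * (real n + 1 - x) * x powr (- \<sigma> - 2))) has_integral Re (trap_num n (of_real \<sigma>))) {real n..real n + 1}"
  proof (rule has_integral_cong)
    fix x assume "x \<in> {real n..real n + 1}"
    hence x: "x \<ge> 0" by auto
    have p: "complex_of_real x powr (- of_real \<sigma> - 2) = of_real (x powr (- \<sigma> - 2))"
      using powr_of_real[OF x, of "- \<sigma> - 2"] by simp
    have "(of_real \<sigma> - 1) * of_real \<sigma> * (of_real \<sigma> + 1) / 2 = complex_of_real c" by (simp add: c_def)
    thus "Re ((of_real \<sigma> - 1) * of_real \<sigma> * (of_real \<sigma> + 1) / 2 * (of_real ((x - real n) * (real n + 1 - x)) * complex_of_real x powr (- of_real \<sigma> - 2))) = c * ((x - real n) * (real n + 1 - x) * x powr (- \<sigma> - 2))"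
      unfolding p by (simp only: of_real_mult[symmetric] Re_complex_of_real)
  qed
  finally have "((\<lambda>x. 1 / c * (c * ((x - real n) * (real n + 1 - x) * x powr (- \<sigma> - 2)))) has_integral (1 / c * Re (trap_num n (of_real \<sigma>)))) {real n..real n + 1}"
    by (rule has_integral_mult_right)
  thus ?thesis using c False by (simp add: trap_int_def c_def [symmetric] mult.assoc[symmetric])
qed

text \<open>For -1 < \<sigma> < 0 the integral over [0, 1] converges, and its value is exactly the
  head \<open>1 + (s - 1) / 2\<close> of \<open>zeta_num\<close> after division by the common
  factor. Hence the whole of \<open>zeta_num\<close> is one integral over x > 0 with a nonnegative
  integrand.\<close>

lemma trap_int_sums:
  assumes s: "-1 < \<sigma>" "\<sigma> < 0"
  shows "trap_int \<sigma> sums (2 * Re (zeta_num (of_real \<sigma>)) / ((\<sigma> - 1) * \<sigma> * (\<sigma> + 1)))"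
proof -
  define c where "c = (\<sigma> - 1) * \<sigma> * (\<sigma> + 1) / 2"
  have c: "c \<noteq> 0" using s by (simp add: c_def)
  have "(\<lambda>n. trap_num (Suc n) (of_real \<sigma>)) sums (\<Sum>n. trap_num (Suc n) (of_real \<sigma>))"
    using s by (intro summable_sums summable_trap_num) auto
  hence "(\<lambda>n. Re (trap_num (Suc n) (of_real \<sigma>)) / c) sums (Re (\<Sum>n. trap_num (Suc n) (of_real \<sigma>)) / c)"
    by (intro sums_divide sums_Re)
  hence "(\<lambda>n. trap_int \<sigma> (Suc n)) sums (Re (\<Sum>n. trap_num (Suc n) (of_real \<sigma>)) / c)"
    by (simp add: trap_int_def c_def)
  hence "trap_int \<sigma> sums (Re (\<Sum>n. trap_num (Suc n) (of_real \<sigma>)) / c + trap_int \<sigma> 0)"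
    by (rule sums_Suc)
  also have "trap_int \<sigma> 0 = (1 + (\<sigma> - 1) / 2) / c"
    using s unfolding trap_int_def c_def by (simp add: divide_simps) (simp add: algebra_simps)
  also have "Re (\<Sum>n. trap_num (Suc n) (of_real \<sigma>)) / c + (1 + (\<sigma> - 1) / 2) / c = Re (zeta_num (of_real \<sigma>)) / c"
    by (simp add: zeta_num_def add_divide_distrib)
  finally show ?thesis by (simp add: c_def mult.commute)
qed

text \<open>Write the power of x as a Gamma integral of u powr (\<sigma> + 1) * exp (- x u) and
  interchange; the factor u^2 moves into the x-integral, which is then
  \<open>trapezoid_exp_has_integral\<close>.\<close>

lemma nn_integral_trap_int:
  assumes s: "-1 < \<sigma>" "\<sigma> < 0"
  shows "ennreal (Gamma (\<sigma> + 2) * trap_int \<sigma> n) = 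
    (\<integral>\<^sup>+u. ennreal (indicator {0<..} u * u powr (\<sigma> - 1)) * ennreal (exp (-u) ^ n * ((1 + exp (-u)) - 2 * (1 - exp (-u)) / u)) \<partial>lborel)"
proof -
  define q where "q = (\<lambda>x. (x - real n) * (real n + 1 - x))"
  have q: "q x \<ge> 0" if "x \<in> {real n..real n + 1}" for x using that by (auto simp: q_def)
  have [measurable]: "q \<in> borel_measurable borel" by (simp add: q_def)
  define F where "F = (\<lambda>x u. ennreal (indicator {real n..real n + 1} x * indicator {0<..} u * (q x * (u powr (\<sigma> + 1) * exp (- (x * u))))))"
  have G: "Gamma (\<sigma> + 2) > 0" using s by (intro Gamma_real_pos) auto
  have "ennreal (Gamma (\<sigma> + 2) * trap_int \<sigma> n) = (\<integral>\<^sup>+x. ennreal (indicator {real n..real n + 1} x * (Gamma (\<sigma> + 2) * (q x * x powr (- \<sigma> - 2)))) \<partial>lborel)"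
    by (rule nn_integral_has_integral_lebesgue[symmetric])
       (use has_integral_mult_right[OF trap_int_has_integral[OF s, of n], of "Gamma (\<sigma> + 2)"] G q in \<open>auto simp: q_def\<close>)
  also have "\<dots> = (\<integral>\<^sup>+x. \<integral>\<^sup>+u. F x u \<partial>lborel \<partial>lborel)"
  proof (rule nn_integral_cong)
    fix x :: real
    show "ennreal (indicator {real n..real n + 1} x * (Gamma (\<sigma> + 2) * (q x * x powr (- \<sigma> - 2)))) = (\<integral>\<^sup>+u. F x u \<partial>lborel)"
    proof (cases "x \<in> {real n..real n + 1} \<and> x \<noteq> 0")
      case True
      hence x: "x > 0" by auto
      have "(\<integral>\<^sup>+u. F x u \<partial>lborel) = (\<integral>\<^sup>+u. ennreal (q x) * ennreal (indicator {0<..} u * (u powr ((\<sigma> + 2) - 1) * exp (- (x * u)))) \<partial>lborel)"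
        using True q[of x] by (intro nn_integral_cong) (auto simp: F_def indicator_def add_ac simp flip: ennreal_mult')
      also have "\<dots> = ennreal (q x) * ennreal (Gamma (\<sigma> + 2) * x powr (- (\<sigma> + 2)))"
        by (subst nn_integral_cmult) (use nn_integral_Gamma_scaled[of "\<sigma> + 2" x] s x in auto)
      also have "\<dots> = ennreal (indicator {real n..real n + 1} x * (Gamma (\<sigma> + 2) * (q x * x powr (- \<sigma> - 2))))"
        using True q[of x] by (simp add: mult_ac minus_diff_commute flip: ennreal_mult')
      finally show ?thesis ..
    next
      case False
      hence "indicator {real n..real n + 1} x = (0::real) \<or> q x = 0" by (auto simp: q_def indicator_def)
      thus ?thesis by (auto simp: F_def)
    qed
  qed
  also have "\<dots> = (\<integral>\<^sup>+u. \<integral>\<^sup>+x. F x u \<partial>lborel \<partial>lborel)"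
    by (rule lborel_pair.Fubini'[symmetric]) (simp add: F_def case_prod_unfold)
  also have "\<dots> = (\<integral>\<^sup>+u. ennreal (indicator {0<..} u * u powr (\<sigma> - 1)) * ennreal (exp (-u) ^ n * ((1 + exp (-u)) - 2 * (1 - exp (-u)) / u)) \<partial>lborel)"
  proof (rule nn_integral_cong)
    fix u :: real
    show "(\<integral>\<^sup>+x. F x u \<partial>lborel) = ennreal (indicator {0<..} u * u powr (\<sigma> - 1)) * ennreal (exp (-u) ^ n * ((1 + exp (-u)) - 2 * (1 - exp (-u)) / u))"
    proof (cases "u > 0")
      case u: True
      have "u powr (\<sigma> + 1) = u powr (\<sigma> - 1) * u\<^sup>2" 
        using u by (simp add: add.commute flip: powr_numeral powr_add)
      hence "(\<integral>\<^sup>+x. F x u \<partial>lborel) = (\<integral>\<^sup>+x. ennreal (u powr (\<sigma> - 1)) * ennreal (indicator {real n..real n + 1} x * (q x * (u\<^sup>2 * exp (- (x * u))))) \<partial>lborel)"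
        using u by (intro nn_integral_cong) (auto simp: F_def indicator_def mult_ac simp flip: ennreal_mult')
      also have "\<dots> = ennreal (u powr (\<sigma> - 1)) * (\<integral>\<^sup>+x. ennreal (indicator {real n..real n + 1} x * (q x * (u\<^sup>2 * exp (- (x * u))))) \<partial>lborel)"
        by (subst nn_integral_cmult) auto
      also have "(\<integral>\<^sup>+x. ennreal (indicator {real n..real n + 1} x * (q x * (u\<^sup>2 * exp (- (x * u))))) \<partial>lborel) = ennreal (exp (-u) ^ n * ((1 + exp (-u)) - 2 * (1 - exp (-u)) / u))"
        by (rule nn_integral_has_integral_lebesgue) (use trapezoid_exp_has_integral[OF u, of n] q in \<open>auto simp: q_def\<close>)
      finally show ?thesis using u by simp
    qed (simp add: F_def)
  qed
  finally show ?thesis .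
qed

text \<open>Both sums equal coth (u/2) - 2/u: the left one as a geometric series, the right one by
  partial fractions. This identity is where the two sides of the functional equation meet.\<close>

lemma suminf_trapezoid_exp:
  assumes u: "(u::real) > 0"
  shows "(\<Sum>n. ennreal (exp (-u) ^ n * ((1 + exp (-u)) - 2 * (1 - exp (-u)) / u))) =
         (\<Sum>k. ennreal (4 * u / (u\<^sup>2 + (2 * pi * real (Suc k))\<^sup>2)))"
proof -
  define D where "D = (1 + exp (-u)) - 2 * (1 - exp (-u)) / u"
  define W where "W = (1 + exp (-u)) / (1 - exp (-u)) - 2 / u"
  have e: "exp (-u) < 1" using u by simp
  have nn: "4 * u / (u\<^sup>2 + (2 * pi * real (Suc k))\<^sup>2) \<ge> 0" for k using u by simp
  have S: "(\<Sum>k. ennreal (4 * u / (u\<^sup>2 + (2 * pi * real (Suc k))\<^sup>2))) = ennreal W"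
    using coth_partial_fractions[OF u] nn unfolding W_def by (intro suminf_ennreal_eq) 
  have "W \<ge> 0" using sums_le[OF _ sums_zero coth_partial_fractions[OF u]] nn by (auto simp: W_def)
  moreover have DW: "D = (1 - exp (-u)) * W" using e by (simp add: D_def W_def right_diff_distrib)
  ultimately have D: "D \<ge> 0" using e by simp
  have "(\<lambda>n. exp (-u) ^ n * D) sums (1 / (1 - exp (-u)) * D)"
    using e by (intro sums_mult2 geometric_sums) auto
  also have "1 / (1 - exp (-u)) * D = W" using e unfolding DW by simp
  finally have "(\<Sum>n. ennreal (exp (-u) ^ n * D)) = ennreal W"
    using D by (intro suminf_ennreal_eq) auto
  thus ?thesis unfolding S D_def .
qed

text \<open>
  Tonelli applied to $\int_0^\infty u^{\sigma-1}(\coth(u/2)-2/u)\,du$: expanding in $e^{-nu}$ gives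
  $\zeta(\sigma)$, expanding in partial fractions gives $\zeta(1-\sigma)$, and all terms are nonnegative.
\<close>
lemma zeta_num_real_functional_equation:
  assumes s: "-1 < \<sigma>" "\<sigma> < 0"
  shows "Gamma (\<sigma> + 2) * (2 * Re (zeta_num (of_real \<sigma>)) / ((\<sigma> - 1) * \<sigma> * (\<sigma> + 1))) = 
    2 * Gamma ((1 + \<sigma>) / 2) * Gamma ((1 - \<sigma>) / 2) * (2 * pi) powr (\<sigma> - 1) * (Re (zeta_num (of_real (1 - \<sigma>))) / (- \<sigma>))"
proof -
  define C where "C = 2 * Gamma ((1 + \<sigma>) / 2) * Gamma ((1 - \<sigma>) / 2) * (2 * pi) powr (\<sigma> - 1)"
  have C: "C > 0" using s unfolding C_def by (intro mult_pos_pos Gamma_real_pos) auto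
  define Z where "Z = Re (zeta_num (of_real (1 - \<sigma>))) / (- \<sigma>)"
  have G: "Gamma (\<sigma> + 2) > 0" using s by (intro Gamma_real_pos) auto
  have I: "trap_int \<sigma> n \<ge> 0" for n
    by (rule has_integral_nonneg[OF trap_int_has_integral[OF s]]) auto
  have Zs: "(\<lambda>k. real (Suc k) powr (\<sigma> - 1)) sums Z"
  proof -
    have "(\<lambda>n. Re (of_nat (Suc n) powr (- complex_of_real (1 - \<sigma>)))) sums Re (zeta_num (of_real (1 - \<sigma>)) / (of_real (1 - \<sigma>) - 1))"
      using s by (intro sums_Re zeta_num_sums) auto
    also have "(\<lambda>n. Re (of_nat (Suc n) powr (- complex_of_real (1 - \<sigma>)))) = (\<lambda>k. real (Suc k) powr (\<sigma> - 1))"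
    proof
      fix n
      have "(of_nat (Suc n) :: complex) powr (- complex_of_real (1 - \<sigma>)) = of_real (real (Suc n) powr (\<sigma> - 1))"
        using powr_of_real[of "real (Suc n)" "\<sigma> - 1"] by simp
      thus "Re (of_nat (Suc n) powr (- complex_of_real (1 - \<sigma>))) = real (Suc n) powr (\<sigma> - 1)" by simp
    qed
    also have "zeta_num (of_real (1 - \<sigma>)) / (of_real (1 - \<sigma>) - 1) = zeta_num (of_real (1 - \<sigma>)) / of_real (- \<sigma>)" by simp
    also have "Re \<dots> = Z" unfolding Z_def by (simp only: Re_divide_of_real)
    finally show ?thesis .
  qed
  have "ennreal (Gamma (\<sigma> + 2) * (2 * Re (zeta_num (of_real \<sigma>)) / ((\<sigma> - 1) * \<sigma> * (\<sigma> + 1)))) = (\<Sum>n. ennreal (Gamma (\<sigma> + 2) * trap_int \<sigma> n))"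
    using G I by (intro suminf_ennreal_eq [symmetric] sums_mult trap_int_sums s) (auto intro: mult_nonneg_nonneg)
  also have "\<dots> = (\<Sum>n. \<integral>\<^sup>+u. ennreal (indicator {0<..} u * u powr (\<sigma> - 1)) * ennreal (exp (-u) ^ n * ((1 + exp (-u)) - 2 * (1 - exp (-u)) / u)) \<partial>lborel)"
    by (simp only: nn_integral_trap_int[OF s])
  also have "\<dots> = (\<integral>\<^sup>+u. (\<Sum>n. ennreal (indicator {0<..} u * u powr (\<sigma> - 1)) * ennreal (exp (-u) ^ n * ((1 + exp (-u)) - 2 * (1 - exp (-u)) / u))) \<partial>lborel)"
    by (rule nn_integral_suminf [symmetric]) simp
  also have "\<dots> = (\<integral>\<^sup>+u. (\<Sum>k. ennreal (indicator {0<..} u * u powr (\<sigma> - 1)) * ennreal (4 * u / (u\<^sup>2 + (2 * pi * real (Suc k))\<^sup>2))) \<partial>lborel)"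
  proof (rule nn_integral_cong)
    fix u :: real
    show "(\<Sum>n. ennreal (indicator {0<..} u * u powr (\<sigma> - 1)) * ennreal (exp (-u) ^ n * ((1 + exp (-u)) - 2 * (1 - exp (-u)) / u)))
      = (\<Sum>k. ennreal (indicator {0<..} u * u powr (\<sigma> - 1)) * ennreal (4 * u / (u\<^sup>2 + (2 * pi * real (Suc k))\<^sup>2)))"
      by (cases "u > 0") (simp_all only: ennreal_suminf_cmult suminf_trapezoid_exp, simp)
  qed
  also have "\<dots> = (\<Sum>k. \<integral>\<^sup>+u. ennreal (indicator {0<..} u * u powr (\<sigma> - 1)) * ennreal (4 * u / (u\<^sup>2 + (2 * pi * real (Suc k))\<^sup>2)) \<partial>lborel)"
    by (rule nn_integral_suminf) simp
  also have "\<dots> = (\<Sum>k. ennreal (C * real (Suc k) powr (\<sigma> - 1)))"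
  proof (rule suminf_cong)
    fix k :: nat
    define a where "a = 2 * pi * real (Suc k)"
    have a: "a > 0" by (simp add: a_def)
    have "(\<integral>\<^sup>+u. ennreal (indicator {0<..} u * u powr (\<sigma> - 1)) * ennreal (4 * u / (u\<^sup>2 + a\<^sup>2)) \<partial>lborel) 
       = (\<integral>\<^sup>+u. 4 * ennreal (indicator {0<..} u * (u powr \<sigma> / (u\<^sup>2 + a\<^sup>2))) \<partial>lborel)"
    proof (rule nn_integral_cong)
      fix u :: real
      show "ennreal (indicator {0<..} u * u powr (\<sigma> - 1)) * ennreal (4 * u / (u\<^sup>2 + a\<^sup>2)) = 4 * ennreal (indicator {0<..} u * (u powr \<sigma> / (u\<^sup>2 + a\<^sup>2)))"
      proof (cases "u > 0")
        case True
        have "u powr (\<sigma> - 1) * (4 * u / (u\<^sup>2 + a\<^sup>2)) = 4 * (u powr \<sigma> / (u\<^sup>2 + a\<^sup>2))"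
          using True powr_mult_base[of u "\<sigma> - 1"] by (simp add: mult_ac)
        thus ?thesis using True by (simp flip: ennreal_mult' ennreal_numeral)
      qed auto
    qed
    also have "\<dots> = 4 * ennreal (Gamma ((1 + \<sigma>) / 2) * Gamma ((1 - \<sigma>) / 2) / 2 * a powr (\<sigma> - 1))"
      by (subst nn_integral_cmult) (use nn_integral_Lorentzian_moment[of \<sigma> a] s a in auto)
    also have "\<dots> = ennreal (4 * (Gamma ((1 + \<sigma>) / 2) * Gamma ((1 - \<sigma>) / 2) / 2 * a powr (\<sigma> - 1)))"
      by (simp only: ennreal_mult' zero_le_numeral ennreal_numeral)
    also have "4 * (Gamma ((1 + \<sigma>) / 2) * Gamma ((1 - \<sigma>) / 2) / 2 * a powr (\<sigma> - 1)) = C * real (Suc k) powr (\<sigma> - 1)"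
      unfolding a_def by (subst powr_mult) (auto simp: C_def)
    finally show "(\<integral>\<^sup>+u. ennreal (indicator {0<..} u * u powr (\<sigma> - 1)) * ennreal (4 * u / (u\<^sup>2 + (2 * pi * real (Suc k))\<^sup>2)) \<partial>lborel) = ennreal (C * real (Suc k) powr (\<sigma> - 1))"
      unfolding a_def .
  qed
  also have "\<dots> = ennreal (C * Z)"
    using C Zs by (intro suminf_ennreal_eq sums_mult) auto
  finally have "ennreal (Gamma (\<sigma> + 2) * (2 * Re (zeta_num (of_real \<sigma>)) / ((\<sigma> - 1) * \<sigma> * (\<sigma> + 1)))) = ennreal (C * Z)" .
  \<comment> \<open>\<open>ennreal\<close> sends negative reals to 0, so the equation returns to the
    reals only with both sides known to be nonnegative.\<close>
  moreover have "Gamma (\<sigma> + 2) * (2 * Re (zeta_num (of_real \<sigma>)) / ((\<sigma> - 1) * \<sigma> * (\<sigma> + 1))) \<ge> 0"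
    using G sums_le[OF _ sums_zero trap_int_sums[OF s]] I by (intro mult_nonneg_nonneg) auto
  moreover have "C * Z \<ge> 0" 
    using C sums_le[OF _ sums_zero Zs] by (intro mult_nonneg_nonneg) auto
  ultimately show ?thesis unfolding C_def Z_def by (simp only: ennreal_inj)
qed

subsection \<open>The zeta function on the whole plane\<close>

text \<open>Both sides are holomorphic on the strip where \<open>zeta_num s\<close> and
  \<open>zeta_num (1 - s)\<close> are both defined, because \<open>rGamma\<close> has no poles, so
  equality on the real interval (-1, 0) extends by the identity theorem. The factors s - 1 and - s
  come from the two numerators.\<close>

lemma zeta_num_functional_equation:
  assumes s: "-1 < Re s" "Re s < 2"
  shows "- s * rGamma ((1 - s) / 2) * of_real pi powr (- s / 2) * zeta_num s = 
         (s - 1) * rGamma (s / 2) * of_real pi powr (- (1 - s) / 2) * zeta_num (1 - s)"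
proof -
  define S where "S = {s. -1 < Re s \<and> Re s < 2}"
  define L where "L = (\<lambda>s. - s * rGamma ((1 - s) / 2) * of_real pi powr (- s / 2) * zeta_num s)"
  define R where "R = (\<lambda>s. (s - 1) * rGamma (s / 2) * of_real pi powr (- (1 - s) / 2) * zeta_num (1 - s))"
  have hz: "zeta_num holomorphic_on S" 
    by (rule holomorphic_on_subset[OF holomorphic_zeta_num]) (auto simp: S_def)
  have "(zeta_num \<circ> (\<lambda>s. 1 - s)) holomorphic_on S"
    by (rule holomorphic_on_compose_gen[OF _ holomorphic_zeta_num]) (auto simp: S_def intro!: holomorphic_intros)
  hence hz': "(\<lambda>s. zeta_num (1 - s)) holomorphic_on S" by (simp add: o_def)
  have hol: "L holomorphic_on S" "R holomorphic_on S"
    unfolding L_def R_def by (intro holomorphic_intros hz hz'; simp)+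
  have oS: "open S" and cS: "connected S"
  proof -
    have "S = {s. -1 < Re s} \<inter> {s. Re s < 2}" by (auto simp: S_def)
    thus "open S" "connected S"
      by (auto intro!: open_Int open_halfspace_Re_gt open_halfspace_Re_lt convex_connected convex_Int convex_halfspace_Re_gt convex_halfspace_Re_lt)
  qed
  define U where "U = complex_of_real ` {-1<..<0}"
  have real: "L z - R z = 0" if zU: "z \<in> U" for z
  proof -
    obtain \<sigma> where z: "z = of_real \<sigma>" and \<sigma>: "-1 < \<sigma>" "\<sigma> < 0" using zU by (auto simp: U_def)
    define A where "A = Re (zeta_num (of_real \<sigma>))"
    define B where "B = Re (zeta_num (of_real (1 - \<sigma>)))"
    \<comment> \<open>Conjugation symmetry makes the values on the real axis real, so the real
      functional equation loses nothing.\<close>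
    have real: "zeta_num (of_real x) = of_real (Re (zeta_num (of_real x)))" if "x > -1" for x
    proof -
      have "cnj (zeta_num (of_real x)) = zeta_num (of_real x)" using that by (simp add: cnj_zeta_num)
      thus ?thesis by (simp add: complex_eq_iff)
    qed
    have A: "zeta_num z = of_real A" and B: "zeta_num (1 - z) = of_real B"
      using real[of \<sigma>] real[of "1 - \<sigma>"] \<sigma> by (simp_all add: A_def B_def z)
    have fe: "Gamma (\<sigma> + 2) * (2 * A / ((\<sigma> - 1) * \<sigma> * (\<sigma> + 1))) = 
      2 * Gamma ((1 + \<sigma>) / 2) * Gamma ((1 - \<sigma>) / 2) * (2 * pi) powr (\<sigma> - 1) * (B / (- \<sigma>))"
      using zeta_num_real_functional_equation[OF \<sigma>] by (simp add: A_def B_def)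
    have ni: "x \<notin> \<int>\<^sub>\<le>\<^sub>0" if "-1 < x" "x \<noteq> 0" for x :: real
      using that by (auto elim!: nonpos_Ints_cases)
    have G1: "Gamma (\<sigma> + 2) = (\<sigma> + 1) * \<sigma> * Gamma \<sigma>"
    proof -
      have "Gamma (\<sigma> + 1 + 1) = (\<sigma> + 1) * Gamma (\<sigma> + 1)" using ni[of "\<sigma> + 1"] \<sigma> by (intro Gamma_plus1) auto
      also have "Gamma (\<sigma> + 1) = \<sigma> * Gamma \<sigma>" using ni[of "\<sigma>"] \<sigma> by (intro Gamma_plus1) auto
      finally show ?thesis by (simp add: add.commute)
    qed
    \<comment> \<open>Legendre duplication trades Gamma \<sigma> and Gamma ((1 + \<sigma>) / 2) for
      Gamma (\<sigma> / 2), which makes the equation symmetric.\<close>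
    have G2: "Gamma (\<sigma> / 2) * Gamma ((1 + \<sigma>) / 2) = 2 powr (1 - \<sigma>) * sqrt pi * Gamma \<sigma>"
    proof -
      have ni': "complex_of_real x \<notin> \<int>\<^sub>\<le>\<^sub>0" if "-1 < x" "x \<noteq> 0" for x
        using that by (auto elim!: nonpos_Ints_cases simp: complex_eq_iff)
      have "Gamma (complex_of_real (\<sigma> / 2)) * Gamma (complex_of_real (\<sigma> / 2) + 1/2) = 
          exp ((1 - 2 * complex_of_real (\<sigma>/2)) * of_real (ln 2)) * of_real (sqrt pi) * Gamma (2 * complex_of_real (\<sigma>/2))"
        using ni'[of "\<sigma> / 2"] ni'[of "\<sigma> / 2 + 1/2"] \<sigma> by (intro Gamma_legendre_duplication) auto
      also have "exp ((1 - 2 * complex_of_real (\<sigma>/2)) * of_real (ln 2)) = of_real (2 powr (1 - \<sigma>))"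
        by (simp add: powr_def flip: exp_of_real)
      also have "complex_of_real (\<sigma> / 2) + 1/2 = of_real ((1 + \<sigma>) / 2)" by (simp add: add_divide_distrib)
      also have "2 * complex_of_real (\<sigma>/2) = of_real \<sigma>" by simp
      finally have "complex_of_real (Gamma (\<sigma> / 2) * Gamma ((1 + \<sigma>) / 2)) = of_real (2 powr (1 - \<sigma>) * sqrt pi * Gamma \<sigma>)"
        by (simp only: Gamma_complex_of_real of_real_mult)
      thus ?thesis by (simp only: of_real_eq_iff)
    qed
    have nz: "Gamma \<sigma> \<noteq> 0" "Gamma (\<sigma> / 2) \<noteq> 0" "Gamma ((1 - \<sigma>) / 2) \<noteq> 0" "\<sigma> \<noteq> 0" "\<sigma> + 1 \<noteq> 0" "\<sigma> - 1 \<noteq> 0"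
      using ni[of \<sigma>] ni[of "\<sigma> / 2"] ni[of "(1 - \<sigma>) / 2"] \<sigma> by (auto simp: Gamma_eq_zero_iff)
    have p2: "2 powr (1 - \<sigma>) * (2 * pi) powr (\<sigma> - 1) = pi powr (\<sigma> - 1)"
      by (simp add: powr_mult flip: powr_add mult.assoc)
    have p3: "sqrt pi * pi powr (\<sigma> - 1) = pi powr (\<sigma> - 1/2)"
      by (simp add: powr_half_sqrt[symmetric] flip: powr_add)
    have "Gamma \<sigma> * (2 * A / (\<sigma> - 1)) = 2 * Gamma ((1 + \<sigma>) / 2) * Gamma ((1 - \<sigma>) / 2) * (2 * pi) powr (\<sigma> - 1) * (B / (- \<sigma>))"
    proof -
      have "(\<sigma> + 1) * \<sigma> * Gamma \<sigma> * (2 * A / ((\<sigma> - 1) * \<sigma> * (\<sigma> + 1))) = Gamma \<sigma> * (2 * A / (\<sigma> - 1))"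
        using nz by (simp add: divide_simps)
      thus ?thesis using fe unfolding G1 by (simp only:)
    qed
    hence "Gamma (\<sigma> / 2) * (Gamma \<sigma> * (2 * A / (\<sigma> - 1))) = 2 * (Gamma (\<sigma> / 2) * Gamma ((1 + \<sigma>) / 2)) * Gamma ((1 - \<sigma>) / 2) * (2 * pi) powr (\<sigma> - 1) * (B / (- \<sigma>))"
      by (simp add: mult_ac)
    also have "\<dots> = Gamma \<sigma> * (2 * Gamma ((1 - \<sigma>) / 2) * (sqrt pi * (2 powr (1 - \<sigma>) * (2 * pi) powr (\<sigma> - 1))) * (B / (- \<sigma>)))"
      unfolding G2 by (simp add: mult_ac)
    finally have "Gamma \<sigma> * (Gamma (\<sigma> / 2) * (2 * A / (\<sigma> - 1))) = Gamma \<sigma> * (2 * Gamma ((1 - \<sigma>) / 2) * pi powr (\<sigma> - 1/2) * (B / (- \<sigma>)))"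
      unfolding p2 p3 by (simp add: mult_ac)
    hence "Gamma (\<sigma> / 2) * (2 * A / (\<sigma> - 1)) = 2 * Gamma ((1 - \<sigma>) / 2) * pi powr (\<sigma> - 1/2) * (B / (- \<sigma>))"
      using nz by (subst (asm) mult_cancel_left) simp
    hence "- \<sigma> * Gamma (\<sigma> / 2) * A = (\<sigma> - 1) * Gamma ((1 - \<sigma>) / 2) * pi powr (\<sigma> - 1/2) * B"
      using nz by (simp add: field_simps)
    hence "- \<sigma> * rGamma ((1 - \<sigma>) / 2) * A = (\<sigma> - 1) * rGamma (\<sigma> / 2) * pi powr (\<sigma> - 1/2) * B"
      using nz unfolding rGamma_inverse_Gamma by (simp add: field_simps)
    hence "- \<sigma> * rGamma ((1 - \<sigma>) / 2) * (pi powr (- \<sigma> / 2)) * A = (\<sigma> - 1) * rGamma (\<sigma> / 2) * (pi powr (- \<sigma> / 2) * pi powr (\<sigma> - 1/2)) * B"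
    proof -
      have "x * y * p * A = v * w * (p * c) * B" if "x * y * A = v * w * c * B" for x y p v w c :: real
        using arg_cong[OF that, of "\<lambda>t. p * t"] by (simp add: mult_ac)
      from this[OF \<open>- \<sigma> * rGamma ((1 - \<sigma>) / 2) * A = (\<sigma> - 1) * rGamma (\<sigma> / 2) * pi powr (\<sigma> - 1/2) * B\<close>]
      show ?thesis .
    qed
    also have "pi powr (- \<sigma> / 2) * pi powr (\<sigma> - 1/2) = pi powr (- (1 - \<sigma>) / 2)"
    proof -
      have "- \<sigma> / 2 + (\<sigma> - 1/2) = - (1 - \<sigma>) / 2" by (simp add: field_simps)
      thus ?thesis by (simp only: powr_add [symmetric])
    qed
    finally have eq: "- \<sigma> * rGamma ((1 - \<sigma>) / 2) * (pi powr (- \<sigma> / 2)) * A = (\<sigma> - 1) * rGamma (\<sigma> / 2) * pi powr (- (1 - \<sigma>) / 2) * B" .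
    have c1: "rGamma ((1 - z) / 2) = of_real (rGamma ((1 - \<sigma>) / 2))" "rGamma (z / 2) = of_real (rGamma (\<sigma> / 2))"
      by (simp_all add: z flip: rGamma_complex_of_real)
    have c2: "of_real pi powr (- z / 2) = complex_of_real (pi powr (- \<sigma> / 2))"
       "of_real pi powr (- (1 - z) / 2) = complex_of_real (pi powr (- (1 - \<sigma>) / 2))"
      by (simp_all add: z flip: powr_of_real)
    have "L z = of_real (- \<sigma> * rGamma ((1 - \<sigma>) / 2) * (pi powr (- \<sigma> / 2)) * A)"
      unfolding L_def A c1 c2 by (simp add: z)
    also have "\<dots> = R z"
      unfolding eq R_def B c1 c2 by (simp add: z)
    finally show ?thesis by simp
  qed
  have "L s - R s = 0"
  proof (rule analytic_continuation[of "\<lambda>s. L s - R s" S U "-1/2"])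
    show "(\<lambda>s. L s - R s) holomorphic_on S" by (intro holomorphic_intros hol)
    show "U \<subseteq> S" by (auto simp: U_def S_def)
    show "(-1/2 :: complex) islimpt U"
    proof (rule islimptI)
      fix T :: "complex set" assume "-1/2 \<in> T" "open T"
      then obtain e where e: "e > 0" "ball (-1/2) e \<subseteq> T" by (auto simp: open_contains_ball)
      define x where "x = -1/2 + min e (1/2) / 2"
      have "complex_of_real x \<in> ball (-1/2) e"
      proof -
        have "dist (-1/2) (complex_of_real x) = dist (complex_of_real (-1/2)) (complex_of_real x)" by simp
        also have "\<dots> = \<bar>-1/2 - x\<bar>" by (simp only: dist_of_real dist_real_def)
        finally show ?thesis using e by (auto simp: x_def min_def)
      qed
      moreover have "x \<in> {-1<..<0}" using e by (auto simp: x_def min_def)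
      hence "complex_of_real x \<in> U" unfolding U_def by (rule imageI)
      moreover have "complex_of_real x \<noteq> -1/2" using e by (auto simp: x_def complex_eq_iff)
      ultimately show "\<exists>y\<in>U. y \<in> T \<and> y \<noteq> -1/2" using e by blast
    qed
  qed (use oS cS real s in \<open>auto simp: S_def\<close>)
  thus ?thesis by (simp add: L_def R_def)
qed

text \<open>The definite description needs a witness on the whole punctured plane: the quotient by s
  - 1 for Re s > -1, continued to the left by the functional equation with its usual factor
  \<open>chi\<close>. Uniqueness is the identity theorem from the half plane Re s > 1.\<close>

lemma zeta_properties:
  "zeta holomorphic_on - {1} \<and> (\<forall>s. Re s > -1 \<longrightarrow> zeta s = zeta_num s / (s - 1))"
proof -
  define chi where "chi = (\<lambda>s::complex. rGamma (s / 2) * Gamma ((1 - s) / 2) * of_real pi powr (s - 1 / 2))"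
  define f where "f = (\<lambda>s. if Re s > -1 then zeta_num s / (s - 1) else chi s * (zeta_num (1 - s) / (- s)))"
  have agree: "zeta_num s / (s - 1) = chi s * (zeta_num (1 - s) / (- s))" if s: "-1 < Re s" "Re s < 0" for s
  proof -
    have nz: "s \<noteq> 0" "s - 1 \<noteq> 0" using s by auto
    have nz': "Gamma ((1 - s) / 2) \<noteq> 0" "(1 - s) / 2 \<notin> \<int>\<^sub>\<le>\<^sub>0"
      using s by (auto simp: Gamma_eq_zero_iff elim!: nonpos_Ints_cases) (auto simp: complex_eq_iff)
    have p: "of_real pi powr (- (1 - s) / 2) = complex_of_real pi powr (- s / 2) * of_real pi powr (s - 1/2)"
    proof -
      have "- (1 - s) / 2 = - s / 2 + (s - 1/2)" by (simp add: field_simps)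
      thus ?thesis by (simp only: powr_add)
    qed
    have pn: "complex_of_real pi powr (- s / 2) \<noteq> 0" by simp
    have "- s * (rGamma ((1 - s) / 2) * zeta_num s) * of_real pi powr (- s / 2) = 
         ((s - 1) * rGamma (s / 2) * of_real pi powr (s - 1/2) * zeta_num (1 - s)) * of_real pi powr (- s / 2)"
      using zeta_num_functional_equation[of s] s unfolding p by (simp add: mult_ac)
    hence "- s * (rGamma ((1 - s) / 2) * zeta_num s) = (s - 1) * rGamma (s / 2) * of_real pi powr (s - 1/2) * zeta_num (1 - s)"
      using pn by (subst (asm) mult_cancel_right) simp
    moreover have "Z / (s - 1) = g * G * P * (Z1 / (- s))" if "- s * (inverse G * Z) = (s - 1) * g * P * Z1" "G \<noteq> 0" for g G P Z Z1
    proof -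
      have "Z * (- s) = g * G * P * Z1 * (s - 1)" 
      proof -
        have "G * inverse G = 1" using that(2) by simp
        moreover have "- s * Z * (G * inverse G) = G * ((s - 1) * g * P * Z1)"
          using arg_cong[OF that(1), of "\<lambda>t. G * t"] by (simp only: mult_ac)
        ultimately show ?thesis by (simp add: mult_ac)
      qed
      hence "Z / (s - 1) = (g * G * P * Z1) / (- s)" using nz by (subst frac_eq_eq) auto
      thus ?thesis by simp
    qed
    ultimately show ?thesis using nz'(1) unfolding chi_def rGamma_inverse_Gamma by blast
  qed
  have hol1: "f holomorphic_on ({s. Re s > -1} - {1})"
  proof -
    have "(\<lambda>s. zeta_num s / (s - 1)) holomorphic_on ({s. Re s > -1} - {1})"
      by (intro holomorphic_intros holomorphic_on_subset[OF holomorphic_zeta_num]) auto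
    thus ?thesis by (rule holomorphic_transform) (auto simp: f_def)
  qed
  have hol2: "f holomorphic_on {s. Re s < 0}"
  proof -
    have "(zeta_num \<circ> (\<lambda>s. 1 - s)) holomorphic_on {s. Re s < 0}"
      by (rule holomorphic_on_compose_gen[OF _ holomorphic_zeta_num]) (auto intro!: holomorphic_intros)
    hence hz': "(\<lambda>s. zeta_num (1 - s)) holomorphic_on {s. Re s < 0}" by (simp add: o_def)
    have "(\<lambda>s. chi s * (zeta_num (1 - s) / (- s))) holomorphic_on {s. Re s < 0}"
      unfolding chi_def by (intro holomorphic_intros hz') (auto elim!: nonpos_Ints_cases simp: complex_eq_iff)
    thus ?thesis by (rule holomorphic_transform) (use agree in \<open>auto simp: f_def\<close>)
  qed
  have "f holomorphic_on (({s. Re s > -1} - {1}) \<union> {s. Re s < 0})"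
    by (intro holomorphic_on_Un hol1 hol2 open_Diff open_halfspace_Re_gt open_halfspace_Re_lt) auto
  also have "({s. Re s > -1} - {1}) \<union> {s. Re s < 0} = - {1::complex}" by auto
  finally have hol: "f holomorphic_on - {1}" .
  have sums: "(\<lambda>n. of_nat (Suc n) powr (- s)) sums f s" if "Re s > 1" for s
    using zeta_num_sums[OF that] that by (simp add: f_def)
  \<comment> \<open>Division by zero gives 0, which is the value prescribed at the pole.\<close>
  have f1: "f 1 = 0" by (simp add: f_def)
  have "zeta = f"
    unfolding zeta_def
  proof (rule the_equality)
    show "f holomorphic_on - {1} \<and> (\<forall>s. 1 < Re s \<longrightarrow> (\<lambda>n. of_nat (Suc n) powr - s) sums f s) \<and> f 1 = 0"
      using hol sums f1 by blast
    fix g assume g: "g holomorphic_on - {1} \<and> (\<forall>s. 1 < Re s \<longrightarrow> (\<lambda>n. of_nat (Suc n) powr - s) sums g s) \<and> g 1 = 0"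
    show "g = f"
    proof
      fix s show "g s = f s"
      proof (cases "s = 1")
        case False
        have "g s - f s = 0"
        proof (rule analytic_continuation_open[of "{s. Re s > 1}" "- {1}" "\<lambda>s. g s - f s" "\<lambda>_. 0"])
          show "{s. Re s > 1} \<noteq> ({} :: complex set)" by (auto intro: exI[of _ "2::complex"])
          show "connected (- {1 :: complex})" by (rule connected_punctured_universe) simp
        qed (use g hol sums False in \<open>auto intro!: holomorphic_intros open_halfspace_Re_gt sums_unique2\<close>)
        thus ?thesis by simp
      qed (use g f1 in auto)
    qed
  qed
  moreover have "f s = zeta_num s / (s - 1)" if "Re s > -1" for s using that by (simp add: f_def)
  ultimately show ?thesis using hol by simp
qed

lemmas holomorphic_zeta = zeta_properties[THEN conjunct1]
lemma zeta_eq: "Re s > -1 \<Longrightarrow> zeta s = zeta_num s / (s - 1)"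
  using zeta_properties by blast

subsection \<open>The logarithmic derivative on the critical line\<close>

text \<open>In the series for Re (Digamma (a + ib)) the negative part (a + k) / ((a + k)^2 + b^2) of
  each early term dies out as b grows, leaving a harmonic sum; the later terms are never below those
  at the real point a. The harmonic series diverges.\<close>

lemma Digamma_vertical_at_top:
  assumes a: "0 < a" "a < 1"
  shows "\<exists>b0>0. \<forall>b\<ge>b0. K \<le> Re (Digamma (Complex a b))"
proof -
  define h where "h = (\<lambda>k. inverse (real (Suc k)) - inverse (a + real k))"
  have hs: "h sums (Digamma a + euler_mascheroni)"
    unfolding h_def Digamma_def using summable_Digamma[of a] a by (simp add: summable_sums)
  have h0: "h k \<le> 0" for k unfolding h_def using a by (simp add: le_imp_inverse_le)
  have "filterlim (harm :: nat \<Rightarrow> real) at_top sequentially"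
    by (rule harm_at_top)
  hence "eventually (\<lambda>N. harm N \<ge> K + euler_mascheroni + 1 - (Digamma a + euler_mascheroni)) sequentially"
    by (simp add: filterlim_at_top)
  hence "eventually (\<lambda>N. harm N \<ge> K + euler_mascheroni + 1 - (Digamma a + euler_mascheroni) \<and> N \<ge> 1) sequentially"
    using eventually_ge_at_top[of 1] by eventually_elim auto
  then obtain N where N: "harm N \<ge> K + euler_mascheroni + 1 - (Digamma a + euler_mascheroni)" "N \<ge> 1"
    by (auto simp: eventually_sequentially)
  have "K \<le> Re (Digamma (Complex a b))" if b: "b \<ge> real N + 1" for b
  proof -
    define z where "z = Complex a b"
    have z0: "z \<noteq> 0" using a by (auto simp: z_def complex_eq_iff)
    define f where "f = (\<lambda>k. Re (inverse (of_nat (Suc k)) - inverse (z + of_nat k)))"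
    have fs: "f sums (Re (Digamma z) + euler_mascheroni)"
    proof -
      have "(\<lambda>k. inverse (of_nat (Suc k)) - inverse (z + of_nat k)) sums (Digamma z + euler_mascheroni)"
        unfolding Digamma_def using summable_Digamma[OF z0] by (simp add: summable_sums)
      moreover have "Re (euler_mascheroni :: complex) = euler_mascheroni"
        by (metis Re_complex_of_real of_real_euler_mascheroni)
      ultimately show ?thesis using sums_Re unfolding f_def by fastforce
    qed
    have f_eq: "f k = inverse (real (Suc k)) - (a + k) / ((a + k)\<^sup>2 + b\<^sup>2)" for k
    proof -
      have "Re (inverse (of_nat (Suc k) :: complex)) = inverse (real (Suc k))"
        by (metis Re_complex_of_real of_real_inverse of_real_of_nat_eq)
      moreover have "Re (inverse (z + of_nat k)) = (a + k) / ((a + k)\<^sup>2 + b\<^sup>2)" by (simp add: z_def)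
      ultimately show ?thesis by (simp add: f_def)
    qed
    \<comment> \<open>For k < N, (a + k) * N <= b^2 makes the negative part at most 1/N, a total
      loss of 1; as \<open>h k <= 0\<close>, adding \<open>h k\<close> keeps a lower bound and gives
      one formula for all k.\<close>
    have le: "h k + (if k < N then inverse (real (Suc k)) - inverse (real N) else 0) \<le> f k" for k
    proof (cases "k < N")
      case True
      have "(a + k) / ((a + k)\<^sup>2 + b\<^sup>2) \<le> inverse (real N)"
      proof -
        have "(a + k) * real N \<le> b * b" using True a b by (intro mult_mono) auto
        also have "\<dots> \<le> (a + k)\<^sup>2 + b\<^sup>2" by (simp add: power2_eq_square)
        finally have *: "(a + k) * real N \<le> (a + k)\<^sup>2 + b\<^sup>2" .
        have "(a + k)\<^sup>2 + b\<^sup>2 > 0" using b by (intro add_nonneg_pos) auto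
        moreover have "(a + k) \<le> inverse (real N) * ((a + k)\<^sup>2 + b\<^sup>2)"
          using * N by (simp add: field_simps)
        ultimately show ?thesis by (simp only: divide_le_eq if_True)
      qed
      thus ?thesis using True h0[of k] by (simp add: f_eq)
    next
      case False
      have "(a + k) / ((a + k)\<^sup>2 + b\<^sup>2) \<le> (a + k) / ((a + k)\<^sup>2)"
        using a by (intro divide_left_mono mult_pos_pos add_pos_nonneg) auto
      also have "\<dots> = inverse (a + k)" by (cases "a + real k = 0") (auto simp: power2_eq_square divide_inverse)
      finally show ?thesis using False by (simp add: f_eq h_def)
    qed
    have "(\<lambda>k. if k \<in> {..<N} then inverse (real (Suc k)) - inverse (real N) else 0) sums (\<Sum>k<N. inverse (real (Suc k)) - inverse (real N))"
      by (rule sums_If_finite_set) simp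
    also have "(\<Sum>k<N. inverse (real (Suc k)) - inverse (real N)) = harm N - 1"
    proof -
      have "harm N = (\<Sum>k<N. inverse (real (Suc k)))"
        unfolding harm_def by (rule sum.reindex_bij_witness[of _ Suc "\<lambda>k. k - 1"]) auto
      thus ?thesis using N by (simp add: sum_subtractf)
    qed
    finally have "(\<lambda>k. h k + (if k < N then inverse (real (Suc k)) - inverse (real N) else 0)) sums (Digamma a + euler_mascheroni + (harm N - 1))"
      using hs by (intro sums_add) simp_all
    from sums_le[OF le this fs] N show ?thesis by (simp add: z_def)
  qed
  thus ?thesis by (intro exI[of _ "real N + 1"]) auto
qed

lemma zeta_symmetric_functional_equation:
  assumes "0 < Re s" "Re s < 1"
  shows "of_real pi powr (- s / 2) * Gamma (s / 2) * zeta s = 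
         of_real pi powr (- (1 - s) / 2) * Gamma ((1 - s) / 2) * zeta (1 - s)"
proof -
  have nz: "s \<noteq> 0" "s - 1 \<noteq> 0" "s \<noteq> 1" using assms by auto
  have G: "Gamma (s / 2) \<noteq> 0" "Gamma ((1 - s) / 2) \<noteq> 0"
    using assms by (auto simp: Gamma_eq_zero_iff elim!: nonpos_Ints_cases) (auto simp: complex_eq_iff)
  have z: "zeta_num s = (s - 1) * zeta s" "zeta_num (1 - s) = - s * zeta (1 - s)"
    using zeta_eq[of s] zeta_eq[of "1 - s"] assms nz by auto
  have e: "- s * inverse (Gamma ((1 - s) / 2)) * of_real pi powr (- s / 2) * ((s - 1) * zeta s) = 
         (s - 1) * inverse (Gamma (s / 2)) * of_real pi powr (- (1 - s) / 2) * (- s * zeta (1 - s))"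
    using zeta_num_functional_equation[of s] assms unfolding z rGamma_inverse_Gamma by simp
  have "P * G1 * Z = Q * G2 * Z'" if "- s * inverse G2 * P * ((s - 1) * Z) = (s - 1) * inverse G1 * Q * (- s * Z')" "G1 \<noteq> 0" "G2 \<noteq> 0"
    for P Q G1 G2 Z Z' :: complex
  proof -
    have "(- s * (s - 1)) * (inverse G2 * P * Z) = (- s * (s - 1)) * (inverse G1 * Q * Z')"
      using that(1) by (simp only: mult_ac)
    hence "inverse G2 * P * Z = inverse G1 * Q * Z'" using nz by (subst (asm) mult_cancel_left) auto
    thus ?thesis using that(2,3) by (simp add: field_simps)
  qed
  from this[OF e G] show ?thesis .
qed

lemma zeta_cnj: "Re s > -1 \<Longrightarrow> zeta (cnj s) = cnj (zeta s)"
  by (simp add: zeta_eq cnj_zeta_num)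

lemma complex_pi_powr_cnj: "complex_of_real pi powr cnj a = cnj (of_real pi powr a)"
  by (simp add: cnj_powr)

text \<open>The completed function \<Lambda> is real on the critical line by the functional equation
  and conjugation, so its derivative along the line, \<open>\<i> * \<Lambda>'\<close>, is real too.
  Hence \<Lambda>' / \<Lambda> is purely imaginary there, and its real part relates zeta' / zeta to
  Digamma.\<close>

lemma zeta_logderiv_critical_line:
  "\<exists>t0>0. \<forall>t\<ge>t0. zeta (Complex (1/2) t) \<noteq> 0 \<longrightarrow> Re (deriv zeta (Complex (1/2) t) / zeta (Complex (1/2) t)) \<le> -1"
proof -
  \<comment> \<open>The excess 2 over ln pi is halved in \<open>D\<close> and gives exactly the
    bound -1.\<close>
  obtain b0 where b0: "b0 > 0" "\<And>b. b \<ge> b0 \<Longrightarrow> ln pi + 2 \<le> Re (Digamma (Complex (1/4) b))"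
    using Digamma_vertical_at_top[of "1/4" "ln pi + 2"] by auto
  have "Re (deriv zeta s / zeta s) \<le> -1" if t: "t \<ge> 2 * b0" and s: "s = Complex (1/2) t" and nz: "zeta s \<noteq> 0" for s t
  proof -
    define \<Lambda> where "\<Lambda> = (\<lambda>s. of_real pi powr (- s / 2) * Gamma (s / 2) * zeta s)"
    define G where "G = of_real pi powr (- s / 2) * Gamma (s / 2)"
    have s1: "s \<noteq> 1" "Re s = 1/2" using s by (auto simp: complex_eq_iff)
    have np: "s / 2 \<notin> \<int>\<^sub>\<le>\<^sub>0" using s by (auto elim!: nonpos_Ints_cases simp: complex_eq_iff)
    have G: "G \<noteq> 0" using np by (simp add: G_def Gamma_eq_zero_iff)
    have dz: "(zeta has_field_derivative deriv zeta s) (at s)"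
      by (rule holomorphic_derivI[OF holomorphic_zeta]) (use s1 in auto)
    define D where "D = (Digamma (s / 2) - ln pi) / 2"
    define \<Lambda>' where "\<Lambda>' = G * (D * zeta s + deriv zeta s)"
    have d\<Lambda>: "(\<Lambda> has_field_derivative \<Lambda>') (at s)"
    proof -
      have dP: "((\<lambda>s. complex_of_real pi powr (- s / 2)) has_field_derivative (of_real pi powr (- s / 2) * (- complex_of_real (ln pi) / 2))) (at s)"
      proof -
        have "((\<lambda>s. complex_of_real pi powr (- s / 2)) has_field_derivative (Ln (of_real pi) * of_real pi powr (- s / 2) * (- 1 / 2))) (at s)"
          by (rule DERIV_chain2[OF has_field_derivative_powr_right]) (auto intro!: derivative_eq_intros)
        thus ?thesis by (simp add: Ln_of_real mult_ac)
      qed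
      have dG: "((\<lambda>s. Gamma (s / 2)) has_field_derivative (Gamma (s / 2) * Digamma (s / 2) / 2)) (at s)"
      proof -
        have "((\<lambda>s. Gamma (s / 2)) has_field_derivative (Gamma (s / 2) * Digamma (s / 2) * (1 / 2))) (at s)"
          by (rule DERIV_chain2[OF has_field_derivative_Gamma, of "\<lambda>s. s / 2"]) (use np in \<open>auto intro!: derivative_eq_intros\<close>)
        thus ?thesis by simp
      qed
      have eq: "(p * (- l / 2) * g + g * d / 2 * p) * z + z' * (p * g) = p * g * ((d - l) / 2 * z + z')" for p l g d z z' :: complex
        by (simp add: field_simps)
      show ?thesis
        using DERIV_mult[OF DERIV_mult[OF dP dG] dz] unfolding \<Lambda>_def \<Lambda>'_def G_def D_def eq .
    qed
    have real: "Im (\<Lambda> (Complex (1/2) x)) = 0" for x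
    proof -
      have c: "1 - Complex (1/2) x = cnj (Complex (1/2) x)" by (simp add: complex_eq_iff)
      have "\<Lambda> (Complex (1/2) x) = \<Lambda> (cnj (Complex (1/2) x))"
        using zeta_symmetric_functional_equation[of "Complex (1/2) x"] unfolding \<Lambda>_def c by simp
      also have "\<dots> = cnj (\<Lambda> (Complex (1/2) x))"
      proof -
        define w where "w = Complex (1/2) x"
        have "of_real pi powr (- cnj w / 2) = cnj (of_real pi powr (- w / 2))"
          using complex_pi_powr_cnj[of "- w / 2"] by simp
        moreover have "Gamma (cnj w / 2) = cnj (Gamma (w / 2))" by (simp add: cnj_Gamma)
        moreover have "zeta (cnj w) = cnj (zeta w)" by (rule zeta_cnj) (simp add: w_def)
        ultimately show ?thesis unfolding \<Lambda>_def w_def[symmetric] by (simp only: complex_cnj_mult)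
      qed
      finally show ?thesis by (simp add: complex_eq_iff)
    qed
    have "((\<lambda>x. \<Lambda> (of_real (1/2) + \<i> * of_real x)) has_vector_derivative \<i> * \<Lambda>') (at t)"
    proof -
      have "((\<lambda>x. of_real (1/2) + \<i> * of_real x) has_vector_derivative \<i>) (at t)"
        by (auto intro!: derivative_eq_intros)
      moreover have "(\<Lambda> has_field_derivative \<Lambda>') (at (of_real (1/2) + \<i> * of_real t))"
        using d\<Lambda> by (simp add: s Complex_eq)
      ultimately have "(\<Lambda> \<circ> (\<lambda>x. of_real (1/2) + \<i> * of_real x) has_vector_derivative \<i> * \<Lambda>') (at t)"
        by (rule field_vector_diff_chain_at)
      thus ?thesis by (simp add: o_def)
    qed
    hence "((\<lambda>x. Im (\<Lambda> (of_real (1/2) + \<i> * of_real x))) has_vector_derivative Im (\<i> * \<Lambda>')) (at t)"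
      by (rule bounded_linear.has_vector_derivative[OF bounded_linear_Im])
    moreover have "(\<lambda>x. Im (\<Lambda> (of_real (1/2) + \<i> * of_real x))) = (\<lambda>x. 0)"
      using real by (simp add: Complex_eq)
    ultimately have "((\<lambda>x. 0::real) has_vector_derivative Re \<Lambda>') (at t)" by simp
    hence R: "Re \<Lambda>' = 0" using vector_derivative_unique_at[OF _ has_vector_derivative_const] by blast
    have "Re (\<Lambda>' / \<Lambda> s) = 0"
    proof -
      have "\<Lambda> s = of_real (Re (\<Lambda> s))" using real[of t, folded s] by (simp add: complex_eq_iff)
      thus ?thesis using R by (metis Re_divide_of_real div_0)
    qed
    moreover have "\<Lambda>' / \<Lambda> s = D + deriv zeta s / zeta s"
      using G nz unfolding \<Lambda>'_def \<Lambda>_def G_def[symmetric] by (simp add: field_simps)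
    ultimately have "Re (deriv zeta s / zeta s) = - Re D" by simp
    moreover have "Re D \<ge> 1"
    proof -
      have "s / 2 = Complex (1/4) (t/2)" by (simp add: s complex_eq_iff)
      hence "ln pi + 2 \<le> Re (Digamma (s / 2))" using b0(2)[of "t/2"] t by simp
      thus ?thesis by (simp add: D_def)
    qed
    ultimately show ?thesis by simp
  qed
  thus ?thesis using b0(1) by (intro exI[of _ "2 * b0"]) auto
qed

subsection \<open>Local expansion of the logarithmic derivative\<close>

text \<open>The map g -> g / (2B - g) takes the half plane Re g < B into the unit disc and fixes 0,
  so the Schwarz lemma applies; solving for g gives the bound.\<close>

lemma Borel_Caratheodory_bound:
  assumes hol: "g holomorphic_on ball c R" and g0: "g c = 0"
    and B: "\<And>z. z \<in> ball c R \<Longrightarrow> Re (g z) < B" and s: "norm (s - c) \<le> r" "r < R"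
  shows "norm (g s) \<le> 2 * B * r / (R - r)"
proof -
  have R: "R > 0" "r \<ge> 0" using s norm_ge_zero[of "s - c"] by linarith+
  have B0: "B > 0" using B[of c] R g0 by simp
  define \<phi> where "\<phi> = (\<lambda>z. g (c + of_real R * z) / (2 * of_real B - g (c + of_real R * z)))"
  have inb: "c + of_real R * z \<in> ball c R" if "norm z < 1" for z
    using that R by (simp add: dist_norm norm_mult)
  have nz: "2 * of_real B - g w \<noteq> 0" if "w \<in> ball c R" for w
    using B[OF that] B0 by (auto simp: complex_eq_iff)
  have lt: "norm (g w) < norm (2 * of_real B - g w)" if "w \<in> ball c R" for w
  proof -
    have "(norm (2 * of_real B - g w))\<^sup>2 - (norm (g w))\<^sup>2 = 4 * B * (B - Re (g w))"
      unfolding cmod_power2 by (simp add: power2_eq_square algebra_simps)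
    also have "\<dots> > 0" using B[OF that] B0 by simp
    finally have "(norm (g w))\<^sup>2 < (norm (2 * of_real B - g w))\<^sup>2" by simp
    thus ?thesis by (rule power_less_imp_less_base) simp
  qed
  have hg: "(\<lambda>z. g (c + of_real R * z)) holomorphic_on ball 0 1"
  proof -
    have "g \<circ> (\<lambda>z. c + of_real R * z) holomorphic_on ball 0 1"
      by (rule holomorphic_on_compose_gen[OF _ hol]) (use inb in \<open>auto intro!: holomorphic_intros\<close>)
    thus ?thesis by (simp add: o_def)
  qed
  define \<xi> where "\<xi> = (s - c) / of_real R"
  have x1: "norm \<xi> \<le> r / R" using s R by (simp add: \<xi>_def norm_divide divide_right_mono)
  have x2: "norm \<xi> < 1" using x1 s R by (meson divide_less_eq_1_pos le_less_trans)
  have "norm (\<phi> \<xi>) \<le> norm \<xi>"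
  proof (rule Schwarz_Lemma)
    show "\<phi> holomorphic_on ball 0 1"
      unfolding \<phi>_def by (intro holomorphic_intros hg) (use nz inb in auto)
    show "norm (\<phi> z) < 1" if "norm z < 1" for z
      using lt[OF inb[OF that]] nz[OF inb[OF that]] by (simp add: \<phi>_def norm_divide)
  qed (use x2 g0 in \<open>auto simp: \<phi>_def\<close>)
  hence p: "norm (\<phi> \<xi>) \<le> r / R" using x1 by linarith
  have sR: "c + of_real R * \<xi> = s" using R by (simp add: \<xi>_def)
  have sb: "s \<in> ball c R" using s by (simp add: dist_norm norm_minus_commute)
  have "norm (g s) = norm (\<phi> \<xi>) * norm (2 * of_real B - g s)"
    using nz[OF sb] by (simp add: \<phi>_def sR norm_divide)
  also have "\<dots> \<le> r / R * (2 * B + norm (g s))"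
    using norm_triangle_ineq4[of "2 * of_real B" "g s"] B0 R
    by (intro mult_mono p) auto
  finally have "norm (g s) * (R - r) \<le> 2 * B * r" using R by (simp add: field_simps)
  thus ?thesis using s by (simp add: field_simps)
qed

text \<open>Induction divides out one zero at a time, with the order of the current quotient as
  exponent. The logarithmic derivative is carried along, since each factor adds one partial
  fraction.\<close>

lemma holomorphic_factor_finite_zeros:
  assumes "finite Z" "open A" "connected A" "f holomorphic_on A" "\<exists>w\<in>A. f w \<noteq> 0" "Z \<subseteq> A"
  shows "\<exists>k m. k holomorphic_on A \<and> (\<forall>s\<in>A. f s = k s * (\<Prod>\<rho>\<in>Z. (s - \<rho>) ^ m \<rho>)) \<and> (\<forall>\<rho>\<in>Z. k \<rho> \<noteq> 0) \<and>
      (\<forall>s\<in>A. f s \<noteq> 0 \<longrightarrow> deriv f s / f s = (\<Sum>\<rho>\<in>Z. of_nat (m \<rho>) / (s - \<rho>)) + deriv k s / k s)"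
  using assms
proof (induction Z rule: finite_induct)
  case empty
  thus ?case by (intro exI[of _ f]) auto
next
  case (insert \<rho> Z)
  have "\<exists>k m. k holomorphic_on A \<and> (\<forall>s\<in>A. f s = k s * (\<Prod>\<rho>\<in>Z. (s - \<rho>) ^ m \<rho>)) \<and> (\<forall>\<rho>\<in>Z. k \<rho> \<noteq> 0) \<and>
      (\<forall>s\<in>A. f s \<noteq> 0 \<longrightarrow> deriv f s / f s = (\<Sum>\<rho>\<in>Z. of_nat (m \<rho>) / (s - \<rho>)) + deriv k s / k s)"
    using insert by blast
  then obtain k m where k: "k holomorphic_on A" "\<And>s. s \<in> A \<Longrightarrow> f s = k s * (\<Prod>\<rho>\<in>Z. (s - \<rho>) ^ m \<rho>)" "\<And>\<rho>. \<rho> \<in> Z \<Longrightarrow> k \<rho> \<noteq> 0"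
      and ld: "\<And>s. s \<in> A \<Longrightarrow> f s \<noteq> 0 \<Longrightarrow> deriv f s / f s = (\<Sum>\<rho>\<in>Z. of_nat (m \<rho>) / (s - \<rho>)) + deriv k s / k s"
    by blast
  have rA: "\<rho> \<in> A" using insert by auto
  have nzk: "\<exists>w\<in>A. k w \<noteq> 0" using insert.prems(4) k(2) by auto
  define n where "n = nat (zorder k \<rho>)"
  define g where "g = zor_poly k \<rho>"
  obtain r where r: "r > 0" "cball \<rho> r \<subseteq> A" "g holomorphic_on cball \<rho> r" "\<And>w. w \<in> cball \<rho> r \<Longrightarrow> k w = g w * (w - \<rho>) ^ n \<and> g w \<noteq> 0"
    using zorder_exist_zero[OF k(1) insert.prems(1,2) rA nzk] unfolding n_def g_def by blast
  \<comment> \<open>The quotient is glued from \<open>zor_poly\<close> near \<rho> and plain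
    division elsewhere, which removes the singularity at \<rho>.\<close>
  define k' where "k' = (\<lambda>w. if w \<in> ball \<rho> r then g w else k w / (w - \<rho>) ^ n)"
  have eq: "k w / (w - \<rho>) ^ n = g w" if "w \<in> ball \<rho> r" "w \<noteq> \<rho>" for w
    using r(4)[of w] that by auto
  have h1: "k' holomorphic_on ball \<rho> r"
    by (rule holomorphic_transform[of g]) (use r(3) in \<open>auto simp: k'_def elim: holomorphic_on_subset\<close>)
  have h2: "k' holomorphic_on A - {\<rho>}"
  proof (rule holomorphic_transform)
    show "(\<lambda>w. k w / (w - \<rho>) ^ n) holomorphic_on A - {\<rho>}"
      by (intro holomorphic_intros holomorphic_on_subset[OF k(1)]) auto
  qed (use eq in \<open>auto simp: k'_def\<close>)
  have "k' holomorphic_on (ball \<rho> r \<union> (A - {\<rho>}))"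
    using insert.prems(1) by (intro holomorphic_on_Un h1 h2) auto
  also have "ball \<rho> r \<union> (A - {\<rho>}) = A" using r(1,2) by auto
  finally have h: "k' holomorphic_on A" .
  have kk: "k w = k' w * (w - \<rho>) ^ n" if "w \<in> A" for w
    using that r(4)[of w] r(1) by (cases "w = \<rho>") (auto simp: k'_def)
  define m' where "m' = m(\<rho> := n)"
  have m': "(\<Prod>\<rho>\<in>Z. (s - \<rho>) ^ m' \<rho>) = (\<Prod>\<rho>\<in>Z. (s - \<rho>) ^ m \<rho>)" 
      "(\<Sum>\<rho>\<in>Z. of_nat (m' \<rho>) / (s - \<rho>)) = (\<Sum>\<rho>\<in>Z. of_nat (m \<rho>) / (s - \<rho>))" for s :: complex
    using insert.hyps by (auto intro!: prod.cong sum.cong simp: m'_def)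
  have "k' \<rho> \<noteq> 0" using r by (simp add: k'_def)
  moreover have "k' \<rho>' \<noteq> 0" if "\<rho>' \<in> Z" for \<rho>'
    using k(3)[OF that] kk[of \<rho>'] that insert.prems by auto
  moreover have "f s = k' s * (\<Prod>\<rho>\<in>insert \<rho> Z. (s - \<rho>) ^ m' \<rho>)" if "s \<in> A" for s
    using insert.hyps k(2)[OF that] kk[OF that] by (simp add: m' mult_ac) (simp add: m'_def)
  moreover have "deriv f s / f s = (\<Sum>\<rho>\<in>insert \<rho> Z. of_nat (m' \<rho>) / (s - \<rho>)) + deriv k' s / k' s" if s: "s \<in> A" "f s \<noteq> 0" for s
  proof -
    have ks: "k s \<noteq> 0" using k(2)[OF s(1)] s by auto
    have dk': "(k' has_field_derivative deriv k' s) (at s)"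
      using holomorphic_derivI[OF h insert.prems(1) s(1)] .
    have "((\<lambda>w. k' w * (w - \<rho>) ^ n) has_field_derivative (deriv k' s * (s - \<rho>) ^ n + of_nat n * (s - \<rho>) ^ (n - 1) * k' s)) (at s)"
      by (rule derivative_eq_intros dk' refl | simp)+
    hence "(k has_field_derivative (deriv k' s * (s - \<rho>) ^ n + of_nat n * (s - \<rho>) ^ (n - 1) * k' s)) (at s)"
      by (rule has_field_derivative_transform_within_open[OF _ insert.prems(1) s(1)]) (use kk in auto)
    hence "deriv k s = deriv k' s * (s - \<rho>) ^ n + of_nat n * (s - \<rho>) ^ (n - 1) * k' s"
      by (rule DERIV_imp_deriv)
    moreover have "k s = k' s * (s - \<rho>) ^ n" using kk s by auto
    moreover have "k' s \<noteq> 0" "n = 0 \<or> s \<noteq> \<rho>" using ks kk[OF s(1)] by auto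
    moreover have "(d * (x * P) + n * P * k) / (k * (x * P)) = n / x + d / k" if "P \<noteq> 0" "x \<noteq> 0" "k \<noteq> 0" for d x P n k :: complex
      using that by (simp add: field_simps)
    ultimately have "deriv k s / k s = of_nat n / (s - \<rho>) + deriv k' s / k' s"
      by (cases n) auto
    thus ?thesis using ld[OF s] insert.hyps by (simp add: m' ) (simp add: m'_def)
  qed
  ultimately show ?case using h by (intro exI[of _ k'] exI[of _ m']) auto
qed

lemma finite_zeros_compact:
  assumes f: "f holomorphic_on A" and A: "open A" "connected A" and K: "compact K" "K \<subseteq> A" and w: "w \<in> A" "f w \<noteq> 0"
  shows "finite {z \<in> K. f z = 0}"
proof (rule ccontr)
  assume inf: "infinite {z \<in> K. f z = 0}"
  obtain l where l: "l \<in> K" "l islimpt {z \<in> K. f z = 0}"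
    using K(1)[unfolded compact_eq_Bolzano_Weierstrass] inf by blast
  have "f w = 0"
  proof (rule analytic_continuation[OF f A])
    show "{z \<in> K. f z = 0} \<subseteq> A" "l \<in> A" using K(2) l by auto
  qed (use l w in auto)
  thus False using w by simp
qed

text \<open>A Jensen-type count: on the outer circle every factor has modulus at least R - r, so the
  maximum principle bounds k by M / (R - r)^N, while at the centre every factor is at most r. The
  condition 2r < R makes the logarithm positive, and R - r >= 1 gives the bound M for k
  itself.\<close>

lemma local_factorization:
  assumes A: "open A" "connected A" and f: "f holomorphic_on A" and sub: "cball c R \<subseteq> A"
    and r: "0 < r" "2 * r < R" "R - r \<ge> 1" and fc: "f c \<noteq> 0" and M: "\<And>s. s \<in> cball c R \<Longrightarrow> norm (f s) \<le> M"
  defines "Z \<equiv> {s \<in> cball c r. f s = 0}"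
  shows "finite Z \<and> (\<exists>k m. k holomorphic_on A \<and> (\<forall>s\<in>A. f s = k s * (\<Prod>\<rho>\<in>Z. (s - \<rho>) ^ m \<rho>)) \<and> (\<forall>s\<in>cball c r. k s \<noteq> 0) \<and>
      (\<forall>s\<in>A. f s \<noteq> 0 \<longrightarrow> deriv f s / f s = (\<Sum>\<rho>\<in>Z. of_nat (m \<rho>) / (s - \<rho>)) + deriv k s / k s) \<and>
      (\<forall>s\<in>cball c r. norm (k s) \<le> M) \<and>
      real (\<Sum>\<rho>\<in>Z. m \<rho>) * ln ((R - r) / r) \<le> ln (M / norm (f c)) \<and>
      norm (f c) \<le> norm (k c) * r ^ (\<Sum>\<rho>\<in>Z. m \<rho>))"
proof -
  have cA: "c \<in> A" using sub r by auto
  have fin: "finite Z"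
    unfolding Z_def by (rule finite_zeros_compact[OF f A]) (use sub r cA fc in auto)
  have ZA: "Z \<subseteq> A" using sub r by (auto simp: Z_def)
  obtain k m where k: "k holomorphic_on A" "\<And>s. s \<in> A \<Longrightarrow> f s = k s * (\<Prod>\<rho>\<in>Z. (s - \<rho>) ^ m \<rho>)" "\<And>\<rho>. \<rho> \<in> Z \<Longrightarrow> k \<rho> \<noteq> 0"
      and ld: "\<And>s. s \<in> A \<Longrightarrow> f s \<noteq> 0 \<Longrightarrow> deriv f s / f s = (\<Sum>\<rho>\<in>Z. of_nat (m \<rho>) / (s - \<rho>)) + deriv k s / k s"
    using holomorphic_factor_finite_zeros[OF fin A f _ ZA] fc cA by blast
  define N where "N = (\<Sum>\<rho>\<in>Z. m \<rho>)"
  have kr: "k s \<noteq> 0" if "s \<in> cball c r" for s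
  proof (cases "f s = 0")
    case True
    thus ?thesis using k(3)[of s] that by (auto simp: Z_def)
  next
    case False
    moreover have "s \<in> A" using that sub r by (intro subsetD[OF sub]) auto
    ultimately show ?thesis using k(2)[of s] by auto
  qed
  have ksphere: "norm (k s) * (R - r) ^ N \<le> M" if "s \<in> sphere c R" for s
  proof -
    have "(R - r) ^ N = (\<Prod>\<rho>\<in>Z. (R - r) ^ m \<rho>)" by (simp add: N_def power_sum)
    also have "\<dots> \<le> (\<Prod>\<rho>\<in>Z. norm (s - \<rho>) ^ m \<rho>)"
    proof (rule prod_mono, safe)
      fix \<rho> assume "\<rho> \<in> Z"
      hence "dist c \<rho> \<le> r" by (simp add: Z_def)
      hence "R - r \<le> norm (s - \<rho>)" using that dist_triangle[of c s \<rho>] by (simp add: dist_norm norm_minus_commute)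
      thus "(R - r) ^ m \<rho> \<le> norm (s - \<rho>) ^ m \<rho>" using r by (intro power_mono) auto
    qed (use r in auto)
    finally have "norm (k s) * (R - r) ^ N \<le> norm (k s) * (\<Prod>\<rho>\<in>Z. norm (s - \<rho>) ^ m \<rho>)"
      by (intro mult_left_mono) auto
    also have "\<dots> = norm (f s)" using k(2)[of s] that sub by (auto simp: norm_mult norm_power prod_norm[symmetric])
    also have "\<dots> \<le> M" using M that by auto
    finally show ?thesis .
  qed
  have kmax: "norm (k s) \<le> M / (R - r) ^ N" if "s \<in> cball c R" for s
  proof (rule maximum_modulus_frontier[of k "cball c R"])
    show "k holomorphic_on interior (cball c R)" by (rule holomorphic_on_subset[OF k(1)]) (use sub in auto)
    show "continuous_on (closure (cball c R)) k" 
      using holomorphic_on_imp_continuous_on[OF holomorphic_on_subset[OF k(1) sub]] by simp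
    show "norm (k z) \<le> M / (R - r) ^ N" if "z \<in> frontier (cball c R)" for z
      using ksphere[of z] that r by (simp add: frontier_cball field_simps)
  qed (use that in auto)
  have M0: "M > 0" using M[of c] fc r by (auto intro: less_le_trans[of 0 "norm (f c)"])
  have kM: "norm (k s) \<le> M" if "s \<in> cball c r" for s
  proof -
    have "norm (k s) \<le> M / (R - r) ^ N" using that r by (intro kmax) auto
    also have "\<dots> \<le> M / 1" using r M0 by (intro divide_left_mono one_le_power) auto
    finally show ?thesis by simp
  qed
  have fck: "norm (f c) \<le> norm (k c) * r ^ N"
  proof -
    have "norm (f c) = norm (k c) * (\<Prod>\<rho>\<in>Z. norm (c - \<rho>) ^ m \<rho>)"
      using k(2)[OF cA] by (simp add: norm_mult norm_power prod_norm[symmetric])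
    also have "\<dots> \<le> norm (k c) * (\<Prod>\<rho>\<in>Z. r ^ m \<rho>)"
      by (intro mult_left_mono prod_mono) (auto simp: Z_def dist_norm intro!: power_mono)
    finally show ?thesis by (simp add: N_def power_sum)
  qed
  have "real N * ln ((R - r) / r) \<le> ln (M / norm (f c))"
  proof -
    have "norm (f c) \<le> M / (R - r) ^ N * r ^ N"
      using r by (intro order_trans[OF fck] mult_right_mono kmax) auto
    hence "((R - r) / r) ^ N \<le> M / norm (f c)"
      using fc r by (simp add: field_simps power_divide)
    hence "ln (((R - r) / r) ^ N) \<le> ln (M / norm (f c))"
      using r fc M0 by (subst ln_le_cancel_iff) auto
    thus ?thesis using r by (simp add: ln_realpow)
  qed
  hence Nl: "real (\<Sum>\<rho>\<in>Z. m \<rho>) * ln ((R - r) / r) \<le> ln (M / norm (f c))" by (simp only: N_def)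
  have fck': "norm (f c) \<le> norm (k c) * r ^ (\<Sum>\<rho>\<in>Z. m \<rho>)" using fck by (simp only: N_def)
  show ?thesis
    by (intro conjI fin exI[of _ k] exI[of _ m] ballI impI k(1,2) kr ld kM Nl fck')
qed

text \<open>The regular part h collects the zeros farther than 2\<delta> from s0, which stay at
  distance \<delta> from the small ball, and k' / k, controlled by Borel-Caratheodory for log k and
  Cauchy's inequality. The derivative of h is bounded rather than h because h will be compared with
  its values on the critical line. N counts the zeros of the whole disc of radius r.\<close>

lemma logderiv_near_zeros:
  assumes A: "open A" "connected A" and f: "f holomorphic_on A" and sub: "cball c R \<subseteq> A"
    and r: "0 < r" "2 * r < R" "R - r \<ge> 1" and fc: "f c \<noteq> 0" and M: "\<And>s. s \<in> cball c R \<Longrightarrow> norm (f s) \<le> M"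
    and \<delta>: "\<delta> > 0" "dist c s0 + 4 * \<delta> \<le> r"
  defines "Z \<equiv> {s \<in> cball s0 (2 * \<delta>). f s = 0}"
  shows "\<exists>N m h. finite Z \<and> (\<forall>\<rho>\<in>Z. m \<rho> \<ge> 1 \<and> zorder f \<rho> = int (m \<rho>)) \<and> (\<Sum>\<rho>\<in>Z. m \<rho>) \<le> N \<and>
     h holomorphic_on ball s0 \<delta> \<and>
     (\<forall>s\<in>ball s0 \<delta>. f s \<noteq> 0 \<longrightarrow> deriv f s / f s = (\<Sum>\<rho>\<in>Z. of_nat (m \<rho>) / (s - \<rho>)) + h s) \<and>
     (\<forall>s\<in>ball s0 \<delta>. norm (deriv h s) \<le> 4 * (ln (M / norm (f c)) + real N * ln r + 1) * r / \<delta> ^ 3 + real N / \<delta>\<^sup>2) \<and>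
     real N * ln ((R - r) / r) \<le> ln (M / norm (f c))"
proof -
  define Z1 where "Z1 = {s \<in> cball c r. f s = 0}"
  obtain k m where fin: "finite Z1" and k: "k holomorphic_on A" "\<And>s. s \<in> A \<Longrightarrow> f s = k s * (\<Prod>\<rho>\<in>Z1. (s - \<rho>) ^ m \<rho>)" 
      and k0: "\<And>s. s \<in> cball c r \<Longrightarrow> k s \<noteq> 0"
      and ld: "\<And>s. s \<in> A \<Longrightarrow> f s \<noteq> 0 \<Longrightarrow> deriv f s / f s = (\<Sum>\<rho>\<in>Z1. of_nat (m \<rho>) / (s - \<rho>)) + deriv k s / k s"
      and kM: "\<And>s. s \<in> cball c r \<Longrightarrow> norm (k s) \<le> M"
      and N: "real (\<Sum>\<rho>\<in>Z1. m \<rho>) * ln ((R - r) / r) \<le> ln (M / norm (f c))"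
      and fck: "norm (f c) \<le> norm (k c) * r ^ (\<Sum>\<rho>\<in>Z1. m \<rho>)"
    using local_factorization[OF A f sub r fc M] unfolding Z1_def by blast
  define N where "N = (\<Sum>\<rho>\<in>Z1. m \<rho>)"
  have cb: "cball s0 (2 * \<delta>) \<subseteq> cball c r"
  proof
    fix s assume "s \<in> cball s0 (2 * \<delta>)"
    thus "s \<in> cball c r" using dist_triangle[of c s s0] \<delta> by simp
  qed
  have ZZ: "Z \<subseteq> Z1" using cb by (auto simp: Z_def Z1_def)
  have finZ: "finite Z" using finite_subset[OF ZZ fin] .
  have crA: "cball c r \<subseteq> A" using sub r by auto
  have cA: "c \<in> cball c r" using r by simp
  have m: "m \<rho> \<ge> 1 \<and> zorder f \<rho> = int (m \<rho>)" if "\<rho> \<in> Z" for \<rho>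
  proof -
    have \<rho>: "\<rho> \<in> Z1" using that ZZ by blast
    hence \<rho>': "\<rho> \<in> cball c r" "f \<rho> = 0" by (auto simp: Z1_def)
    have \<rho>A: "\<rho> \<in> A" using \<rho>'(1) crA by blast
    define g where "g = (\<lambda>s. k s * (\<Prod>\<rho>'\<in>Z1 - {\<rho>}. (s - \<rho>') ^ m \<rho>'))"
    have fg: "f w = g w * (w - \<rho>) ^ m \<rho>" if "w \<in> A" for w
      using k(2)[OF that] \<rho> fin by (simp add: g_def prod.remove mult_ac)
    have g0: "g \<rho> \<noteq> 0" using k0[OF \<rho>'(1)] fin by (auto simp: g_def)
    have "zorder f \<rho> = int (m \<rho>)"
    proof (rule zorder_eqI[OF A(1) \<rho>A])
      show "g holomorphic_on A" unfolding g_def by (intro holomorphic_intros k)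
    qed (use g0 fg in auto)
    moreover have "m \<rho> \<noteq> 0" using fg[OF \<rho>A] g0 \<rho>'(2) by (cases "m \<rho>") auto
    ultimately show ?thesis by simp
  qed
  \<comment> \<open>Upper bound for Re g = ln |k s| - ln |k c|; the summand 1 makes it strict and B
    positive.\<close>
  define B where "B = ln (M / norm (f c)) + real N * ln r + 1"
  have M0: "M > 0" using M[of c] fc r by (auto intro: less_le_trans[of 0 "norm (f c)"])
  have cxb: "ball c r \<subseteq> cball c r" by auto
  obtain g1 where g1: "g1 holomorphic_on ball c r" "\<And>x. x \<in> ball c r \<Longrightarrow> exp (g1 x) = k x"
    by (rule holomorphic_logarithm_exists[of "ball c r" k c])
       (use k0 crA r cxb in \<open>auto intro!: holomorphic_on_subset[OF k(1)]\<close>)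
  define g where "g = (\<lambda>s. g1 s - g1 c)"
  have hg: "g holomorphic_on ball c r" unfolding g_def by (intro holomorphic_intros g1)
  have Reg: "Re (g s) < B" if "s \<in> ball c r" for s
  proof -
    have nz: "k s \<noteq> 0" "k c \<noteq> 0" using k0[of s] k0[of c] that r by auto
    have e: "norm (k s) = exp (Re (g1 s))" "norm (k c) = exp (Re (g1 c))"
      using g1(2)[OF that] g1(2)[of c] r by (metis norm_exp_eq_Re centre_in_ball)+
    have "Re (g s) = ln (norm (k s)) - ln (norm (k c))" by (simp add: g_def e)
    also have "\<dots> \<le> ln M - (ln (norm (f c)) - real N * ln r)"
    proof (rule diff_mono)
      show "ln (norm (k s)) \<le> ln M" using kM[of s] nz that M0 by (subst ln_le_cancel_iff) auto
      have "ln (norm (f c)) \<le> ln (norm (k c) * r ^ N)" using fck fc nz r by (subst ln_le_cancel_iff) (auto simp: N_def)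
      also have "\<dots> = ln (norm (k c)) + real N * ln r" using nz r by (simp add: ln_mult ln_realpow)
      finally show "ln (norm (f c)) - real N * ln r \<le> ln (norm (k c))" by simp
    qed
    also have "\<dots> < B" using M0 fc by (simp add: B_def ln_div)
    finally show ?thesis .
  qed
  have B0: "B > 0" using Reg[of c] r by (simp add: g_def)
  have gb: "norm (g s) \<le> 2 * B * r / \<delta>" if "norm (s - c) \<le> r - \<delta>" for s
  proof -
    have "norm (g s) \<le> 2 * B * (r - \<delta>) / (r - (r - \<delta>))"
      by (rule Borel_Caratheodory_bound[OF hg _ Reg that]) (use \<delta> in \<open>auto simp: g_def\<close>)
    also have "\<dots> \<le> 2 * B * r / (r - (r - \<delta>))"
      using \<delta> B0 by (intro divide_right_mono mult_left_mono) auto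
    also have "\<dots> = 2 * B * r / \<delta>" by simp
    finally show ?thesis .
  qed
  have dg: "deriv g s = deriv k s / k s" if "s \<in> ball c r" for s
  proof -
    have "(g has_field_derivative deriv g s) (at s)" by (rule holomorphic_derivI[OF hg open_ball that])
    hence "((\<lambda>s. exp (g1 c) * exp (g s)) has_field_derivative (exp (g1 c) * (exp (g s) * deriv g s))) (at s)"
      by (auto intro!: derivative_eq_intros)
    moreover have ek: "exp (g1 c) * exp (g w) = k w" if "w \<in> ball c r" for w
      using g1(2)[OF that] by (simp add: g_def flip: exp_add)
    ultimately have "(k has_field_derivative (exp (g1 c) * (exp (g s) * deriv g s))) (at s)"
      using has_field_derivative_transform_within_open[OF _ open_ball that] by blast
    hence "deriv k s = k s * deriv g s" using ek[OF that] by (simp add: DERIV_imp_deriv flip: mult.assoc)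
    thus ?thesis using k0[of s] that by auto
  qed
  have sub2: "ball s0 \<delta> \<subseteq> ball c r" 
  proof
    fix s assume "s \<in> ball s0 \<delta>"
    thus "s \<in> ball c r" using dist_triangle[of c s s0] \<delta> by simp
  qed
  define h where "h = (\<lambda>s. (\<Sum>\<rho>\<in>Z1 - Z. of_nat (m \<rho>) / (s - \<rho>)) + deriv g s)"
  have far: "norm (s - \<rho>) \<ge> \<delta>" if "\<rho> \<in> Z1 - Z" "s \<in> ball s0 \<delta>" for s \<rho>
  proof -
    have "dist s0 \<rho> > 2 * \<delta>" using that by (auto simp: Z1_def Z_def)
    thus ?thesis using that(2) dist_triangle[of s0 \<rho> s] by (simp add: dist_norm)
  qed
  have hh: "h holomorphic_on ball s0 \<delta>"
    unfolding h_def by (intro holomorphic_intros holomorphic_on_subset[OF hg]) (use far \<delta> sub2 in force)+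
  have split: "deriv f s / f s = (\<Sum>\<rho>\<in>Z. of_nat (m \<rho>) / (s - \<rho>)) + h s" if "s \<in> ball s0 \<delta>" "f s \<noteq> 0" for s
  proof -
    have sr: "s \<in> ball c r" using sub2 that by auto
    have "(\<Sum>\<rho>\<in>Z1. of_nat (m \<rho>) / (s - \<rho>)) = (\<Sum>\<rho>\<in>Z. of_nat (m \<rho>) / (s - \<rho>)) + (\<Sum>\<rho>\<in>Z1 - Z. of_nat (m \<rho>) / (s - \<rho>))"
      using sum.subset_diff[OF ZZ fin, of "\<lambda>\<rho>. of_nat (m \<rho>) / (s - \<rho>)"] by (simp add: add.commute)
    moreover have "s \<in> A" using sr crA cxb by blast
    ultimately show ?thesis using ld[of s] that dg[OF sr] by (simp add: h_def)
  qed
  have dh: "norm (deriv h s) \<le> 4 * B * r / \<delta> ^ 3 + real N / \<delta>\<^sup>2" if s: "s \<in> ball s0 \<delta>" for s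
  proof -
    have sr: "s \<in> ball c r" using sub2 s by auto
    have ddg: "(deriv g has_field_derivative deriv (deriv g) s) (at s)"
      by (rule holomorphic_derivI[OF _ open_ball sr]) (intro holomorphic_intros hg; simp)
    have "(h has_field_derivative ((\<Sum>\<rho>\<in>Z1 - Z. - of_nat (m \<rho>) / (s - \<rho>)\<^sup>2) + deriv (deriv g) s)) (at s)"
      unfolding h_def
    proof (intro DERIV_add DERIV_sum ddg)
      fix \<rho> assume "\<rho> \<in> Z1 - Z"
      hence "s - \<rho> \<noteq> 0" using far[of \<rho> s] s \<delta> by auto
      thus "((\<lambda>s. of_nat (m \<rho>) / (s - \<rho>)) has_field_derivative - of_nat (m \<rho>) / (s - \<rho>)\<^sup>2) (at s)"
        by (auto intro!: derivative_eq_intros simp: power2_eq_square)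
    qed
    hence e: "deriv h s = (\<Sum>\<rho>\<in>Z1 - Z. - of_nat (m \<rho>) / (s - \<rho>)\<^sup>2) + deriv (deriv g) s"
      by (rule DERIV_imp_deriv)
    have a: "norm (\<Sum>\<rho>\<in>Z1 - Z. - of_nat (m \<rho>) / (s - \<rho>)\<^sup>2) \<le> real N / \<delta>\<^sup>2"
    proof -
      have "norm (\<Sum>\<rho>\<in>Z1 - Z. - of_nat (m \<rho>) / (s - \<rho>)\<^sup>2) \<le> (\<Sum>\<rho>\<in>Z1 - Z. real (m \<rho>) / \<delta>\<^sup>2)"
      proof (rule sum_norm_le)
        fix \<rho> assume "\<rho> \<in> Z1 - Z"
        hence "\<delta> \<le> norm (s - \<rho>)" using far s by auto
        hence "\<delta>\<^sup>2 \<le> (norm (s - \<rho>))\<^sup>2" using \<delta> by (intro power_mono) auto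
        hence "real (m \<rho>) / (norm (s - \<rho>))\<^sup>2 \<le> real (m \<rho>) / \<delta>\<^sup>2"
          using \<delta> by (intro divide_left_mono mult_pos_pos) (auto intro: less_le_trans[of 0 "\<delta>\<^sup>2"])
        thus "norm (- of_nat (m \<rho>) / (s - \<rho>)\<^sup>2) \<le> real (m \<rho>) / \<delta>\<^sup>2" by (simp add: norm_divide norm_power)
      qed
      also have "\<dots> \<le> (\<Sum>\<rho>\<in>Z1. real (m \<rho>) / \<delta>\<^sup>2)" using fin by (intro sum_mono2) auto
      also have "\<dots> = real N / \<delta>\<^sup>2" by (simp add: N_def sum_divide_distrib)
      finally show ?thesis .
    qed
    have b: "norm (deriv (deriv g) s) \<le> 4 * B * r / \<delta> ^ 3"
    proof -
      \<comment> \<open>The room 4\<delta> in the hypothesis pays for moving from s0 to s, for the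
        Cauchy circle, and for the gap \<delta> of Borel-Caratheodory.\<close>
      have in2: "cball s \<delta> \<subseteq> ball c r" and nn: "\<And>x. x \<in> cball s \<delta> \<Longrightarrow> norm (x - c) \<le> r - \<delta>"
      proof -
        have *: "dist c x \<le> r - 2 * \<delta>" if "x \<in> cball s \<delta>" for x
          using that s \<delta> dist_triangle[of c x s] dist_triangle[of c s s0] by simp
        show "cball s \<delta> \<subseteq> ball c r" using * \<delta> by force
        show "norm (x - c) \<le> r - \<delta>" if "x \<in> cball s \<delta>" for x using *[OF that] \<delta> by (simp add: dist_norm norm_minus_commute)
      qed
      have "norm ((deriv ^^ 2) g s) \<le> fact 2 * (2 * B * r / \<delta>) / \<delta> ^ 2"
      proof (rule Cauchy_inequality)
        show "g holomorphic_on ball s \<delta>" using in2 by (intro holomorphic_on_subset[OF hg]) auto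
        show "continuous_on (cball s \<delta>) g" using in2 by (intro holomorphic_on_imp_continuous_on holomorphic_on_subset[OF hg])
        show "norm (g x) \<le> 2 * B * r / \<delta>" if "norm (s - x) = \<delta>" for x
          using that by (intro gb nn) (auto simp: dist_norm)
      qed (use \<delta> in auto)
      also have "fact 2 * (2 * B * r / \<delta>) / \<delta> ^ 2 = 4 * B * r / \<delta> ^ 3" 
        using \<delta> by (simp add: power2_eq_square power3_eq_cube)
      finally show ?thesis by (simp add: numeral_2_eq_2)
    qed
    show ?thesis unfolding e using norm_triangle_mono[OF a b] by (simp only: add.commute)
  qed
  have NZ: "(\<Sum>\<rho>\<in>Z. m \<rho>) \<le> N" unfolding N_def using fin ZZ by (intro sum_mono2) auto
  show ?thesis
    using finZ m NZ hh split dh[unfolded B_def] N[folded N_def] by blast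
qed

text \<open>
  The centre $19/10 + iT$ is a compromise: discs around it that reach the critical line must fit twice
  into the half plane $\mathrm{Re}\,s > -1$, so its real part has to be below 2, and the terms
  $n \ge 2$ of the Dirichlet series must not outweigh the first one.
\<close>
lemma zeta_lower_bound: "norm (zeta (Complex (19/10) T)) \<ge> 1/10"
proof -
  define c where "c = Complex (19/10) T"
  have rc: "Re c = 19/10" by (simp add: c_def)
  \<comment> \<open>The term n = 2 has modulus 1 / (2x) and the tail is at most (10/9) / x, so x >=
    1.82 leaves 1 - (1/2 + 10/9) / 1.82 > 1/10.\<close>
  define x :: real where "x = 2 powr (9/10)"
  have x: "x \<ge> 182/100"
  proof (rule ccontr)
    assume "\<not> ?thesis"
    hence "x ^ 10 < (182/100) ^ 10" by (intro power_strict_mono) (auto simp: x_def)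
    hence "x ^ 10 < 182 ^ 10 / 100 ^ 10" by (simp add: power_divide)
    moreover have "x ^ 10 = 512" by (simp add: x_def powr_power)
    ultimately show False by simp
  qed
  \<comment> \<open>\<open>b n\<close> is the integral of t powr (-19/10) over [n + 2, n + 3]; it
    dominates the term of index n + 3 and telescopes.\<close>
  define b where "b = (\<lambda>n. 10/9 * (real (n + 2) powr (-9/10) - real (Suc n + 2) powr (-9/10)))"
  have b: "b sums (10/9 * inverse x)"
  proof -
    have "(\<lambda>n. real (n + 2) powr (-9/10)) \<longlonglongrightarrow> 0"
      by (rule tendsto_neg_powr[OF _ filterlim_compose[OF filterlim_real_sequentially filterlim_add_const_nat_at_top]]) auto
    from sums_mult[OF telescope_sums'[OF this], of "10/9"] show ?thesis by (simp add: b_def x_def powr_minus)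
  qed
  have ab: "norm (of_nat (Suc (n + 2)) powr (- c)) \<le> b n" for n
  proof -
    have "\<exists>\<xi>>real (n + 2). \<xi> < real (n + 3) \<and> real (n + 3) powr (-9/10) - real (n + 2) powr (-9/10) = (real (n + 3) - real (n + 2)) * (-9/10 * \<xi> powr (-9/10 - 1))"
      by (rule MVT2) (auto intro!: derivative_eq_intros simp: field_simps)
    then obtain \<xi> where xi: "\<xi> > real (n + 2)" "\<xi> < real (n + 3)" "real (n + 3) powr (-9/10) - real (n + 2) powr (-9/10) = -9/10 * \<xi> powr (-19/10)"
      by auto
    have "norm (of_nat (Suc (n + 2)) powr (- c)) = real (n + 3) powr (-19/10)"
      using norm_powr_real_powr[of "of_nat (Suc (n + 2))" "-c"] rc by (simp add: add.commute)
    also have "\<dots> \<le> \<xi> powr (-19/10)" using xi by (intro powr_mono2') auto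
    also have "\<dots> = b n" using xi(3) by (simp add: b_def add.commute)
    finally show ?thesis .
  qed
  have "(\<lambda>n. of_nat (Suc n) powr (- c)) sums zeta c"
    using zeta_num_sums[of c] zeta_eq[of c] rc by simp
  hence "(\<lambda>n. of_nat (Suc (n + 2)) powr (- c)) sums (zeta c - (\<Sum>n<2. of_nat (Suc n) powr (- c)))"
    by (rule sums_split_initial_segment)
  hence s: "(\<lambda>n. of_nat (Suc (n + 2)) powr (- c)) sums (zeta c - (1 + 2 powr (- c)))"
    by (simp add: numeral_2_eq_2)
  have "norm (zeta c - (1 + 2 powr (- c))) \<le> 10/9 * inverse x"
    by (rule norm_sums_le[OF s b ab])
  moreover have "norm ((2::complex) powr (- c)) = inverse x / 2"
  proof -
    have "norm ((2::complex) powr (- c)) = 2 powr (- (19/10))" using norm_powr_real_powr[of 2 "-c"] rc by simp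
    also have "- (19/10) = - (9/10) + (- 1 :: real)" by simp
    also have "2 powr (- (9/10) + (- 1 :: real)) = inverse x / 2" unfolding powr_add x_def by (simp add: powr_minus)
    finally show ?thesis .
  qed
  moreover have "inverse x \<le> 100/182" using le_imp_inverse_le[OF x] by simp
  moreover have "1 \<le> norm (zeta c) + norm ((2::complex) powr (- c)) + norm (zeta c - (1 + 2 powr (- c)))"
  proof -
    have "1 = norm (zeta c - 2 powr (- c) - (zeta c - (1 + 2 powr (- c))))" by simp
    also have "\<dots> \<le> norm (zeta c) + norm ((2::complex) powr (- c)) + norm (zeta c - (1 + 2 powr (- c)))"
      by (meson add_right_mono norm_triangle_ineq4 order_trans)
    finally show ?thesis .
  qed
  ultimately show ?thesis unfolding c_def[symmetric] by linarith
qed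

text \<open>The radii satisfy 14/10 + 4/1000 <= 141/100 and 2 * 141/100 < 285/100 < 289/100 < 29/10,
  where 14/10 is the distance from the centre to the critical line and 29/10 its distance to Re s =
  -1. One constant serves for the zero count and for h', so that a single parameter remains
  later.\<close>

lemma zeta_near_critical_point:
  "\<exists>C>0. \<exists>t0\<ge>3. \<forall>T\<ge>t0. \<exists>Z m h. 
     Z = {s \<in> cball (Complex (1/2) T) (1/500). zeta s = 0} \<and> finite Z \<and> 
     (\<forall>\<rho>\<in>Z. m \<rho> \<ge> (1::nat) \<and> zorder zeta \<rho> = int (m \<rho>)) \<and> real (\<Sum>\<rho>\<in>Z. m \<rho>) \<le> C * ln T \<and>
     h holomorphic_on ball (Complex (1/2) T) (1/1000) \<and>
     (\<forall>s\<in>ball (Complex (1/2) T) (1/1000). zeta s \<noteq> 0 \<longrightarrow> deriv zeta s / zeta s = (\<Sum>\<rho>\<in>Z. of_nat (m \<rho>) / (s - \<rho>)) + h s) \<and>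
     (\<forall>s\<in>ball (Complex (1/2) T) (1/1000). norm (deriv h s) \<le> C * ln T)"
proof -
  obtain K where K: "K > 0" "\<And>s. Re s \<ge> -0.95 \<Longrightarrow> norm (zeta_num s) \<le> K * (norm s + 1) ^ 3"
    using zeta_num_bound by auto
  \<comment> \<open>(R - r) / r = 144/141 for R = 285/100 and r = 141/100.\<close>
  define q where "q = ln (144/141 :: real)"
  have q: "q > 0" by (simp add: q_def)
  define C1 where "C1 = 10 / q"
  define C2 where "C2 = 4 * (10 + C1 * ln (141/100) + 1) * (141/100) / (1/1000) ^ 3 + C1 / (1/1000)\<^sup>2"
  have C1: "C1 > 0" using q by (simp add: C1_def)
  have l141: "ln (141/100 :: real) \<ge> 0" by simp
  have C2: "C2 > 0" unfolding C2_def using C1 l141 by (intro add_pos_pos mult_pos_pos divide_pos_pos add_nonneg_pos mult_nonneg_nonneg) auto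
  define t0 where "t0 = max 3 (10 * K)"
  show ?thesis
  proof (rule exI[of _ "C1 + C2"], intro conjI exI[of _ t0] allI impI)
    show "C1 + C2 > 0" using C1 C2 by simp
    show "t0 \<ge> 3" by (simp add: t0_def)
    fix T assume T: "T \<ge> t0"
    hence T3: "T \<ge> 3" "T \<ge> 10 * K" by (auto simp: t0_def)
    have lnT: "ln T \<ge> 1" 
    proof -
      have "exp 1 \<le> T" using exp_le T3 by linarith
      thus ?thesis using T3 by (simp add: ln_ge_iff)
    qed
    define c where "c = Complex (19/10) T"
    define s0 where "s0 = Complex (1/2) T"
    define A where "A = ball c (289/100)"
    have Re: "Re s \<ge> -0.95" "norm (s - 1) \<ge> 1/10" "norm s \<le> T + 5" if "s \<in> cball c (285/100)" for s
    proof -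
      have d: "norm (c - s) \<le> 285/100" using that by (simp add: dist_norm)
      show "Re s \<ge> -0.95" using abs_Re_le_cmod[of "c - s"] d by (simp add: c_def abs_le_iff)
      have "Im s \<ge> 1/10" using abs_Im_le_cmod[of "c - s"] d T3 by (simp add: c_def abs_le_iff)
      thus "norm (s - 1) \<ge> 1/10" using abs_Im_le_cmod[of "s - 1"] by simp
      have "norm c \<le> 19/10 + T" using cmod_le[of c] T3 by (simp add: c_def)
      thus "norm s \<le> T + 5" using d norm_triangle_sub[of s c] by (simp add: norm_minus_commute)
    qed
    have ReA: "Re s > -1" "s \<noteq> 1" if "s \<in> A" for s
    proof -
      have d: "norm (c - s) < 289/100" using that by (simp add: dist_norm A_def)
      show "Re s > -1" using abs_Re_le_cmod[of "c - s"] d by (simp add: c_def abs_le_iff)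
      show "s \<noteq> 1" using abs_Im_le_cmod[of "c - s"] d T3 by (auto simp: c_def abs_le_iff)
    qed
    define M where "M = 10 * K * (T + 6) ^ 3"
    have M: "norm (zeta s) \<le> M" if "s \<in> cball c (285/100)" for s
    proof -
      have "norm (zeta s) = norm (zeta_num s) / norm (s - 1)" using Re[OF that] by (simp add: zeta_eq norm_divide)
      also have "\<dots> \<le> K * (norm s + 1) ^ 3 / (1/10)" using Re[OF that] K by (intro frac_le) auto
      also have "\<dots> \<le> K * (T + 6) ^ 3 / (1/10)"
        using Re[OF that] K(1) by (intro divide_right_mono mult_left_mono power_mono) auto
      finally show ?thesis by (simp add: M_def)
    qed
    have fc: "norm (zeta c) \<ge> 1/10" unfolding c_def by (rule zeta_lower_bound)
    \<comment> \<open>T >= 10K absorbs the growth constant and T >= 3 the numerical factors, leaving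
      a pure power of T.\<close>
    have lM: "ln (M / norm (zeta c)) \<le> 10 * ln T"
    proof -
      have "M / norm (zeta c) \<le> M / (1/10)" using fc K T3 by (intro divide_left_mono) (auto simp: M_def)
      also have "\<dots> = 10 * (10 * K) * (T + 6) ^ 3" by (simp add: M_def)
      also have "\<dots> \<le> 10 * T * (3 * T) ^ 3" using T3 K by (intro mult_mono power_mono) auto
      also have "\<dots> = 270 * T ^ 4" by (simp add: power3_eq_cube power4_eq_xxxx)
      also have "\<dots> \<le> 3 ^ 6 * T ^ 4" by (intro mult_right_mono) (use T3 in auto)
      also have "\<dots> \<le> T ^ 6 * T ^ 4" by (intro mult_right_mono power_mono) (use T3 in auto)
      also have "\<dots> = T ^ 10" by (simp flip: power_add)
      finally have "ln (M / norm (zeta c)) \<le> ln (T ^ 10)"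
      proof (subst ln_le_cancel_iff)
        have "M > 0" using K T3 by (simp add: M_def)
        thus "M / norm (zeta c) > 0" using fc by (intro divide_pos_pos) auto
      qed (use T3 in auto)
      also have "\<dots> = 10 * ln T" using T3 by (simp add: ln_realpow)
      finally show ?thesis .
    qed
    define Z where "Z = {s \<in> cball s0 (2 * (1/1000)). zeta s = 0}"
    have "\<exists>N m h. finite Z \<and> (\<forall>\<rho>\<in>Z. m \<rho> \<ge> 1 \<and> zorder zeta \<rho> = int (m \<rho>)) \<and> (\<Sum>\<rho>\<in>Z. m \<rho>) \<le> N \<and>
     h holomorphic_on ball s0 (1/1000) \<and>
     (\<forall>s\<in>ball s0 (1/1000). zeta s \<noteq> 0 \<longrightarrow> deriv zeta s / zeta s = (\<Sum>\<rho>\<in>Z. of_nat (m \<rho>) / (s - \<rho>)) + h s) \<and>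
     (\<forall>s\<in>ball s0 (1/1000). norm (deriv h s) \<le> 4 * (ln (M / norm (zeta c)) + real N * ln (141/100) + 1) * (141/100) / (1/1000) ^ 3 + real N / (1/1000)\<^sup>2) \<and>
     real N * ln ((285/100 - 141/100) / (141/100)) \<le> ln (M / norm (zeta c))"
      unfolding Z_def
    proof (rule logderiv_near_zeros)
      show "open A" "connected A" by (auto simp: A_def)
      show "zeta holomorphic_on A" by (rule holomorphic_on_subset[OF holomorphic_zeta]) (use ReA in auto)
      show "cball c (285/100) \<subseteq> A" by (auto simp: A_def)
      have "dist c s0 = 14/10"
      proof -
        have "c - s0 = of_real (14/10)" by (simp add: c_def s0_def complex_eq_iff)
        hence "dist c s0 = \<bar>14/10\<bar>" by (simp only: dist_norm norm_of_real)
        thus ?thesis by simp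
      qed
      thus "dist c s0 + 4 * (1/1000) \<le> 141/100" by simp
    qed (use fc M in auto)
    then obtain N m h where fin: "finite Z" and m: "\<forall>\<rho>\<in>Z. m \<rho> \<ge> 1 \<and> zorder zeta \<rho> = int (m \<rho>)" 
      and mN: "(\<Sum>\<rho>\<in>Z. m \<rho>) \<le> N" and h: "h holomorphic_on ball s0 (1/1000)"
      and split: "\<forall>s\<in>ball s0 (1/1000). zeta s \<noteq> 0 \<longrightarrow> deriv zeta s / zeta s = (\<Sum>\<rho>\<in>Z. of_nat (m \<rho>) / (s - \<rho>)) + h s"
      and dh: "\<And>s. s\<in>ball s0 (1/1000) \<Longrightarrow> norm (deriv h s) \<le> 4 * (ln (M / norm (zeta c)) + real N * ln (141/100) + 1) * (141/100) / (1/1000) ^ 3 + real N / (1/1000)\<^sup>2"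
      and Nq: "real N * ln ((285/100 - 141/100) / (141/100)) \<le> ln (M / norm (zeta c))"
      by blast
    have "real N * q \<le> 10 * ln T" using Nq lM by (simp add: q_def)
    hence N: "real N \<le> C1 * ln T" using q by (simp add: C1_def field_simps)
    have dh': "norm (deriv h s) \<le> (C1 + C2) * ln T" if "s \<in> ball s0 (1/1000)" for s
    proof -
      have "norm (deriv h s) \<le> 4 * (ln (M / norm (zeta c)) + real N * ln (141/100) + 1) * (141/100) / (1/1000) ^ 3 + real N / (1/1000)\<^sup>2"
        by (rule dh[OF that])
      also have "\<dots> \<le> 4 * (10 * ln T + C1 * ln T * ln (141/100) + ln T) * (141/100) / (1/1000) ^ 3 + C1 * ln T / (1/1000)\<^sup>2"
        using lM N lnT l141 by (intro add_mono divide_right_mono mult_right_mono mult_left_mono) auto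
      also have "\<dots> = C2 * ln T" by (simp add: C2_def algebra_simps)
      also have "\<dots> \<le> (C1 + C2) * ln T" using C1 lnT by (intro mult_right_mono) auto
      finally show ?thesis .
    qed
    have Zeq: "Z = {s \<in> cball (Complex (1/2) T) (1/500). zeta s = 0}" by (simp add: Z_def s0_def)
    have "real (\<Sum>\<rho>\<in>Z. m \<rho>) \<le> C1 * ln T" using mN N by linarith
    also have "\<dots> \<le> (C1 + C2) * ln T" using C2 lnT by (intro mult_right_mono) auto
    finally have mC: "real (\<Sum>\<rho>\<in>Z. m \<rho>) \<le> (C1 + C2) * ln T" .
    show "\<exists>Z m h. 
     Z = {s \<in> cball (Complex (1/2) T) (1/500). zeta s = 0} \<and> finite Z \<and> 
     (\<forall>\<rho>\<in>Z. m \<rho> \<ge> (1::nat) \<and> zorder zeta \<rho> = int (m \<rho>)) \<and> real (\<Sum>\<rho>\<in>Z. m \<rho>) \<le> (C1 + C2) * ln T \<and>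
     h holomorphic_on ball (Complex (1/2) T) (1/1000) \<and>
     (\<forall>s\<in>ball (Complex (1/2) T) (1/1000). zeta s \<noteq> 0 \<longrightarrow> deriv zeta s / zeta s = (\<Sum>\<rho>\<in>Z. of_nat (m \<rho>) / (s - \<rho>)) + h s) \<and>
     (\<forall>s\<in>ball (Complex (1/2) T) (1/1000). norm (deriv h s) \<le> (C1 + C2) * ln T)"
      using Zeq fin m mC h split dh' unfolding s0_def by blast
  qed
qed

subsection \<open>Poles in reflected pairs\<close>

text \<open>Common denominator of the two poles. The factor 1/2 - Re s makes the pair vanish on the
  critical line, and the sign to its left is that of a difference which is negative when s is
  farther from \<rho> vertically and from the line together than \<rho> is from the line.\<close>

lemma Re_reflected_pair:
  fixes s \<rho> :: complex
  assumes "s \<noteq> \<rho>" "s \<noteq> 1 - cnj \<rho>"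
  shows "Re (1 / (s - \<rho>)) + Re (1 / (s - (1 - cnj \<rho>))) = 
    2 * (1/2 - Re s) * ((Re \<rho> - 1/2)\<^sup>2 - (1/2 - Re s)\<^sup>2 - (Im s - Im \<rho>)\<^sup>2) / ((norm (s - \<rho>))\<^sup>2 * (norm (s - (1 - cnj \<rho>)))\<^sup>2)"
proof -
  define X d Y where "X = 1/2 - Re s" "d = Re \<rho> - 1/2" "Y = Im s - Im \<rho>"
  have Re1: "Re (1 / z) = Re z / (norm z)\<^sup>2" for z :: complex by (simp add: Re_divide cmod_power2)
  have P: "(norm (s - \<rho>))\<^sup>2 = (X + d)\<^sup>2 + Y\<^sup>2" and Q: "(norm (s - (1 - cnj \<rho>)))\<^sup>2 = (d - X)\<^sup>2 + Y\<^sup>2"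
    unfolding cmod_power2 X_d_Y_def by (simp_all add: power2_eq_square algebra_simps)
  have R: "Re (s - \<rho>) = - (X + d)" "Re (s - (1 - cnj \<rho>)) = d - X" by (simp_all add: X_d_Y_def)
  have nz: "(norm (s - \<rho>))\<^sup>2 \<noteq> 0" "(norm (s - (1 - cnj \<rho>)))\<^sup>2 \<noteq> 0" using assms by auto
  have "Re (1 / (s - \<rho>)) + Re (1 / (s - (1 - cnj \<rho>))) = 
    (- (X + d) * (norm (s - (1 - cnj \<rho>)))\<^sup>2 + (d - X) * (norm (s - \<rho>))\<^sup>2) / ((norm (s - \<rho>))\<^sup>2 * (norm (s - (1 - cnj \<rho>)))\<^sup>2)"
    unfolding Re1 R by (rule add_frac_eq[OF nz])
  also have "- (X + d) * (norm (s - (1 - cnj \<rho>)))\<^sup>2 + (d - X) * (norm (s - \<rho>))\<^sup>2 = 2 * X * (d\<^sup>2 - X\<^sup>2 - Y\<^sup>2)"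
    unfolding P Q by (simp add: power2_eq_square algebra_simps)
  finally show ?thesis unfolding X_d_Y_def .
qed

text \<open>\<open>Z\<close> may contain zeros outside \<open>ball s0 \<delta>\<close>: those just
  beyond its edge must stay explicit poles, or h' could not be bounded on the ball. Hence
  \<open>Zf\<close> concerns only the ball, whereas \<open>sym\<close> concerns all of
  \<open>Z\<close>.\<close>

locale critical_zeros =
  fixes f :: "complex \<Rightarrow> complex" and s0 :: complex and Z :: "complex set" and m :: "complex \<Rightarrow> nat"
    and h :: "complex \<Rightarrow> complex" and \<delta> D N :: real
  assumes Re0: "Re s0 = 1/2" and \<delta>: "\<delta> > 0" and finZ: "finite Z"
    and fZ: "\<And>\<rho>. \<rho> \<in> Z \<Longrightarrow> f \<rho> = 0" and Zf: "\<And>s. s \<in> ball s0 \<delta> \<Longrightarrow> f s = 0 \<Longrightarrow> s \<in> Z"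
    and sym: "\<And>\<rho>. \<rho> \<in> Z \<Longrightarrow> 1 - cnj \<rho> \<in> Z \<and> m (1 - cnj \<rho>) = m \<rho>"
    and m1: "\<And>\<rho>. \<rho> \<in> Z \<Longrightarrow> m \<rho> \<ge> 1" and mN: "real (\<Sum>\<rho>\<in>Z. m \<rho>) \<le> N"
    and expansion: "\<And>s. s \<in> ball s0 \<delta> \<Longrightarrow> f s \<noteq> 0 \<Longrightarrow> deriv f s / f s = (\<Sum>\<rho>\<in>Z. of_nat (m \<rho>) / (s - \<rho>)) + h s"
    and hol: "h holomorphic_on ball s0 \<delta>" and D: "\<And>s. s \<in> ball s0 \<delta> \<Longrightarrow> norm (deriv h s) \<le> D"
    and line: "\<And>s. s \<in> ball s0 \<delta> \<Longrightarrow> Re s = 1/2 \<Longrightarrow> f s \<noteq> 0 \<Longrightarrow> Re (deriv f s / f s) \<le> -1"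
begin

definition pairsum :: "complex \<Rightarrow> complex \<Rightarrow> real" where
  "pairsum s \<rho> = Re (1 / (s - \<rho>)) + Re (1 / (s - (1 - cnj \<rho>)))"

text \<open>Reindexing by the reflection and averaging. Halving treats zeros on the line, which are
  their own mirror images, and genuine pairs uniformly.\<close>

lemma Re_poles_eq: "Re (\<Sum>\<rho>\<in>Z. of_nat (m \<rho>) / (s - \<rho>)) = (\<Sum>\<rho>\<in>Z. real (m \<rho>) * pairsum s \<rho>) / 2"
proof -
  have R: "Re (of_nat n / z) = real n * Re (1 / z)" for n z
    by (simp add: Re_divide)
  have "(\<Sum>\<rho>\<in>Z. real (m \<rho>) * Re (1 / (s - \<rho>))) = (\<Sum>\<rho>\<in>Z. real (m \<rho>) * Re (1 / (s - (1 - cnj \<rho>))))"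
    by (rule sum.reindex_bij_witness[of _ "\<lambda>\<rho>. 1 - cnj \<rho>" "\<lambda>\<rho>. 1 - cnj \<rho>"]) (use sym in auto)
  thus ?thesis by (simp add: R pairsum_def ring_distribs sum.distrib)
qed

lemma reflect_neq: "s \<notin> Z \<Longrightarrow> \<rho> \<in> Z \<Longrightarrow> s \<noteq> \<rho> \<and> s \<noteq> 1 - cnj \<rho>"
  using sym by auto

text \<open>The poles contribute nothing on the line, so h inherits the bound of f' / f wherever f
  does not vanish. Continuity extends it across the finitely many zeros, approached along the
  line.\<close>

lemma Re_regular_part_critical_line:
  assumes s: "s \<in> ball s0 \<delta>" "Re s = 1/2"
  shows "Re (h s) \<le> -1"
proof (rule ccontr)
  assume "\<not> ?thesis"
  hence gt: "Re (h s) > -1" by simp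
  have "continuous (at s) h"
    using hol s(1) holomorphic_on_imp_continuous_on continuous_on_eq_continuous_at open_ball by blast
  hence "((\<lambda>w. Re (h w)) \<longlongrightarrow> Re (h s)) (at s)" by (intro tendsto_Re) (simp add: isCont_def)
  hence "eventually (\<lambda>w. Re (h w) > -1) (at s)" using gt by (rule order_tendstoD)
  moreover have "eventually (\<lambda>w. w \<in> ball s0 \<delta>) (at s)" using s(1) by (intro eventually_at_in_open') auto
  moreover have "eventually (\<lambda>w. w \<notin> Z) (at s)"
    using islimpt_finite[OF finZ, of s] by (simp add: islimpt_iff_eventually)
  ultimately have ev: "eventually (\<lambda>w. Re (h w) > -1 \<and> w \<in> ball s0 \<delta> \<and> w \<notin> Z) (at s)"
    by eventually_elim auto
  then obtain e where e: "e > 0" "\<And>w. w \<noteq> s \<Longrightarrow> dist w s < e \<Longrightarrow> Re (h w) > -1 \<and> w \<in> ball s0 \<delta> \<and> w \<notin> Z"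
    by (auto simp: eventually_at)
  define w where "w = s + Complex 0 (e/2)"
  have "w \<noteq> s" "dist w s < e" using e(1) by (auto simp: w_def complex_eq_iff dist_norm complex_norm)
  note w = e(2)[OF this]
  have Rw: "Re w = 1/2" using s by (simp add: w_def)
  have fw: "f w \<noteq> 0" using w Zf by auto
  have "pairsum w \<rho> = 0" if "\<rho> \<in> Z" for \<rho>
    unfolding pairsum_def using reflect_neq[of w \<rho>] w that by (subst Re_reflected_pair) (auto simp: Rw)
  hence "Re (\<Sum>\<rho>\<in>Z. of_nat (m \<rho>) / (w - \<rho>)) = 0" unfolding Re_poles_eq by simp
  hence "Re (deriv f w / f w) = Re (h w)" using expansion[of w] w fw by simp
  thus False using line[of w] w Rw fw by simp
qed

lemma D_nonneg: "D \<ge> 0"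
  using D[of s0] \<delta> by (meson centre_in_ball norm_ge_zero order_trans)

text \<open>Compare h at s with h at the horizontal projection \<open>s'\<close> of s to the line:
  the change is at most D times the distance, hence of the same shape as the pair terms.\<close>

lemma Re_logderiv_le:
  assumes s: "s \<in> ball s0 \<delta>" "Re s \<le> 1/2" "f s \<noteq> 0"
  shows "Re (deriv f s / f s) \<le> -1 + D * (1/2 - Re s) + (\<Sum>\<rho>\<in>Z. real (m \<rho>) * pairsum s \<rho>) / 2"
proof -
  define s' where "s' = Complex (1/2) (Im s)"
  have s'b: "s' \<in> ball s0 \<delta>"
  proof -
    have "s' - s0 = \<i> * of_real (Im s - Im s0)" using Re0 by (simp add: s'_def complex_eq_iff)
    hence "norm (s' - s0) = \<bar>Im (s - s0)\<bar>" by (simp only: norm_mult norm_ii norm_of_real) simp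
    also have "\<dots> \<le> norm (s - s0)" by (rule abs_Im_le_cmod)
    finally show ?thesis using s(1) by (simp add: dist_norm norm_minus_commute)
  qed
  have "norm (h s - h s') \<le> D * norm (s - s')"
  proof (rule field_differentiable_bound[of "ball s0 \<delta>" h "deriv h"])
    show "(h has_field_derivative deriv h z) (at z within ball s0 \<delta>)" if "z \<in> ball s0 \<delta>" for z
      using holomorphic_derivI[OF hol open_ball that] .
  qed (use D s s'b in auto)
  also have "norm (s - s') = 1/2 - Re s"
  proof -
    have "s - s' = of_real (Re s - 1/2)" by (simp add: s'_def complex_eq_iff)
    hence "norm (s - s') = \<bar>Re s - 1/2\<bar>" by (simp only: norm_of_real)
    thus ?thesis using s by simp
  qed
  finally have "Re (h s - h s') \<le> D * (1/2 - Re s)" using complex_Re_le_cmod order_trans by blast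
  moreover have "Re (h s') \<le> -1" using s'b by (intro Re_regular_part_critical_line) (auto simp: s'_def)
  ultimately have "Re (h s) \<le> -1 + D * (1/2 - Re s)" by simp
  thus ?thesis using expansion[OF s(1,3)] by (simp only: plus_complex.simps Re_poles_eq)
qed

lemma dist_reflect: "norm (1 - cnj \<rho> - s0) = norm (\<rho> - s0)"
proof -
  have "1 - cnj \<rho> - s0 = - cnj (\<rho> - s0)" using Re0 by (simp add: complex_eq_iff)
  thus ?thesis by (simp only: norm_minus_cancel complex_mod_cnj)
qed

text \<open>Both poles lie between 3r/4 and 5r/4 from s, so the denominator is at most (5/4)^4 r^4
  <= 3 r^4.\<close>

lemma pairsum_inner:
  assumes "\<rho> \<in> Z" "norm (\<rho> - s0) \<le> r / 4" "norm (s - s0) = r" "r > 0" "Re s \<le> 1/2"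
  shows "pairsum s \<rho> \<le> - (1/2 - Re s) / (3 * r\<^sup>2)"
proof -
  define X where "X = 1/2 - Re s"
  have X: "X \<ge> 0" using assms by (simp add: X_def)
  define P where "P = norm (s - \<rho>)"
  define Q where "Q = norm (s - (1 - cnj \<rho>))"
  have tri: "norm (s - w) \<ge> 3/4 * r \<and> norm (s - w) \<le> 5/4 * r" if "norm (w - s0) \<le> r / 4" for w
    using assms(3) that norm_triangle_ineq2[of "s - s0" "w - s0"] norm_triangle_ineq4[of "s - s0" "w - s0"] by auto
  have P: "P \<ge> 3/4 * r" "P \<le> 5/4 * r" using tri[of \<rho>] assms(2) by (auto simp: P_def)
  have Q: "Q \<ge> 3/4 * r" "Q \<le> 5/4 * r" using tri[of "1 - cnj \<rho>"] assms(2) unfolding dist_reflect Q_def by auto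
  have ne: "s \<noteq> \<rho>" "s \<noteq> 1 - cnj \<rho>" using P Q assms(4) by (auto simp: P_def Q_def)
  \<comment> \<open>The point 1/2 + i Im \<rho> is no farther from s0 than \<rho>, hence at least
    3r/4 from s; and (3/4)^2 - (1/4)^2 = 1/2.\<close>
  have num: "X\<^sup>2 + (Im s - Im \<rho>)\<^sup>2 - (Re \<rho> - 1/2)\<^sup>2 \<ge> r\<^sup>2 / 2"
  proof -
    define w where "w = s - Complex (1/2) (Im \<rho>)"
    have "norm (Complex (1/2) (Im \<rho>) - s0) = \<bar>Im (\<rho> - s0)\<bar>"
    proof -
      have "Complex (1/2) (Im \<rho>) - s0 = \<i> * of_real (Im \<rho> - Im s0)" using Re0 by (simp add: complex_eq_iff)
      thus ?thesis by (simp only: norm_mult norm_ii norm_of_real) simp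
    qed
    also have "\<dots> \<le> r / 4" using abs_Im_le_cmod[of "\<rho> - s0"] assms(2) by simp
    finally have "norm w \<ge> 3/4 * r"
      using assms(3) norm_triangle_ineq2[of "s - s0" "Complex (1/2) (Im \<rho>) - s0"] by (simp add: w_def)
    hence "(norm w)\<^sup>2 \<ge> (3/4 * r)\<^sup>2" using assms(4) by (intro power_mono) auto
    moreover have "(norm w)\<^sup>2 = X\<^sup>2 + (Im s - Im \<rho>)\<^sup>2" by (simp add: cmod_power2 w_def X_def power2_commute)
    moreover have "(Re \<rho> - 1/2)\<^sup>2 \<le> (r / 4)\<^sup>2"
    proof -
      have "\<bar>Re \<rho> - 1/2\<bar> \<le> r / 4" using abs_Re_le_cmod[of "\<rho> - s0"] assms(2) Re0 by simp
      thus ?thesis using assms(4) by (simp add: abs_le_square_iff[symmetric])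
    qed
    ultimately show ?thesis by (simp add: power_mult_distrib power_divide)
  qed
  have den: "P\<^sup>2 * Q\<^sup>2 \<le> 3 * r ^ 4"
  proof -
    have "P\<^sup>2 * Q\<^sup>2 \<le> (5/4 * r)\<^sup>2 * (5/4 * r)\<^sup>2" using P Q assms(4) by (intro mult_mono power_mono) (auto simp: P_def Q_def)
    also have "\<dots> = 625/256 * r ^ 4" by (simp add: power2_eq_square power4_eq_xxxx)
    also have "\<dots> \<le> 3 * r ^ 4" by (intro mult_right_mono) auto
    finally show ?thesis .
  qed
  have den0: "P\<^sup>2 * Q\<^sup>2 > 0" using ne by (simp add: P_def Q_def)
  have "pairsum s \<rho> = - (2 * X * (X\<^sup>2 + (Im s - Im \<rho>)\<^sup>2 - (Re \<rho> - 1/2)\<^sup>2) / (P\<^sup>2 * Q\<^sup>2))"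
  proof -
    have "2 * X * ((Re \<rho> - 1/2)\<^sup>2 - X\<^sup>2 - (Im s - Im \<rho>)\<^sup>2) = - (2 * X * (X\<^sup>2 + (Im s - Im \<rho>)\<^sup>2 - (Re \<rho> - 1/2)\<^sup>2))"
      by (simp add: algebra_simps)
    thus ?thesis unfolding pairsum_def Re_reflected_pair[OF ne] P_def Q_def minus_divide_left X_def by (simp only:)
  qed
  moreover have "2 * X * (X\<^sup>2 + (Im s - Im \<rho>)\<^sup>2 - (Re \<rho> - 1/2)\<^sup>2) / (P\<^sup>2 * Q\<^sup>2) \<ge> 2 * X * (r\<^sup>2 / 2) / (3 * r ^ 4)"
  proof -
    have "0 \<le> X\<^sup>2 + (Im s - Im \<rho>)\<^sup>2 - (Re \<rho> - 1/2)\<^sup>2" by (rule order_trans[OF _ num]) simp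
    thus ?thesis using X by (intro frac_le mult_left_mono mult_nonneg_nonneg num den den0) auto
  qed
  moreover have "2 * X * (r\<^sup>2 / 2) / (3 * r ^ 4) = X / (3 * r\<^sup>2)"
    using assms(4) by (simp add: power2_eq_square power4_eq_xxxx)
  ultimately show ?thesis unfolding X_def [symmetric] minus_divide_left [symmetric] by linarith
qed

text \<open>The numerator is bounded by the product of the two distances, so one power of each
  cancels; the bound stays proportional to the distance from the line.\<close>

lemma pairsum_le:
  assumes s: "Re s \<le> 1/2" and e: "0 < \<eta>" "norm (s - \<rho>) \<ge> \<eta>" "norm (s - (1 - cnj \<rho>)) \<ge> \<eta>"
  shows "pairsum s \<rho> \<le> 2 * (1/2 - Re s) / \<eta>\<^sup>2"
proof -
  define X where "X = 1/2 - Re s"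
  have X: "X \<ge> 0" using s by (simp add: X_def)
  define d Y where "d = Re \<rho> - 1/2" "Y = Im s - Im \<rho>"
  define P where "P = norm (s - \<rho>)"
  define Q where "Q = norm (s - (1 - cnj \<rho>))"
  have PQ: "P \<ge> \<eta>" "Q \<ge> \<eta>" using e by (auto simp: P_def Q_def)
  have ne: "s \<noteq> \<rho>" "s \<noteq> 1 - cnj \<rho>" using PQ e by (auto simp: P_def Q_def)
  have le: "d\<^sup>2 - X\<^sup>2 - Y\<^sup>2 \<le> P * Q"
  proof -
    \<comment> \<open>d^2 - X^2 - Y^2 and 2dY are the real and imaginary parts of ((X + d) + iY) ((d
      - X) + iY), whose factors have moduli P and Q.\<close>
    have "(P * Q)\<^sup>2 = (d\<^sup>2 - X\<^sup>2 - Y\<^sup>2)\<^sup>2 + (2 * d * Y)\<^sup>2"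
      unfolding power_mult_distrib P_def Q_def cmod_power2 X_def d_Y_def
      by (simp add: power2_eq_square algebra_simps)
    hence "(d\<^sup>2 - X\<^sup>2 - Y\<^sup>2)\<^sup>2 \<le> (P * Q)\<^sup>2" by simp
    moreover have "P * Q \<ge> 0" by (simp add: P_def Q_def)
    ultimately show ?thesis using abs_le_square_iff[of "d\<^sup>2 - X\<^sup>2 - Y\<^sup>2" "P * Q"] by linarith
  qed
  have PQ0: "P * Q > 0" "P > 0" "Q > 0" using PQ e by auto
  have "pairsum s \<rho> = 2 * X * (d\<^sup>2 - X\<^sup>2 - Y\<^sup>2) / (P * Q)\<^sup>2"
    unfolding pairsum_def Re_reflected_pair[OF ne] P_def Q_def X_def d_Y_def by (simp add: power_mult_distrib)
  also have "\<dots> \<le> 2 * X * (P * Q) / (P * Q)\<^sup>2"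
    using X le by (intro divide_right_mono mult_left_mono) auto
  also have "\<dots> = 2 * X / (P * Q)" using PQ0 by (simp add: power2_eq_square)
  also have "\<dots> \<le> 2 * X / \<eta>\<^sup>2"
    unfolding power2_eq_square using PQ e X by (intro divide_left_mono mult_mono mult_pos_pos) auto
  finally show ?thesis by (simp add: X_def)
qed

text \<open>The numbers in \<open>alt\<close> balance the budget with x = 1/2 - Re s. With an inner
  zero, its pair gives - x / (6 r^2), while h and the other pairs cost at most x / (12 r^2) each.
  Without one, the gain -1 pays for costs of 1/4 and 1/4.\<close>

lemma Re_logderiv_arc_neg:
  assumes r: "0 < r" "r < \<delta>" and L: "L \<ge> 2"
    and gap: "\<And>\<rho>. \<rho> \<in> Z \<Longrightarrow> norm (\<rho> - s0) \<le> r / 4 \<or> norm (\<rho> - s0) \<ge> L * r"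
    and alt: "(\<exists>\<rho>\<in>Z. norm (\<rho> - s0) \<le> r / 4) \<and> 12 * r\<^sup>2 * D \<le> 1 \<and> 48 * N \<le> L\<^sup>2 \<or> 4 * r * D \<le> 1 \<and> 16 * N \<le> L\<^sup>2 * r"
    and s: "norm (s - s0) = r" "Re s \<le> 1/2"
  shows "f s \<noteq> 0 \<and> Re (deriv f s / f s) < 0"
proof
  have sb: "s \<in> ball s0 \<delta>" using s r by (simp add: dist_norm norm_minus_commute)
  show fs: "f s \<noteq> 0"
  proof
    assume "f s = 0"
    hence "s \<in> Z" using Zf sb by auto
    from gap[OF this] have "r \<le> r / 4 \<or> L * r \<le> r" using s by simp
    moreover have "2 * r \<le> L * r" using L r by (intro mult_right_mono) auto
    ultimately show False using r by auto
  qed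
  define X where "X = 1/2 - Re s"
  have X: "X \<ge> 0" "X \<le> r"
    using s abs_Re_le_cmod[of "s - s0"] Re0 by (auto simp: X_def)
  have N: "N \<ge> 0" using mN by linarith
  have outer: "pairsum s \<rho> \<le> 8 * X / (L * r)\<^sup>2" if "\<rho> \<in> Z" "norm (\<rho> - s0) \<ge> L * r" for \<rho>
  proof -
    have "2 * r \<le> L * r" using L r by (intro mult_right_mono) auto
    hence tri: "norm (s - w) \<ge> L * r / 2" if "norm (w - s0) \<ge> L * r" for w
      using that s norm_triangle_ineq2[of "w - s0" "s - s0"] by (auto simp: norm_minus_commute)
    have "norm (s - \<rho>) \<ge> L * r / 2" "norm (s - (1 - cnj \<rho>)) \<ge> L * r / 2"
      using tri[of \<rho>] tri[of "1 - cnj \<rho>"] that(2) unfolding dist_reflect by auto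
    hence "pairsum s \<rho> \<le> 2 * (1/2 - Re s) / (L * r / 2)\<^sup>2"
      using s L r by (intro pairsum_le) auto
    thus ?thesis by (simp add: X_def power_divide)
  qed
  define b where "b = 8 * X / (L * r)\<^sup>2"
  have b: "b \<ge> 0" using X by (simp add: b_def)
  have inner: "pairsum s \<rho> \<le> - X / (3 * r\<^sup>2)" if "\<rho> \<in> Z" "norm (\<rho> - s0) \<le> r / 4" for \<rho>
    using pairsum_inner[OF that s(1) r(1) s(2)] by (simp add: X_def)
  have in0: "- X / (3 * r\<^sup>2) \<le> 0" using X by simp
  have all: "pairsum s \<rho> \<le> b" if "\<rho> \<in> Z" for \<rho>
    using gap[OF that] inner[OF that] outer[OF that] b in0 by (auto simp: b_def)
  have sumb: "(\<Sum>\<rho>\<in>Z. real (m \<rho>) * b) \<le> N * b"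
    using mN b by (simp add: mult_right_mono flip: sum_distrib_right)
  have main: "Re (deriv f s / f s) \<le> -1 + D * X + (\<Sum>\<rho>\<in>Z. real (m \<rho>) * pairsum s \<rho>) / 2"
    using Re_logderiv_le[OF sb s(2) fs] by (simp add: X_def)
  from alt show "Re (deriv f s / f s) < 0"
  proof (elim disjE conjE bexE)
    fix \<rho>0 assume \<rho>0: "\<rho>0 \<in> Z" "norm (\<rho>0 - s0) \<le> r / 4" and c: "12 * r\<^sup>2 * D \<le> 1" "48 * N \<le> L\<^sup>2"
    \<comment> \<open>Only the zero \<rho>0 enters with its negative bound; every other pair, inner
      or outer, is estimated by b >= 0.\<close>
    have "(\<Sum>\<rho>\<in>Z. real (m \<rho>) * pairsum s \<rho>) = real (m \<rho>0) * pairsum s \<rho>0 + (\<Sum>\<rho>\<in>Z - {\<rho>0}. real (m \<rho>) * pairsum s \<rho>)"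
      using finZ \<rho>0(1) by (rule sum.remove)
    also have "real (m \<rho>0) * pairsum s \<rho>0 \<le> - X / (3 * r\<^sup>2)"
    proof -
      have "real (m \<rho>0) * pairsum s \<rho>0 \<le> real (m \<rho>0) * (- X / (3 * r\<^sup>2))" using inner[OF \<rho>0] by (intro mult_left_mono) auto
      also have "\<dots> \<le> 1 * (- X / (3 * r\<^sup>2))" using m1[OF \<rho>0(1)] in0 by (intro mult_right_mono_neg) auto
      finally show ?thesis by simp
    qed
    also have "(\<Sum>\<rho>\<in>Z - {\<rho>0}. real (m \<rho>) * pairsum s \<rho>) \<le> (\<Sum>\<rho>\<in>Z - {\<rho>0}. real (m \<rho>) * b)"
      by (intro sum_mono mult_left_mono all) auto
    also have "\<dots> \<le> (\<Sum>\<rho>\<in>Z. real (m \<rho>) * b)" using finZ b by (intro sum_mono2) auto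
    also note sumb
    finally have "(\<Sum>\<rho>\<in>Z. real (m \<rho>) * pairsum s \<rho>) \<le> - X / (3 * r\<^sup>2) + N * b" by simp
    hence "(\<Sum>\<rho>\<in>Z. real (m \<rho>) * pairsum s \<rho>) / 2 \<le> (- X / (3 * r\<^sup>2) + N * b) / 2" by (rule divide_right_mono) simp
    hence "Re (deriv f s / f s) \<le> -1 + D * X + (- X / (3 * r\<^sup>2) + N * b) / 2" by (intro order_trans[OF main] add_left_mono)
    also have "N * b \<le> X / (6 * r\<^sup>2)"
    proof -
      have "N * b = 8 * X * N / (L\<^sup>2 * r\<^sup>2)" by (simp add: b_def power_mult_distrib)
      also have "\<dots> \<le> X * L\<^sup>2 / 6 / (L\<^sup>2 * r\<^sup>2)"
        using c(2) X(1) mult_left_mono[of "48 * N" "L\<^sup>2" X] by (intro divide_right_mono) auto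
      also have "\<dots> = X / (6 * r\<^sup>2)" using L by simp
      finally show ?thesis .
    qed
    also have "D * X \<le> X / (12 * r\<^sup>2)"
    proof -
      have "D * (12 * r\<^sup>2) \<le> 1" using c(1) by (simp add: mult_ac)
      hence "D \<le> 1 / (12 * r\<^sup>2)" using r by (subst pos_le_divide_eq) auto
      thus ?thesis using mult_right_mono[of D "1 / (12 * r\<^sup>2)" X] X(1) by simp
    qed
    finally show ?thesis by (simp add: field_simps)
  next
    assume c: "4 * r * D \<le> 1" "16 * N \<le> L\<^sup>2 * r"
    have "(\<Sum>\<rho>\<in>Z. real (m \<rho>) * pairsum s \<rho>) \<le> (\<Sum>\<rho>\<in>Z. real (m \<rho>) * b)"
      by (intro sum_mono mult_left_mono all) auto
    also note sumb
    also have "N * b \<le> 1/2"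
    proof -
      have "N * b = 8 * X * N / (L\<^sup>2 * r\<^sup>2)" by (simp add: b_def power_mult_distrib)
      also have "\<dots> \<le> 8 * r * N / (L\<^sup>2 * r\<^sup>2)" using X N by (intro divide_right_mono mult_right_mono) auto
      also have "\<dots> \<le> (r * (L\<^sup>2 * r) / 2) / (L\<^sup>2 * r\<^sup>2)"
        using c(2) r mult_left_mono[of "16 * N" "L\<^sup>2 * r" r] by (intro divide_right_mono) auto
      also have "\<dots> = 1/2" using L r by (simp add: power2_eq_square)
      finally show ?thesis .
    qed
    finally have "Re (deriv f s / f s) \<le> -1 + D * X + 1/4" using main by simp
    also have "D * X \<le> 1/4"
      using mult_left_mono[OF X(2) D_nonneg] c(1) by (simp add: mult_ac)
    finally show ?thesis by simp
  qed
qed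

text \<open>Left of the line, zeros on it contribute nonpositively. Zeros off it keep a fixed
  horizontal distance from the chord for small \<epsilon>, so they contribute a multiple of
  \<epsilon>, and the total is -1 plus a multiple of \<epsilon>.\<close>

lemma Re_logderiv_chord_neg:
  assumes r: "0 < r" "r < \<delta>"
  shows "eventually (\<lambda>\<epsilon>. \<forall>s. norm (s - s0) \<le> r \<longrightarrow> Re s = 1/2 - \<epsilon> \<longrightarrow> f s \<noteq> 0 \<and> Re (deriv f s / f s) < 0) (at_right 0)"
proof -
  \<comment> \<open>For Re \<rho> = 1/2 division by zero makes \<open>K \<rho>\<close> equal to 0,
    consistent with the nonpositive contribution of such zeros.\<close>
  define K where "K = (\<lambda>\<rho>. real (m \<rho>) * (2 / ((Re \<rho> - 1/2) / 2)\<^sup>2))"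
  define W where "W = D + (\<Sum>\<rho>\<in>Z. K \<rho>) + 1"
  have K0: "K \<rho> \<ge> 0" for \<rho> by (simp add: K_def)
  have W: "W > 0" using D_nonneg K0 by (simp add: W_def add_nonneg_pos sum_nonneg)
  have "eventually (\<lambda>\<epsilon>. \<forall>\<rho>\<in>Z. Re \<rho> \<noteq> 1/2 \<longrightarrow> \<epsilon> < \<bar>Re \<rho> - 1/2\<bar> / 2) (at_right (0::real))"
  proof (rule eventually_ball_finite[OF finZ], rule ballI)
    fix \<rho> assume "\<rho> \<in> Z"
    show "eventually (\<lambda>\<epsilon>. Re \<rho> \<noteq> 1/2 \<longrightarrow> \<epsilon> < \<bar>Re \<rho> - 1/2\<bar> / 2) (at_right (0::real))"
      by (cases "Re \<rho> = 1/2") (auto simp: eventually_at_right_field intro!: exI[of _ "\<bar>Re \<rho> - 1/2\<bar> / 2"])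
  qed
  moreover have "eventually (\<lambda>\<epsilon>. \<epsilon> < 1 / W) (at_right (0::real))"
    using W by (auto simp: eventually_at_right_field intro!: exI[of _ "1 / W"])
  moreover have "eventually (\<lambda>\<epsilon>. \<epsilon> > 0) (at_right (0::real))" by (rule eventually_at_right_less)
  ultimately show ?thesis
  proof eventually_elim
    case (elim \<epsilon>)
    show ?case
    proof (intro allI impI)
      fix s assume s: "norm (s - s0) \<le> r" "Re s = 1/2 - \<epsilon>"
      have sb: "s \<in> ball s0 \<delta>" using s r by (simp add: dist_norm norm_minus_commute)
      have far: "norm (s - \<rho>) \<ge> \<bar>Re \<rho> - 1/2\<bar> / 2 \<and> norm (s - (1 - cnj \<rho>)) \<ge> \<bar>Re \<rho> - 1/2\<bar> / 2" if "\<rho> \<in> Z" "Re \<rho> \<noteq> 1/2" for \<rho>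
        using elim that s abs_Re_le_cmod[of "s - \<rho>"] abs_Re_le_cmod[of "s - (1 - cnj \<rho>)"] by auto
      have sZ: "s \<notin> Z"
      proof
        assume "s \<in> Z"
        thus False using far[of s] s elim by auto
      qed
      hence fs: "f s \<noteq> 0" using Zf sb by auto
      have le: "real (m \<rho>) * pairsum s \<rho> \<le> \<epsilon> * K \<rho>" if "\<rho> \<in> Z" for \<rho>
      proof (cases "Re \<rho> = 1/2")
        case False
        hence "pairsum s \<rho> \<le> 2 * (1/2 - Re s) / (\<bar>Re \<rho> - 1/2\<bar> / 2)\<^sup>2"
          using far[OF that False] elim s by (intro pairsum_le) auto
        also have "\<dots> = \<epsilon> * (2 / ((Re \<rho> - 1/2) / 2)\<^sup>2)" using s by (simp add: power_divide)
        finally have "real (m \<rho>) * pairsum s \<rho> \<le> real (m \<rho>) * (\<epsilon> * (2 / ((Re \<rho> - 1/2) / 2)\<^sup>2))"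
          by (intro mult_left_mono) auto
        thus ?thesis by (simp add: K_def mult_ac)
      next
        case True
        have ne: "s \<noteq> \<rho>" "s \<noteq> 1 - cnj \<rho>" using reflect_neq[OF sZ that] by auto
        have "pairsum s \<rho> \<le> 0"
          unfolding pairsum_def Re_reflected_pair[OF ne] True using s elim
          by (intro divide_nonpos_nonneg mult_nonneg_nonpos) auto
        hence "real (m \<rho>) * pairsum s \<rho> \<le> 0" by (intro mult_nonneg_nonpos) auto
        also have "0 \<le> \<epsilon> * K \<rho>" using elim K0 by simp
        finally show ?thesis .
      qed
      have "Re (deriv f s / f s) \<le> -1 + D * \<epsilon> + (\<Sum>\<rho>\<in>Z. real (m \<rho>) * pairsum s \<rho>) / 2"
        using Re_logderiv_le[OF sb _ fs] s elim by simp
      also have "(\<Sum>\<rho>\<in>Z. real (m \<rho>) * pairsum s \<rho>) \<le> (\<Sum>\<rho>\<in>Z. \<epsilon> * K \<rho>)" by (intro sum_mono le)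
      also have "\<dots> = \<epsilon> * (\<Sum>\<rho>\<in>Z. K \<rho>)" by (simp add: sum_distrib_left)
      finally have "Re (deriv f s / f s) \<le> -1 + D * \<epsilon> + \<epsilon> * (\<Sum>\<rho>\<in>Z. K \<rho>) / 2" by simp
      also have "\<dots> \<le> -1 + D * \<epsilon> + \<epsilon> * (\<Sum>\<rho>\<in>Z. K \<rho>)" using elim K0 by (simp add: sum_nonneg)
      also have "\<dots> < -1 + \<epsilon> * W" using elim by (simp add: W_def algebra_simps)
      also have "\<dots> < 0" using elim W by (simp add: field_simps)
      finally show "f s \<noteq> 0 \<and> Re (deriv f s / f s) < 0" using fs by simp
    qed
  qed
qed

end

subsection \<open>Counting zeros in a circular segment\<close>

text \<open>Rouche's theorem compares f' with - c f for a large constant c: a compact set of values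
  w in the left half plane lies in the disc |w + c| < c once c is large.\<close>

lemma num_zeros_deriv_eq_of_Re_logderiv_neg:
  fixes f :: "complex \<Rightarrow> complex"
  assumes f: "f holomorphic_on ball s0 R" and r: "0 < r" "r < R" and e: "0 < \<epsilon>" "\<epsilon> < r"
    and fin: "finite {z \<in> ball s0 R. f z = 0}" "finite {z \<in> ball s0 R. deriv f z = 0}"
    and arc: "\<And>s. norm (s - s0) = r \<Longrightarrow> Re s \<le> Re s0 - \<epsilon> \<Longrightarrow> f s \<noteq> 0 \<and> Re (deriv f s / f s) < 0"
    and chord: "\<And>s. norm (s - s0) \<le> r \<Longrightarrow> Re s = Re s0 - \<epsilon> \<Longrightarrow> f s \<noteq> 0 \<and> Re (deriv f s / f s) < 0"
  defines "D \<equiv> {s. norm (s - s0) < r \<and> Re s < Re s0 - \<epsilon>}"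
  shows "num_zeros f D = num_zeros (deriv f) D"
proof -
  \<comment> \<open>The arc runs counterclockwise from angle \<theta> to 2 pi - \<theta>, where r
    cos \<theta> = - \<epsilon>, and the chord closes it upwards.\<close>
  define \<theta> where "\<theta> = arccos (- (\<epsilon> / r))"
  have er: "0 < \<epsilon> / r" "\<epsilon> / r < 1" using e r by auto
  have c\<theta>: "r * cos \<theta> = - \<epsilon>" using er r unfolding \<theta>_def by (subst cos_arccos) auto
  have \<theta>: "0 < \<theta>" "\<theta> < pi" using er arccos_lt_bounded[of "- (\<epsilon> / r)"] by (simp_all add: \<theta>_def)
  have \<theta>0: "sin \<theta> > 0" using \<theta> by (intro sin_gt_zero) auto
  define y where "y = r * sin \<theta>"
  have y: "y > 0" using \<theta>0 r by (simp add: y_def)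
  define a where "a = s0 + Complex (- \<epsilon>) y"
  define b where "b = s0 + Complex (- \<epsilon>) (- y)"
  define g1 where "g1 = part_circlepath s0 r \<theta> (2 * pi - \<theta>)"
  define \<gamma> where "\<gamma> = g1 +++ linepath b a"
  have rcis: "s0 + of_real r * exp (\<i> * of_real t) = s0 + Complex (r * cos t) (r * sin t)" for t
    by (simp add: complex_eq_iff Re_exp Im_exp)
  have g1s: "pathstart g1 = a" and g1f: "pathfinish g1 = b"
  proof -
    show "pathstart g1 = a" unfolding g1_def pathstart_part_circlepath a_def
      by (simp add: rcis c\<theta> y_def)
    have "cos (2 * pi - \<theta>) = cos \<theta>" "sin (2 * pi - \<theta>) = - sin \<theta>" by (simp_all add: cos_diff sin_diff)
    thus "pathfinish g1 = b" unfolding g1_def pathfinish_part_circlepath b_def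
      by (simp only: rcis) (simp add: c\<theta> y_def)
  qed
  have pg1: "norm (s - s0) = r \<and> Re s \<le> Re s0 - \<epsilon>" if sg: "s \<in> path_image g1" for s
  proof -
    have "\<theta> \<le> 2 * pi - \<theta>" using \<theta> by simp
    then obtain t where t: "s = s0 + of_real r * exp (\<i> * of_real t)" "\<theta> \<le> t" "t \<le> 2 * pi - \<theta>"
      using sg unfolding g1_def by (auto simp: path_image_part_circlepath)
    have "cos t \<le> cos \<theta>"
    proof (cases "t \<le> pi")
      case True
      thus ?thesis using t \<theta> by (intro cos_monotone_0_pi_le) auto
    next
      case False
      have "cos t = cos (2 * pi - t)" by (simp add: cos_diff)
      also have "\<dots> \<le> cos \<theta>" using t \<theta> False by (intro cos_monotone_0_pi_le) auto
      finally show ?thesis .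
    qed
    hence "r * cos t \<le> - \<epsilon>" using r mult_left_mono[of "cos t" "cos \<theta>" r] c\<theta> by simp
    hence "Re s \<le> Re s0 - \<epsilon>" unfolding t(1) rcis by simp
    thus ?thesis using r by (simp add: t(1) norm_mult)
  qed
  have pl: "norm (s - s0) \<le> r \<and> Re s = Re s0 - \<epsilon>" if sg: "s \<in> closed_segment b a" for s
  proof -
    have nab: "norm (a - s0) = r" "norm (b - s0) = r"
      using pg1[of a] pg1[of b] g1s g1f pathstart_in_path_image[of g1] pathfinish_in_path_image[of g1] by auto
    have "closed_segment b a \<subseteq> cball s0 r"
      using nab by (intro closed_segment_subset convex_cball) (auto simp: dist_norm norm_minus_commute)
    moreover have "Re s = Re s0 - \<epsilon>"
    proof -
      obtain u where "s = (1 - u) *\<^sub>R b + u *\<^sub>R a" using sg by (auto simp: closed_segment_def)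
      hence "Re s = (1 - u) * Re b + u * Re a" by simp
      thus ?thesis by (simp add: a_def b_def algebra_simps)
    qed
    ultimately show ?thesis using sg by (auto simp: dist_norm norm_minus_commute)
  qed
  have pi: "path_image \<gamma> = path_image g1 \<union> closed_segment b a"
    unfolding \<gamma>_def by (subst path_image_join) (simp_all add: g1f)
  have vp: "valid_path \<gamma>" unfolding \<gamma>_def g1_def
    by (intro valid_path_join) (use g1f in \<open>auto simp: g1_def\<close>)
  have path: "path \<gamma>" using vp by (rule valid_path_imp_path)
  have loop: "pathfinish \<gamma> = pathstart \<gamma>" by (simp add: \<gamma>_def g1s)
  have pimg: "f s \<noteq> 0 \<and> Re (deriv f s / f s) < 0 \<and> norm (s - s0) \<le> r \<and> Re s \<le> Re s0 - \<epsilon> \<and> s \<notin> D" if "s \<in> path_image \<gamma>" for s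
    using that pg1[of s] pl[of s] arc[of s] chord[of s] unfolding pi D_def by auto
  have pS: "path_image \<gamma> \<subseteq> ball s0 R" using pimg r by (fastforce simp: dist_norm norm_minus_commute)
  have cvx: "convex (cball s0 r \<inter> {s. Re s \<le> Re s0 - \<epsilon>})"
    by (intro convex_Int convex_cball convex_halfspace_Re_le)
  \<comment> \<open>The closed segment is convex and contains the path, so the winding number
    vanishes outside it; its points outside \<open>D\<close> lie on the path.\<close>
  have wn0: "winding_number \<gamma> z = 0" if "z \<notin> path_image \<gamma>" "z \<notin> D" for z
  proof (cases "norm (z - s0) \<le> r \<and> Re z \<le> Re s0 - \<epsilon>")
    case False
    thus ?thesis using pimg
      by (intro winding_number_zero_outside[OF path cvx loop]) (auto simp: dist_norm norm_minus_commute)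
  next
    case True
    hence "norm (z - s0) = r \<or> Re z = Re s0 - \<epsilon>" using that(2) by (auto simp: D_def)
    hence "z \<in> path_image \<gamma>"
    proof
      assume z: "Re z = Re s0 - \<epsilon>"
      have "(Im z - Im s0)\<^sup>2 \<le> y\<^sup>2"
      proof -
        have "(norm (z - s0))\<^sup>2 \<le> r\<^sup>2" using True by (intro power_mono) auto
        hence "\<epsilon>\<^sup>2 + (Im z - Im s0)\<^sup>2 \<le> r\<^sup>2" using z by (simp add: cmod_power2)
        moreover have "y\<^sup>2 + \<epsilon>\<^sup>2 = r\<^sup>2 * ((sin \<theta>)\<^sup>2 + (cos \<theta>)\<^sup>2)"
        proof -
          have "\<epsilon>\<^sup>2 = (r * cos \<theta>)\<^sup>2" by (simp add: c\<theta>)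
          hence "y\<^sup>2 + \<epsilon>\<^sup>2 = r\<^sup>2 * (sin \<theta>)\<^sup>2 + r\<^sup>2 * (cos \<theta>)\<^sup>2" by (simp only: y_def power_mult_distrib)
          thus ?thesis by (simp only: distrib_left)
        qed
        ultimately show ?thesis by simp
      qed
      hence iy: "\<bar>Im z - Im s0\<bar> \<le> y" using y by (simp add: abs_le_square_iff[symmetric])
      define u where "u = (Im z - Im s0 + y) / (2 * y)"
      have "z = (1 - u) *\<^sub>R b + u *\<^sub>R a"
      proof -
        have "u * (2 * y) = Im z - Im s0 + y" using y by (simp add: u_def)
        thus ?thesis using z by (simp add: complex_eq_iff a_def b_def algebra_simps)
      qed
      moreover have "0 \<le> u" "u \<le> 1" using iy y by (auto simp: u_def field_simps abs_le_iff)
      ultimately show "z \<in> path_image \<gamma>" unfolding pi closed_segment_def by blast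
    next
      assume z: "norm (z - s0) = r"
      define w where "w = (z - s0) / of_real r"
      have "norm w = 1" using z r by (simp add: w_def norm_divide)
      then obtain t where t: "0 \<le> t" "t < 2 * pi" "w = exp (\<i> * of_real t)"
        using Arg2pi[of w] by (auto simp: is_Arg_def mult_ac) 
      have zt: "z = s0 + of_real r * exp (\<i> * of_real t)" using t(3) r by (simp add: w_def field_simps)
      have ct: "cos t \<le> cos \<theta>"
      proof -
        have "r * cos t \<le> r * cos \<theta>" using True unfolding zt rcis c\<theta> by simp
        thus ?thesis using r by simp
      qed
      have "\<theta> \<le> t"
      proof (rule ccontr)
        assume "\<not> \<theta> \<le> t"
        hence "cos \<theta> < cos t" using t \<theta> by (intro cos_monotone_0_pi) auto
        thus False using ct by simp
      qed
      moreover have "t \<le> 2 * pi - \<theta>"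
      proof (rule ccontr)
        assume "\<not> t \<le> 2 * pi - \<theta>"
        hence "cos \<theta> < cos (2 * pi - t)" using t \<theta> by (intro cos_monotone_0_pi) auto
        thus False using ct by (simp add: cos_diff)
      qed
      ultimately show "z \<in> path_image \<gamma>" unfolding pi g1_def using zt \<theta>
        by (auto simp: path_image_part_circlepath)
    qed
    thus ?thesis using that by simp
  qed
  \<comment> \<open>Arc and chord both turn counterclockwise around points of \<open>D\<close>, so
    both contributions are positive.\<close>
  have wnpos: "Re (winding_number \<gamma> z) > 0" if "z \<in> D" for z
  proof -
    have "z \<notin> path_image \<gamma>" using pimg that by blast
    hence zn: "z \<notin> path_image g1" "z \<notin> closed_segment b a" by (auto simp: pi)
    have "Re (winding_number g1 z) > 0" unfolding g1_def
      by (rule winding_number_part_circlepath_pos_less) (use \<theta> that in \<open>auto simp: D_def\<close>)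
    moreover have "Re (winding_number (linepath b a) z) > 0"
      by (rule winding_number_linepath_pos_lt) (use that y in \<open>auto simp: D_def a_def b_def mult_pos_pos\<close>)
    moreover have "winding_number \<gamma> z = winding_number g1 z + winding_number (linepath b a) z"
      unfolding \<gamma>_def by (rule winding_number_join) (use zn g1f in \<open>auto simp: g1_def\<close>)
    ultimately show ?thesis by simp
  qed
  have Dconn: "connected D"
  proof -
    have "D = ball s0 r \<inter> {s. Re s < Re s0 - \<epsilon>}" by (auto simp: D_def dist_norm norm_minus_commute)
    thus ?thesis by (auto intro!: convex_connected convex_Int convex_halfspace_Re_lt)
  qed
  \<comment> \<open>A common nonzero winding number cancels from the two sides of Rouche's
    identity.\<close>
  have "winding_number \<gamma> constant_on D"
    by (rule winding_number_constant[OF path loop Dconn]) (use pimg in blast)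
  then obtain \<kappa> where \<kappa>: "\<And>z. z \<in> D \<Longrightarrow> winding_number \<gamma> z = \<kappa>" by (auto simp: constant_on_def)
  show ?thesis
  proof (cases "D = {}")
    case True
    thus ?thesis by (simp add: num_zeros_def zeros_in_def)
  next
    case False
    have \<kappa>0: "\<kappa> \<noteq> 0" using wnpos \<kappa> False by fastforce
    have hd: "deriv f holomorphic_on ball s0 R" by (intro holomorphic_deriv f) auto
    define w where "w = (\<lambda>s. deriv f s / f s)"
    have cw: "continuous_on (path_image \<gamma>) w"
      unfolding w_def by (intro continuous_intros holomorphic_on_imp_continuous_on 
        holomorphic_on_subset[OF f pS] holomorphic_on_subset[OF hd pS]) (use pimg in auto)
    \<comment> \<open>For c > 0, |w + c| < c means |w|^2 < - 2 c Re w, so c is taken as the maximum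
      of this quotient on the path plus 1.\<close>
    have cq: "continuous_on (path_image \<gamma>) (\<lambda>s. (norm (w s))\<^sup>2 / (- 2 * Re (w s)))"
      by (intro continuous_intros cw) (use pimg in \<open>force simp: w_def\<close>)
    obtain p where p: "p \<in> path_image \<gamma>" "\<And>s. s \<in> path_image \<gamma> \<Longrightarrow> (norm (w s))\<^sup>2 / (- 2 * Re (w s)) \<le> (norm (w p))\<^sup>2 / (- 2 * Re (w p))"
      using continuous_attains_sup[OF compact_path_image[OF path] path_image_nonempty cq] by blast
    define c where "c = (norm (w p))\<^sup>2 / (- 2 * Re (w p)) + 1"
    have Rew: "Re (w s) < 0" if "s \<in> path_image \<gamma>" for s using pimg[OF that] by (simp add: w_def)
    have c: "c > 0" unfolding c_def using Rew[OF p(1)] by (intro add_nonneg_pos divide_nonneg_pos) auto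
    have less: "norm (w s + of_real c) < c" if "s \<in> path_image \<gamma>" for s
    proof -
      have "(norm (w s))\<^sup>2 / (- 2 * Re (w s)) < c" using p(2)[OF that] by (simp add: c_def)
      hence "(norm (w s))\<^sup>2 < c * (- 2 * Re (w s))" using Rew[OF that] by (subst (asm) pos_divide_less_eq) auto
      moreover have "(norm (w s + of_real c))\<^sup>2 = (norm (w s))\<^sup>2 + 2 * c * Re (w s) + c\<^sup>2"
        unfolding cmod_power2 by (simp add: power2_eq_square algebra_simps)
      ultimately have "(norm (w s + of_real c))\<^sup>2 < c\<^sup>2" by simp
      thus ?thesis using c by (rule power_less_imp_less_base[OF _ less_imp_le])
    qed
    \<comment> \<open>\<open>F + G\<close> is f', and |G| < |F| is the inequality |w + c| < c
      multiplied by |f|.\<close>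
    define F where "F = (\<lambda>s. of_real (- c) * f s)"
    define G where "G = (\<lambda>s. deriv f s + of_real c * f s)"
    have FG: "F s + G s = deriv f s" for s by (simp add: F_def G_def)
    have F0: "F s = 0 \<longleftrightarrow> f s = 0" for s using c by (simp add: F_def)
    have "(\<Sum>p\<in>{p \<in> ball s0 R. F p + G p = 0}. winding_number \<gamma> p * of_int (zorder (\<lambda>p. F p + G p) p)) =
          (\<Sum>p\<in>{p \<in> ball s0 R. F p = 0}. winding_number \<gamma> p * of_int (zorder F p))"
    proof (rule Rouche_theorem)
      show "\<forall>z\<in>path_image \<gamma>. cmod (G z) < cmod (F z)"
      proof
        fix z assume z: "z \<in> path_image \<gamma>"
        have "G z = (w z + of_real c) * f z" using pimg[OF z] by (simp add: G_def w_def field_simps)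
        hence "norm (G z) = norm (w z + of_real c) * norm (f z)" by (simp add: norm_mult)
        also have "\<dots> < c * norm (f z)" using less[OF z] pimg[OF z] by (intro mult_strict_right_mono) auto
        also have "\<dots> = norm (F z)" using c by (simp add: F_def norm_mult)
        finally show "norm (G z) < norm (F z)" .
      qed
      show "\<forall>z. z \<notin> ball s0 R \<longrightarrow> winding_number \<gamma> z = 0"
        using wn0 pS r by (force simp: D_def dist_norm norm_minus_commute)
      show "F holomorphic_on ball s0 R" "G holomorphic_on ball s0 R"
        unfolding F_def G_def by (intro holomorphic_intros f hd)+
    qed (use fin vp loop pS in \<open>simp_all add: FG F0\<close>)
    moreover have "zorder F p = zorder f p" for p unfolding F_def using zorder_cmult[of "of_real (- c)" f] c by simp
    ultimately have eq: "(\<Sum>p\<in>{p \<in> ball s0 R. deriv f p = 0}. winding_number \<gamma> p * of_int (zorder (deriv f) p)) =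
          (\<Sum>p\<in>{p \<in> ball s0 R. f p = 0}. winding_number \<gamma> p * of_int (zorder f p))"
      unfolding FG F0 by (simp only:)
    have DR: "D \<subseteq> ball s0 R" using r by (auto simp: D_def dist_norm norm_minus_commute)
    have nz: "num_zeros g D = nat (\<Sum>p\<in>zeros_in g D. zorder g p) \<and> (\<Sum>p\<in>zeros_in g D. zorder g p) \<ge> 0 \<and>
       (\<Sum>p\<in>{p \<in> ball s0 R. g p = 0}. winding_number \<gamma> p * of_int (zorder g p)) = \<kappa> * of_int (\<Sum>p\<in>zeros_in g D. zorder g p)"
      if g: "g holomorphic_on ball s0 R" "finite {p \<in> ball s0 R. g p = 0}" "\<And>p. p \<in> path_image \<gamma> \<Longrightarrow> g p \<noteq> 0" for g
    proof -
      have ex: "\<exists>w\<in>ball s0 R. g w \<noteq> 0" using g(3)[of a] pS pathstart_in_path_image[of \<gamma>] g1s by (auto simp: \<gamma>_def)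
      \<comment> \<open>\<open>num_zeros\<close> applies \<open>nat\<close> to each order, which
        changes nothing as orders at zeros of a function that does not vanish identically are
        nonnegative.\<close>
      have pos: "zorder g p \<ge> 0" if "p \<in> zeros_in g D" for p
        using zorder_exist_zero[OF g(1) open_ball connected_ball _ ex, of p] that DR by (auto simp: zeros_in_def split: if_splits)
      have "(\<Sum>p\<in>{p \<in> ball s0 R. g p = 0}. winding_number \<gamma> p * of_int (zorder g p)) = 
            (\<Sum>p\<in>zeros_in g D. winding_number \<gamma> p * of_int (zorder g p))"
      proof (rule sum.mono_neutral_right[OF g(2)])
        show "zeros_in g D \<subseteq> {p \<in> ball s0 R. g p = 0}" using DR by (auto simp: zeros_in_def)
        show "\<forall>i\<in>{p \<in> ball s0 R. g p = 0} - zeros_in g D. winding_number \<gamma> i * of_int (zorder g i) = 0"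
          using wn0 g(3) by (auto simp: zeros_in_def)
      qed
      also have "\<dots> = (\<Sum>p\<in>zeros_in g D. \<kappa> * of_int (zorder g p))"
        by (intro sum.cong) (auto simp: zeros_in_def \<kappa>)
      finally have "(\<Sum>p\<in>{p \<in> ball s0 R. g p = 0}. winding_number \<gamma> p * of_int (zorder g p)) = \<kappa> * of_int (\<Sum>p\<in>zeros_in g D. zorder g p)"
        by (simp add: sum_distrib_left)
      moreover have "num_zeros g D = nat (\<Sum>p\<in>zeros_in g D. zorder g p)"
      proof -
        have "int (num_zeros g D) = (\<Sum>p\<in>zeros_in g D. zorder g p)"
          unfolding num_zeros_def of_nat_sum using pos by (intro sum.cong) auto
        thus ?thesis by linarith
      qed
      ultimately show ?thesis using pos by (auto intro!: sum_nonneg)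
    qed
    have n1: "num_zeros f D = nat (\<Sum>p\<in>zeros_in f D. zorder f p)" "(\<Sum>p\<in>{p \<in> ball s0 R. f p = 0}. winding_number \<gamma> p * of_int (zorder f p)) = \<kappa> * of_int (\<Sum>p\<in>zeros_in f D. zorder f p)"
      using nz[of f] f fin pimg by blast+
    have "deriv f p \<noteq> 0" if "p \<in> path_image \<gamma>" for p using pimg[OF that] by auto
    hence n2: "num_zeros (deriv f) D = nat (\<Sum>p\<in>zeros_in (deriv f) D. zorder (deriv f) p)" "(\<Sum>p\<in>{p \<in> ball s0 R. deriv f p = 0}. winding_number \<gamma> p * of_int (zorder (deriv f) p)) = \<kappa> * of_int (\<Sum>p\<in>zeros_in (deriv f) D. zorder (deriv f) p)"
      using nz[of "deriv f"] hd fin by blast+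
    have "(of_int (\<Sum>p\<in>zeros_in f D. zorder f p) :: complex) = of_int (\<Sum>p\<in>zeros_in (deriv f) D. zorder (deriv f) p)"
      using eq \<kappa>0 unfolding n1(2) n2(2) by simp
    hence "(\<Sum>p\<in>zeros_in f D. zorder f p) = (\<Sum>p\<in>zeros_in (deriv f) D. zorder (deriv f) p)"
      by (simp only: of_int_eq_iff)
    thus ?thesis unfolding n1(1) n2(1) by simp
  qed
qed

subsection \<open>Choice of the radius\<close>

text \<open>Transport the local factorization at \<rho> through s -> 1 - cnj s. The functional
  equation contributes the quotient \<open>P (1 - s) / P s\<close>, which has neither zeros nor
  poles in the strip, and the reflection contributes (-1)^n. The point \<open>w\<close> witnesses
  that zeta is not identically zero there.\<close>

lemma zorder_zeta_reflect:
  assumes \<rho>: "0 < Re \<rho>" "Re \<rho> < 1" and nz: "0 < Re w" "Re w < 1" "zeta w \<noteq> 0"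
  shows "zorder zeta (1 - cnj \<rho>) = zorder zeta \<rho>"
proof -
  define S where "S = {s::complex. 0 < Re s} \<inter> {s. Re s < 1}"
  have S: "open S" "connected S" unfolding S_def
    by (auto intro!: open_Int open_halfspace_Re_gt open_halfspace_Re_lt convex_connected convex_Int convex_halfspace_Re_gt convex_halfspace_Re_lt)
  have hol: "zeta holomorphic_on S" by (rule holomorphic_on_subset[OF holomorphic_zeta]) (auto simp: S_def)
  define n where "n = nat (zorder zeta \<rho>)"
  define g where "g = zor_poly zeta \<rho>"
  have ex: "\<exists>w\<in>S. zeta w \<noteq> 0" using nz by (auto simp: S_def)
  have \<rho>S: "\<rho> \<in> S" using \<rho> by (auto simp: S_def)
  note ze = zorder_exist_zero[OF hol S \<rho>S ex]
  have n0: "zorder zeta \<rho> \<ge> 0" using conjunct1[OF ze] by (simp split: if_splits)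
  obtain r where r: "r > 0" "cball \<rho> r \<subseteq> S" "g holomorphic_on cball \<rho> r" "\<And>w. w \<in> cball \<rho> r \<Longrightarrow> zeta w = g w * (w - \<rho>) ^ n \<and> g w \<noteq> 0"
    using conjunct2[OF ze] unfolding n_def g_def by blast
  define \<rho>' where "\<rho>' = 1 - cnj \<rho>"
  have refl: "1 - cnj s \<in> ball \<rho> r" if "s \<in> ball \<rho>' r" for s
  proof -
    have "\<rho> - (1 - cnj s) = - cnj (\<rho>' - s)" by (simp add: \<rho>'_def)
    hence "norm (\<rho> - (1 - cnj s)) = norm (\<rho>' - s)" by (simp only: norm_minus_cancel complex_mod_cnj)
    thus ?thesis using that by (simp add: dist_norm)
  qed
  have strip: "0 < Re s \<and> Re s < 1" if "s \<in> ball \<rho>' r" for s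
    using subsetD[OF r(2), of "1 - cnj s"] refl[OF that] by (auto simp: S_def)
  define P where "P = (\<lambda>s. complex_of_real pi powr (- s / 2) * Gamma (s / 2))"
  have P0: "P s \<noteq> 0" if "0 < Re s" for s
    using that by (auto simp: P_def Gamma_eq_zero_iff elim!: nonpos_Ints_cases)
  have holP: "P holomorphic_on {s. 0 < Re s}"
    unfolding P_def by (intro holomorphic_intros) (auto elim!: nonpos_Ints_cases simp: complex_eq_iff)
  define g' where "g' = (\<lambda>s. cnj (g (1 - cnj s)))"
  have holg: "g' holomorphic_on ball \<rho>' r"
  proof -
    have "(\<lambda>s. g (1 - s)) holomorphic_on cnj ` ball \<rho>' r"
    proof -
      have "g \<circ> (\<lambda>s. 1 - s) holomorphic_on cnj ` ball \<rho>' r"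
        by (rule holomorphic_on_compose_gen[OF _ r(3)]) (use refl in \<open>auto intro!: holomorphic_intros simp: less_imp_le[OF refl[unfolded mem_ball]]\<close>)
      thus ?thesis by (simp add: o_def)
    qed
    from holomorphic_on_compose_cnj_cnj[OF this] show ?thesis by (simp add: o_def g'_def)
  qed
  have "zorder zeta \<rho>' = int n"
  proof (rule zorder_eqI[of "ball \<rho>' r" _ "\<lambda>s. P (1 - s) / P s * g' s * (-1) ^ n"])
    have "P \<circ> (\<lambda>s. 1 - s) holomorphic_on ball \<rho>' r"
      by (rule holomorphic_on_compose_gen[OF _ holP]) (use strip in \<open>auto intro!: holomorphic_intros\<close>)
    hence "(\<lambda>s. P (1 - s)) holomorphic_on ball \<rho>' r" by (simp add: o_def)
    moreover have "P holomorphic_on ball \<rho>' r" by (rule holomorphic_on_subset[OF holP]) (use strip in auto)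
    ultimately show "(\<lambda>s. P (1 - s) / P s * g' s * (-1) ^ n) holomorphic_on ball \<rho>' r"
      using strip P0 by (intro holomorphic_intros holg) blast+
    have "\<rho>' \<in> ball \<rho>' r" using r(1) by simp
    note strip[OF this]
    moreover have "g' \<rho>' \<noteq> 0" using r(1) r(4)[of \<rho>] by (simp add: g'_def \<rho>'_def)
    ultimately show "P (1 - \<rho>') / P \<rho>' * g' \<rho>' * (-1) ^ n \<noteq> 0" using P0[of \<rho>'] P0[of "1 - \<rho>'"] by auto
    fix s assume s: "s \<in> ball \<rho>' r"
    have "P s * zeta s = P (1 - s) * zeta (1 - s)"
      unfolding P_def using strip[OF s] by (intro zeta_symmetric_functional_equation) auto
    also have "zeta (1 - s) = cnj (zeta (1 - cnj s))"
      using zeta_cnj[of "1 - cnj s"] strip[OF s] by simp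
    also have "zeta (1 - cnj s) = g (1 - cnj s) * ((1 - cnj s) - \<rho>) ^ n"
      using r(4)[of "1 - cnj s"] refl[OF s] by auto
    also have "cnj (g (1 - cnj s) * ((1 - cnj s) - \<rho>) ^ n) = g' s * (-1) ^ n * (s - \<rho>') ^ n"
    proof -
      have "cnj ((1 - cnj s) - \<rho>) = - 1 * (s - \<rho>')" by (simp add: \<rho>'_def)
      thus ?thesis by (simp only: complex_cnj_mult complex_cnj_power g'_def power_mult_distrib mult.assoc)
    qed
    finally have "P s * zeta s = P (1 - s) * (g' s * (-1) ^ n * (s - \<rho>') ^ n)" .
    thus "zeta s = P (1 - s) / P s * g' s * (-1) ^ n * (s - \<rho>') powi int n"
      using P0[of s] strip[OF s] by (simp add: field_simps)
  qed (use r in auto)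
  thus ?thesis using n0 by (simp add: n_def \<rho>'_def)
qed

text \<open>Pigeonhole: with ratio 1 / (4L) the open windows from R_j / 4 to L R_j around the
  candidate radii R_j are disjoint, as L R_(j+1) = R_j / 4. One more candidate than elements of V
  leaves a window empty.\<close>

lemma geometric_gap:
  fixes V :: "real set"
  assumes fin: "finite V" and R: "R > 0" and L: "L \<ge> 1"
  shows "\<exists>j\<le>card V. \<forall>v\<in>V. v \<le> R * (1 / (4 * L)) ^ j / 4 \<or> v \<ge> L * (R * (1 / (4 * L)) ^ j)"
proof (rule ccontr)
  define q where "q = 1 / (4 * L)"
  assume "\<not> ?thesis"
  hence "\<forall>j\<in>{..card V}. \<exists>v. v \<in> V \<and> R * q ^ j / 4 < v \<and> v < L * (R * q ^ j)" unfolding q_def by force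
  from bchoice[OF this] obtain g where "\<forall>j\<in>{..card V}. g j \<in> V \<and> R * q ^ j / 4 < g j \<and> g j < L * (R * q ^ j)" by blast
  hence g: "\<And>j. j \<le> card V \<Longrightarrow> g j \<in> V \<and> R * q ^ j / 4 < g j \<and> g j < L * (R * q ^ j)" by blast
  have q: "0 < q" "q \<le> 1" "L * q = 1 / 4" using L by (auto simp: q_def)
  have anti: "g j < g i" if "i < j" "j \<le> card V" for i j
  proof -
    have "g j < L * (R * q ^ j)" using g that by auto
    also have "\<dots> \<le> L * (R * q ^ Suc i)" using q R L that by (intro mult_left_mono power_decreasing) auto
    also have "\<dots> = R * q ^ i / 4" using q(3) by (simp add: mult_ac)
    also have "\<dots> < g i" using g[of i] that by auto
    finally show ?thesis .
  qed
  have "inj_on g {..card V}"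
  proof (rule inj_onI)
    fix i j assume "i \<in> {..card V}" "j \<in> {..card V}" "g i = g j"
    thus "i = j" using anti[of i j] anti[of j i] by (cases i j rule: linorder_cases) auto
  qed
  hence "card {..card V} \<le> card V" using g fin by (intro card_inj_on_le) auto
  thus False by simp
qed

context critical_zeros
begin

text \<open>The scales exp (- X), exp (- X / 3) and exp (- X / 6) are the smallest radius, the
  threshold for a close zero and the largest radius. \<open>c1\<close> keeps r below \<delta>,
  \<open>c2\<close> bounds the cost of h, \<open>c3\<close> handles the case without a close zero,
  and \<open>c4\<close> says that all candidate radii fit above the threshold.\<close>

lemma exists_good_radius:
  assumes X: "X > 0" and ND: "N = D" "D \<ge> 0"
    and c1: "exp (- X / 6) < \<delta>" and c2: "12 * D * exp (- X / 6) \<le> 1" and c3: "16 * D \<le> exp (X / 3)"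
    and c4: "ln 4 + D * ln (28 * (D + 1)) \<le> X / 6"
  obtains r where "exp (- X) \<le> r" "r \<le> exp (- X / 6)"
    "\<And>s. norm (s - s0) = r \<Longrightarrow> Re s \<le> 1/2 \<Longrightarrow> f s \<noteq> 0 \<and> Re (deriv f s / f s) < 0"
proof (cases "\<exists>\<rho>\<in>Z. norm (\<rho> - s0) < exp (- X / 3)")
  case False
  define r where "r = exp (- X)"
  \<comment> \<open>Chosen so that L * r is the threshold exp (- X / 3); then L^2 * r = exp (X / 3),
    which \<open>c3\<close> compares with 16 N.\<close>
  define L where "L = exp (2 * X / 3)"
  have ln4: "ln 4 \<ge> (1::real)"
  proof -
    have "exp 1 \<le> (4::real)" using exp_le by linarith
    thus ?thesis by (simp add: ln_ge_iff)
  qed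
  have rle: "r \<le> exp (- X / 6)" using X by (simp add: r_def)
  show ?thesis
  proof (rule that[of r])
    show "exp (- X) \<le> r" by (simp add: r_def)
    show "r \<le> exp (- X / 6)" by (rule rle)
    fix s assume s: "norm (s - s0) = r" "Re s \<le> 1/2"
    show "f s \<noteq> 0 \<and> Re (deriv f s / f s) < 0"
    proof (rule Re_logderiv_arc_neg[of r L])
      show "r < \<delta>" using rle c1 by linarith
      have "D * ln (28 * (D + 1)) \<ge> 0" using ND by (intro mult_nonneg_nonneg) auto
      hence "X \<ge> 6" using c4 ln4 by linarith
      hence "2 * X / 3 \<ge> 1" by simp
      hence "L \<ge> exp 1" by (simp add: L_def)
      thus "L \<ge> 2" using exp_ge_add_one_self[of 1] by simp
      have Lr: "L * r = exp (- X / 3)" by (simp add: L_def r_def field_simps flip: exp_add)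
      show "norm (\<rho> - s0) \<le> r / 4 \<or> L * r \<le> norm (\<rho> - s0)" if "\<rho> \<in> Z" for \<rho>
        using False that unfolding Lr by (auto simp: not_less)
      have "4 * r * D \<le> 12 * D * exp (- X / 6)"
        using mult_mono[of "4 * D" "12 * D" r "exp (- X / 6)"] rle ND by (simp add: r_def mult_ac)
      hence "4 * r * D \<le> 1" using c2 by linarith
      moreover have "L\<^sup>2 * r = exp (X / 3)" by (simp add: L_def r_def power2_eq_square flip: exp_add)
      ultimately show "(\<exists>\<rho>\<in>Z. norm (\<rho> - s0) \<le> r / 4) \<and> 12 * r\<^sup>2 * D \<le> 1 \<and> 48 * N \<le> L\<^sup>2 \<or> 4 * r * D \<le> 1 \<and> 16 * N \<le> L\<^sup>2 * r"
        using c3 ND by simp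
    qed (use s in \<open>auto simp: r_def\<close>)
  qed
next
  case True
  then obtain \<rho>0 where \<rho>0: "\<rho>0 \<in> Z" "norm (\<rho>0 - s0) < exp (- X / 3)" by blast
  \<comment> \<open>The factor 7 gives L^2 >= 49 (D + 1)^2 >= 48 N, and 4L = 28 (D + 1) is the ratio
    of consecutive candidate radii.\<close>
  define L where "L = 7 * (D + 1)"
  define V where "V = (\<lambda>\<rho>. norm (\<rho> - s0)) ` Z"
  have L: "L \<ge> 7" using ND by (simp add: L_def)
  have "\<exists>j\<le>card V. \<forall>v\<in>V. v \<le> exp (- X / 6) * (1 / (4 * L)) ^ j / 4 \<or> v \<ge> L * (exp (- X / 6) * (1 / (4 * L)) ^ j)"
    by (rule geometric_gap) (use finZ L in \<open>auto simp: V_def\<close>)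
  then obtain j where j: "j \<le> card V" and gap: "\<And>v. v \<in> V \<Longrightarrow> v \<le> exp (- X / 6) * (1 / (4 * L)) ^ j / 4 \<or> v \<ge> L * (exp (- X / 6) * (1 / (4 * L)) ^ j)"
    by blast
  define r where "r = exp (- X / 6) * (1 / (4 * L)) ^ j"
  have jN: "real j \<le> D"
  proof -
    have "card V \<le> card Z" unfolding V_def using finZ by (rule card_image_le)
    also have "card Z = (\<Sum>\<rho>\<in>Z. 1)" by simp
    also have "\<dots> \<le> (\<Sum>\<rho>\<in>Z. m \<rho>)" using m1 by (intro sum_mono) auto
    finally have "real j \<le> real (\<Sum>\<rho>\<in>Z. m \<rho>)" using j by linarith
    thus ?thesis using mN ND by linarith
  qed
  have r: "r > 0" "r \<le> exp (- X / 6)"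
  proof -
    show "r > 0" using L by (simp add: r_def)
    have "(1 / (4 * L)) ^ j \<le> 1" using L by (intro power_le_one) auto
    thus "r \<le> exp (- X / 6)" using mult_left_mono[of "(1 / (4 * L)) ^ j" 1 "exp (- X / 6)"] by (simp add: r_def)
  qed
  \<comment> \<open>At most D shrinkings by 4L occur, so even the smallest candidate keeps the close
    zero inside radius r/4.\<close>
  have r4: "exp (- X / 3) \<le> r / 4"
  proof -
    have "(1 / (4 * L)) ^ j = exp (- (real j * ln (4 * L)))"
      using L by (simp add: exp_minus exp_of_nat_mult power_one_over inverse_eq_divide)
    hence "r / 4 = exp (- X / 6) * exp (- (real j * ln (4 * L))) * exp (- ln 4)" 
      by (simp add: r_def exp_minus)
    also have "\<dots> = exp (- X / 6 - real j * ln (4 * L) - ln 4)"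
      by (simp flip: exp_add)
    also have "\<dots> \<ge> exp (- X / 3)"
    proof -
      have "4 * L = 28 * (D + 1)" by (simp add: L_def)
      moreover have "real j * ln (4 * L) \<le> D * ln (4 * L)" using jN L by (intro mult_right_mono) auto
      ultimately have "ln 4 + real j * ln (4 * L) \<le> X / 6" using c4 by simp
      thus ?thesis by simp
    qed
    finally show ?thesis .
  qed
  show ?thesis
  proof (rule that[of r])
    have "exp (- X) \<le> exp (- X / 3)" using X by simp
    thus "exp (- X) \<le> r" using r4 r by linarith
    show "r \<le> exp (- X / 6)" by (rule r)
    fix s assume s: "norm (s - s0) = r" "Re s \<le> 1/2"
    show "f s \<noteq> 0 \<and> Re (deriv f s / f s) < 0"
    proof (rule Re_logderiv_arc_neg[of r L])
      show "r < \<delta>" using r c1 by linarith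
      show "norm (\<rho> - s0) \<le> r / 4 \<or> L * r \<le> norm (\<rho> - s0)" if "\<rho> \<in> Z" for \<rho>
        using gap[of "norm (\<rho> - s0)"] that by (auto simp: V_def r_def)
      have "r \<le> 1" using r X by (meson exp_le_one_iff divide_le_0_iff neg_le_0_iff_le less_imp_le order_trans zero_le_numeral)
      hence "r\<^sup>2 \<le> r" using r by (simp add: power2_eq_square mult_left_le)
      hence "12 * r\<^sup>2 * D \<le> 12 * D * exp (- X / 6)"
        using mult_mono[of "12 * D" "12 * D" "r\<^sup>2" "exp (- X / 6)"] r ND by (simp add: mult_ac)
      hence "12 * r\<^sup>2 * D \<le> 1" using c2 by linarith
      moreover have "48 * N \<le> L\<^sup>2" 
      proof -
        have "L\<^sup>2 = 49 * D\<^sup>2 + 98 * D + 49" by (simp add: L_def power2_eq_square algebra_simps)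
        thus ?thesis using ND zero_le_power2[of D] by linarith
      qed
      moreover have "norm (\<rho>0 - s0) \<le> r / 4" using \<rho>0 r4 by linarith
      ultimately show "(\<exists>\<rho>\<in>Z. norm (\<rho> - s0) \<le> r / 4) \<and> 12 * r\<^sup>2 * D \<le> 1 \<and> 48 * N \<le> L\<^sup>2 \<or> 4 * r * D \<le> 1 \<and> 16 * N \<le> L\<^sup>2 * r"
        using \<rho>0(1) by blast
    qed (use s r L in auto)
  qed
qed

text \<open>Finitely many zeros of f and f' lie strictly left of the line, so a chord close enough
  to it cuts off none of them; the arc carries no zeros. Counting in the open segment is therefore
  the same as counting in the half disc.\<close>

lemma num_zeros_left_half_disc:
  assumes A: "open A" "connected A" "f holomorphic_on A" "cball s0 \<delta> \<subseteq> A"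
    and r: "0 < r" "r < \<delta>"
    and arc: "\<And>s. norm (s - s0) = r \<Longrightarrow> Re s \<le> 1/2 \<Longrightarrow> f s \<noteq> 0 \<and> Re (deriv f s / f s) < 0"
  defines "H \<equiv> {s. norm (s - s0) \<le> r \<and> Re s < 1/2}"
  shows "finite (zeros_in f H) \<and> finite (zeros_in (deriv f) H) \<and> num_zeros f H = num_zeros (deriv f) H"
proof -
  \<comment> \<open>The leftmost point of the circle: neither f nor f' vanishes there, so neither is
    identically zero and both have finitely many zeros in the closed disc.\<close>
  define w where "w = s0 - of_real r"
  have w: "norm (w - s0) = r" "Re w \<le> 1/2" "w \<in> A"
    using r A(4) Re0 by (auto simp: w_def dist_norm)
  have fw: "f w \<noteq> 0" "deriv f w \<noteq> 0" using arc[OF w(1,2)] by auto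
  have hd: "deriv f holomorphic_on A" by (intro holomorphic_deriv A)
  have finf: "finite {z \<in> cball s0 \<delta>. f z = 0}" "finite {z \<in> cball s0 \<delta>. deriv f z = 0}"
    using finite_zeros_compact[OF A(3,1,2) compact_cball A(4) w(3) fw(1)] finite_zeros_compact[OF hd A(1,2) compact_cball A(4) w(3) fw(2)] by auto
  have HR: "H \<subseteq> cball s0 \<delta>" using r by (auto simp: H_def dist_norm norm_minus_commute)
  have fin: "finite (zeros_in f H)" "finite (zeros_in (deriv f) H)"
    unfolding zeros_in_def by (rule finite_subset[OF _ finf(1)] finite_subset[OF _ finf(2)]; use HR in auto)+
  have "eventually (\<lambda>\<epsilon>. \<forall>z\<in>zeros_in f H \<union> zeros_in (deriv f) H. Re z < 1/2 - \<epsilon>) (at_right (0::real))"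
  proof (rule eventually_ball_finite, use fin in simp, rule ballI)
    fix z assume "z \<in> zeros_in f H \<union> zeros_in (deriv f) H"
    hence "1/2 - Re z > 0" by (auto simp: zeros_in_def H_def)
    thus "eventually (\<lambda>\<epsilon>. Re z < 1/2 - \<epsilon>) (at_right (0::real))"
      by (auto simp: eventually_at_right_field intro!: exI[of _ "1/2 - Re z"])
  qed
  moreover have "eventually (\<lambda>\<epsilon>. \<epsilon> < r) (at_right (0::real))"
    using r by (auto simp: eventually_at_right_field intro!: exI[of _ r])
  moreover have "eventually (\<lambda>\<epsilon>. \<epsilon> > 0) (at_right (0::real))" by (rule eventually_at_right_less)
  moreover note Re_logderiv_chord_neg[OF r]
  ultimately have "eventually (\<lambda>\<epsilon>. (\<forall>z\<in>zeros_in f H \<union> zeros_in (deriv f) H. Re z < 1/2 - \<epsilon>) \<and> \<epsilon> < r \<and> \<epsilon> > 0 \<and>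
     (\<forall>s. norm (s - s0) \<le> r \<longrightarrow> Re s = 1/2 - \<epsilon> \<longrightarrow> f s \<noteq> 0 \<and> Re (deriv f s / f s) < 0)) (at_right 0)"
    by eventually_elim auto
  from eventually_happens'[OF _ this] obtain \<epsilon> where e: "\<And>z. z \<in> zeros_in f H \<union> zeros_in (deriv f) H \<Longrightarrow> Re z < 1/2 - \<epsilon>" "\<epsilon> < r" "\<epsilon> > 0"
     and chord: "\<And>s. norm (s - s0) \<le> r \<Longrightarrow> Re s = 1/2 - \<epsilon> \<Longrightarrow> f s \<noteq> 0 \<and> Re (deriv f s / f s) < 0"
    by auto
  define E where "E = {s. norm (s - s0) < r \<and> Re s < Re s0 - \<epsilon>}"
  have "num_zeros f E = num_zeros (deriv f) E"
    unfolding E_def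
  proof (rule num_zeros_deriv_eq_of_Re_logderiv_neg)
    have "ball s0 \<delta> \<subseteq> A" using A(4) ball_subset_cball by blast
    thus "f holomorphic_on ball s0 \<delta>" by (rule holomorphic_on_subset[OF A(3)])
    show "finite {z \<in> ball s0 \<delta>. f z = 0}" "finite {z \<in> ball s0 \<delta>. deriv f z = 0}"
      by (rule finite_subset[OF _ finf(1)] finite_subset[OF _ finf(2)]; auto)+
    show "f s \<noteq> 0 \<and> Re (deriv f s / f s) < 0" if "norm (s - s0) = r" "Re s \<le> Re s0 - \<epsilon>" for s
      using arc[of s] that e Re0 by auto
    show "f s \<noteq> 0 \<and> Re (deriv f s / f s) < 0" if "norm (s - s0) \<le> r" "Re s = Re s0 - \<epsilon>" for s
      using chord[of s] that Re0 by auto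
  qed (use r e in auto)
  moreover have "zeros_in f E = zeros_in f H"
    using e(1,3) arc Re0 by (fastforce simp: zeros_in_def E_def H_def)
  moreover have "zeros_in (deriv f) E = zeros_in (deriv f) H"
  proof (rule set_eqI)
    fix z
    show "z \<in> zeros_in (deriv f) E \<longleftrightarrow> z \<in> zeros_in (deriv f) H"
      using e(1)[of z] e(3) arc[of z] Re0 by (auto simp: zeros_in_def E_def H_def less_le)
  qed
  ultimately show ?thesis using fin by (simp add: num_zeros_def)
qed

end

text \<open>A positive power of T dominates log T * log log T. The bound 6 serves to turn division
  by T^0.17 into division by 6.\<close>

lemma eventually_size_conditions:
  assumes "C > (0::real)"
  shows "eventually (\<lambda>T. T powr 0.17 \<ge> 6 \<and> exp (- (T powr 0.17) / 6) < 1/1000 \<and> 12 * (C * ln T) * exp (- (T powr 0.17) / 6) \<le> 1 \<and>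
     16 * (C * ln T) \<le> exp (T powr 0.17 / 3) \<and> ln 4 + C * ln T * ln (28 * (C * ln T + 1)) \<le> T powr 0.17 / 6) at_top"
proof (intro eventually_conj)
  show "eventually (\<lambda>T::real. T powr 0.17 \<ge> 6) at_top" by real_asymp
  show "eventually (\<lambda>T::real. exp (- (T powr 0.17) / 6) < 1/1000) at_top" by real_asymp
  show "eventually (\<lambda>T::real. 12 * (C * ln T) * exp (- (T powr 0.17) / 6) \<le> 1) at_top" by real_asymp
  show "eventually (\<lambda>T::real. 16 * (C * ln T) \<le> exp (T powr 0.17 / 3)) at_top" using assms by real_asymp
  show "eventually (\<lambda>T::real. ln 4 + C * ln T * ln (28 * (C * ln T + 1)) \<le> T powr 0.17 / 6) at_top" using assms by real_asymp
qed

theorem theorem1: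
  "\<exists>T\<^sub>0::real. T\<^sub>0 > 0 \<and>
     (\<forall>T A :: real. T > T\<^sub>0 \<longrightarrow> A > 0.17 \<longrightarrow>
        (\<exists>r::real. exp (- (T powr A)) \<le> r \<and> r \<le> exp (- (T powr (A - 0.17))) \<and>
           finite (zeros_in zeta (left_half_disc T r)) \<and>
           finite (zeros_in (deriv zeta) (left_half_disc T r)) \<and>
           num_zeros zeta (left_half_disc T r) = num_zeros (deriv zeta) (left_half_disc T r)))"
proof -
  obtain C t1 where C: "C > 0" and t1: "t1 \<ge> 3" and near: "\<And>T. T \<ge> t1 \<Longrightarrow> \<exists>Z m h. 
     Z = {s \<in> cball (Complex (1/2) T) (1/500). zeta s = 0} \<and> finite Z \<and> 
     (\<forall>\<rho>\<in>Z. m \<rho> \<ge> (1::nat) \<and> zorder zeta \<rho> = int (m \<rho>)) \<and> real (\<Sum>\<rho>\<in>Z. m \<rho>) \<le> C * ln T \<and>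
     h holomorphic_on ball (Complex (1/2) T) (1/1000) \<and>
     (\<forall>s\<in>ball (Complex (1/2) T) (1/1000). zeta s \<noteq> 0 \<longrightarrow> deriv zeta s / zeta s = (\<Sum>\<rho>\<in>Z. of_nat (m \<rho>) / (s - \<rho>)) + h s) \<and>
     (\<forall>s\<in>ball (Complex (1/2) T) (1/1000). norm (deriv h s) \<le> C * ln T)"
    using zeta_near_critical_point by blast
  obtain t2 where t2: "t2 > 0" "\<And>t. t \<ge> t2 \<Longrightarrow> zeta (Complex (1/2) t) \<noteq> 0 \<Longrightarrow> Re (deriv zeta (Complex (1/2) t) / zeta (Complex (1/2) t)) \<le> -1"
    using zeta_logderiv_critical_line by blast
  obtain t3 where t3: "\<And>T. T \<ge> t3 \<Longrightarrow> T powr 0.17 \<ge> 6 \<and> exp (- (T powr 0.17) / 6) < 1/1000 \<and> 12 * (C * ln T) * exp (- (T powr 0.17) / 6) \<le> 1 \<and>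
     16 * (C * ln T) \<le> exp (T powr 0.17 / 3) \<and> ln 4 + C * ln T * ln (28 * (C * ln T + 1)) \<le> T powr 0.17 / 6"
    using eventually_size_conditions[OF C] by (auto simp: eventually_at_top_linorder)
  define T0 where "T0 = max t1 (max (t2 + 1) t3)"
  show ?thesis
  proof (rule exI[of _ T0], intro conjI allI impI)
    show "T0 > 0" using t1 by (simp add: T0_def)
    fix T A :: real assume T: "T > T0" and A: "A > 0.17"
    have T': "T \<ge> t1" "T \<ge> t2 + 1" "T \<ge> t3" "T \<ge> 3" using T t1 by (auto simp: T0_def)
    define s0 where "s0 = Complex (1/2) T"
    define D where "D = C * ln T"
    have D0: "D \<ge> 0" using C T' by (simp add: D_def)
    define Y where "Y = T powr 0.17"
    define X where "X = T powr A"
    note Y = t3[OF T'(3), folded Y_def D_def]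
    \<comment> \<open>The size conditions are known for Y only, with a threshold independent of A;
      they pass to the larger X by monotonicity.\<close>
    have XY: "X \<ge> Y" using T' A by (simp add: X_def Y_def powr_mono)
    have X6: "T powr (A - 0.17) \<le> X / 6"
    proof -
      have "T powr (A - 0.17) = X / Y" by (simp add: X_def Y_def powr_diff)
      also have "\<dots> \<le> X / 6" using Y by (intro divide_left_mono mult_pos_pos) (auto simp: X_def)
      finally show ?thesis .
    qed
    obtain Z m h where Z: "Z = {s \<in> cball s0 (1/500). zeta s = 0}" and finZ: "finite Z"
     and m: "\<And>\<rho>. \<rho> \<in> Z \<Longrightarrow> m \<rho> \<ge> (1::nat) \<and> zorder zeta \<rho> = int (m \<rho>)" and mN: "real (\<Sum>\<rho>\<in>Z. m \<rho>) \<le> D"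
     and h: "h holomorphic_on ball s0 (1/1000)"
     and ex: "\<And>s. s \<in> ball s0 (1/1000) \<Longrightarrow> zeta s \<noteq> 0 \<Longrightarrow> deriv zeta s / zeta s = (\<Sum>\<rho>\<in>Z. of_nat (m \<rho>) / (s - \<rho>)) + h s"
     and dh: "\<And>s. s \<in> ball s0 (1/1000) \<Longrightarrow> norm (deriv h s) \<le> D"
      using near[OF T'(1)] unfolding s0_def D_def by blast
    define S where "S = {s::complex. 0 < Re s} \<inter> {s. Re s < 1}"
    have S: "open S" "connected S" unfolding S_def
      by (auto intro!: open_Int open_halfspace_Re_gt open_halfspace_Re_lt convex_connected convex_Int convex_halfspace_Re_gt convex_halfspace_Re_lt)
    have holz: "zeta holomorphic_on S" by (rule holomorphic_on_subset[OF holomorphic_zeta]) (auto simp: S_def)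
    have cS: "cball s0 (1/500) \<subseteq> S"
    proof
      fix s assume "s \<in> cball s0 (1/500)"
      hence "\<bar>Re (s0 - s)\<bar> \<le> 1/500" using abs_Re_le_cmod[of "s0 - s"] by (simp add: dist_norm)
      hence "\<bar>1/2 - Re s\<bar> \<le> 1/500" by (simp add: s0_def)
      hence "0 < Re s" "Re s < 1" by linarith+
      thus "s \<in> S" by (simp add: S_def)
    qed
    \<comment> \<open>A disc is infinite and \<open>Z\<close> is finite, so some point of the disc
      is not a zero.\<close>
    have "\<exists>w\<in>cball s0 (1/500). zeta w \<noteq> 0"
    proof (rule ccontr)
      assume "\<not> ?thesis"
      hence "cball s0 (1/500) \<subseteq> Z" by (auto simp: Z)
      moreover have "infinite (cball s0 (1/500))"
        using uncountable_cball[of "1/500" s0] countable_finite by auto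
      ultimately show False using finZ finite_subset by blast
    qed
    then obtain w where w: "w \<in> S" "zeta w \<noteq> 0" using cS by blast
    interpret critical_zeros zeta s0 Z m h "1/1000" D D
    proof
      show "Re s0 = 1/2" by (simp add: s0_def)
      show "zeta \<rho> = 0" if "\<rho> \<in> Z" for \<rho> using that by (simp add: Z)
      show "s \<in> Z" if "s \<in> ball s0 (1/1000)" "zeta s = 0" for s using that by (simp add: Z)
      show "1 - cnj \<rho> \<in> Z \<and> m (1 - cnj \<rho>) = m \<rho>" if \<rho>: "\<rho> \<in> Z" for \<rho>
      proof -
        have strip: "0 < Re \<rho>" "Re \<rho> < 1" using \<rho> cS by (auto simp: Z S_def)
        have "s0 - (1 - cnj \<rho>) = - cnj (s0 - \<rho>)" by (simp add: s0_def complex_eq_iff)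
        hence "norm (s0 - (1 - cnj \<rho>)) = norm (s0 - \<rho>)" by (simp only: norm_minus_cancel complex_mod_cnj)
        moreover have zo: "zorder zeta (1 - cnj \<rho>) = zorder zeta \<rho>"
          using strip w by (intro zorder_zeta_reflect[of \<rho> w]) (auto simp: S_def)
        have "zeta (1 - cnj \<rho>) = 0"
        proof -
          have "of_real pi powr (- (1 - cnj \<rho>) / 2) * Gamma ((1 - cnj \<rho>) / 2) * zeta (1 - cnj \<rho>) = 
            of_real pi powr (- cnj \<rho> / 2) * Gamma (cnj \<rho> / 2) * zeta (cnj \<rho>)"
            using zeta_symmetric_functional_equation[of "1 - cnj \<rho>"] strip by simp
          also have "zeta (cnj \<rho>) = 0" using \<rho> strip by (subst zeta_cnj) (auto simp: Z)
          finally show ?thesis using strip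
            by (auto simp: Gamma_eq_zero_iff elim!: nonpos_Ints_cases) (auto simp: complex_eq_iff)
        qed
        ultimately have Z': "1 - cnj \<rho> \<in> Z" using \<rho> by (simp add: Z dist_norm)
        thus ?thesis using m[OF \<rho>] m[OF Z'] zo by simp
      qed
      show "Re (deriv zeta s / zeta s) \<le> -1" if "s \<in> ball s0 (1/1000)" "Re s = 1/2" "zeta s \<noteq> 0" for s
      proof -
        have "s = Complex (1/2) (Im s)" using that by (simp add: complex_eq_iff)
        moreover have "Im s \<ge> t2" using that(1) T'(2) abs_Im_le_cmod[of "s0 - s"] by (simp add: dist_norm s0_def abs_le_iff)
        ultimately show ?thesis using t2(2)[of "Im s"] that(3) by simp
      qed
    qed (use finZ m mN h ex dh in auto)
    have le: "exp (- X / 6) \<le> exp (- Y / 6)" using XY by simp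
    obtain r where r: "exp (- X) \<le> r" "r \<le> exp (- X / 6)"
      and arc: "\<And>s. norm (s - s0) = r \<Longrightarrow> Re s \<le> 1/2 \<Longrightarrow> zeta s \<noteq> 0 \<and> Re (deriv zeta s / zeta s) < 0"
    proof (rule exists_good_radius[of X])
      show "X > 0" using XY Y by linarith
      show "exp (- X / 6) < 1 / 1000" using le Y by linarith
      show "12 * D * exp (- X / 6) \<le> 1" using mult_left_mono[OF le, of "12 * D"] D0 Y by simp
      have "exp (Y / 3) \<le> exp (X / 3)" using XY by simp
      thus "16 * D \<le> exp (X / 3)" using Y by linarith
      show "ln 4 + D * ln (28 * (D + 1)) \<le> X / 6" using XY Y by linarith
    qed (use D0 in auto)
    have r0: "0 < r" "r < 1/1000" using less_le_trans[OF exp_gt_zero r(1)] r(2) le Y by linarith+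
    have H: "left_half_disc T r = {s. norm (s - s0) \<le> r \<and> Re s < 1/2}" by (simp add: left_half_disc_def s0_def)
    have cS': "cball s0 (1/1000) \<subseteq> S" using cS by (auto intro: order_trans)
    note main = num_zeros_left_half_disc[OF S holz cS' r0 arc, folded H]
    have "exp (- (T powr A)) \<le> r" using r by (simp add: X_def)
    moreover have "r \<le> exp (- (T powr (A - 0.17)))"
    proof (rule order_trans[OF r(2)])
      show "exp (- X / 6) \<le> exp (- (T powr (A - 0.17)))" using X6 by simp
    qed
    ultimately show "\<exists>r. exp (- (T powr A)) \<le> r \<and> r \<le> exp (- (T powr (A - 0.17))) \<and>
           finite (zeros_in zeta (left_half_disc T r)) \<and>
           finite (zeros_in (deriv zeta) (left_half_disc T r)) \<and>
           num_zeros zeta (left_half_disc T r) = num_zeros (deriv zeta) (left_half_disc T r)"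
      using main by blast
  qed
qed

end
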